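(* Each mass-structural equivalence class of rooted, weighted $\mathbb{R}$-trees contains exactly one isomorphism class of interval partition trees (IP trees).
   Context: A real tree ($\mathbb{R}$-tree) is a complete, separable, bounded metric space $(\mathcal{T},d)$ such that (i) for all $x,y\in\mathcal{T}$ there is a unique non-self-intersecting path in $\mathcal{T}$ from $x$ to $y$, called the segment $[[x,y]]_{\mathcal{T}}$, and (ii) each segment is isometric to a closed real interval. Compactness is not required. A rooted, weighted $\mathbb{R}$-tree is a quadruple $(\mathcal{T},d,r,p)$ with $(\mathcal{T},d)$ an $\mathbb{R}$-tree, $r\in\mathcal{T}$ a distinguished vertex (the root), and $p$ a probability distribution on $\mathcal{T}$ with respect to the Borel $\sigma$-algebra generated by $d$. Two such trees are isomorphic if there exists a root- and weight-preserving isometry between them. The fringe subtree rooted at $x$ is $F_x(\mathcal{T}):=\{y\in\mathcal{T}: x\in[[r,y]]_{\mathcal{T}}\}$. A point $x$ is a branch point if there exist three non-trivial segments with endpoint $x$ whose pairwise intersections all equal $\{x\}$; it is a leaf if it is an endpoint of every segment to which it belongs. The subtree spanned by (the closed support of) $p$ is $\mathrm{Span}(p):=\bigcup_{x\in\mathrm{support}(p)}[[r,x]]_{\mathcal{T}}$. The special points of $(\mathcal{T},d,r,p)$ are: (a) the locations of atoms of $p$; (b) the branch points of $\mathrm{Span}(p)$; (c) the isolated leaves of $\mathrm{Span}(p)$, meaning leaves of $\mathrm{Span}(p)$ that are not limit points of the branch points of $\mathrm{Span}(p)$. Let $\mathscr{S}_i$ be the set of special points of $(\mathcal{T}_i,d_i,r_i,p_i)$,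 $i=1,2$. A mass-structural isomorphism between these trees is a bijection $\phi:\mathscr{S}_1\to\mathscr{S}_2$ such that: (i) for every $x\in\mathscr{S}_1$, $p_1([[r_1,x]]_{\mathcal{T}_1})=p_2([[r_2,\phi(x)]]_{\mathcal{T}_2})$, $p_1\{x\}=p_2\{\phi(x)\}$ and $p_1(F_x(\mathcal{T}_1))=p_2(F_{\phi(x)}(\mathcal{T}_2))$; (ii) for $x,y\in\mathscr{S}_1$, $x\in[[r_1,y]]_{\mathcal{T}_1}$ if and only if $\phi(x)\in[[r_2,\phi(y)]]_{\mathcal{T}_2}$. Two rooted, weighted $\mathbb{R}$-trees are mass-structurally equivalent if there exists a mass-structural isomorphism from one to the other; this is an equivalence relation. An interval partition tree (IP tree) is a rooted, weighted $\mathbb{R}$-tree $(\mathcal{T},d,r,p)$ with the following properties. Spanning: every leaf of $\mathcal{T}$ is in the closed support of $p$, i.e. $\mathcal{T}=\mathrm{Span}(p)$. Spacing: for $x\in\mathcal{T}$, if $x$ is either a branch point or lies in the closed support of $p$, then $d(r,x)+p(F_x(\mathcal{T}))=1$.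
   Formalization: Among the special points, the root is never counted as a leaf of Span(p), and it counts as a branch point as soon as two non-trivial segments meet only there; with the literal definitions the claim fails, e.g. for [0,1] rooted at 0 with p a unit mass at 1. *)

theory Defs
  imports "HOL-Probability.Probability"
begin

section \<open>Real trees\<close>

text \<open>
  \<open>S\<close> is the trace of a non-self-intersecting path from \<open>x\<close> to \<open>y\<close>. Paths are identified when
  they have the same trace, i.e. up to reparametrisation. The second disjunct admits the
  degenerate path, which (by \<open>g 0 = x\<close>, \<open>g 1 = y\<close>) is possible only if \<open>x = y\<close>.
\<close>

definition simple_path_trace :: "'a metric \<Rightarrow> 'a \<Rightarrow> 'a \<Rightarrow> 'a set \<Rightarrow> bool" where
  "simple_path_trace m x y S \<longleftrightarrow>
     (\<exists>g. pathin (mtopology_of m) g \<and> g 0 = x \<and> g 1 = y \<and> g ` {0..1} = S \<and>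
          (inj_on g {0..1} \<or> S = {x}))"

definition seg :: "'a metric \<Rightarrow> 'a \<Rightarrow> 'a \<Rightarrow> 'a set" where
  "seg m x y = (THE S. simple_path_trace m x y S)"

definition isometric_to_interval :: "'a metric \<Rightarrow> 'a set \<Rightarrow> bool" where
  "isometric_to_interval m S \<longleftrightarrow>
     (\<exists>(a::real) b f. a \<le> b \<and> f ` S = {a..b} \<and>
        (\<forall>u\<in>S. \<forall>v\<in>S. dist (f u) (f v) = mdist m u v))"

definition real_tree :: "'a metric \<Rightarrow> bool" where
  "real_tree m \<longleftrightarrow>
     mcomplete_of m \<and>
     separable_space (mtopology_of m) \<and>
     Metric_space.mbounded (mspace m) (mdist m) (mspace m) \<and>
     (\<forall>x\<in>mspace m. \<forall>y\<in>mspace m. \<exists>!S. simple_path_trace m x y S) \<and>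
     (\<forall>x\<in>mspace m. \<forall>y\<in>mspace m. isometric_to_interval m (seg m x y))"


section \<open>Rooted, weighted real trees\<close>

record 'a rw_tree =
  tree_metric :: "'a metric"
  tree_root :: 'a
  tree_mass :: "'a measure"

abbreviation tree_points :: "'a rw_tree \<Rightarrow> 'a set" where
  "tree_points T \<equiv> mspace (tree_metric T)"

abbreviation tree_dist :: "'a rw_tree \<Rightarrow> 'a \<Rightarrow> 'a \<Rightarrow> real" where
  "tree_dist T \<equiv> mdist (tree_metric T)"

abbreviation tree_top :: "'a rw_tree \<Rightarrow> 'a topology" where
  "tree_top T \<equiv> mtopology_of (tree_metric T)"

abbreviation tree_seg :: "'a rw_tree \<Rightarrow> 'a \<Rightarrow> 'a \<Rightarrow> 'a set" where
  "tree_seg T \<equiv> seg (tree_metric T)"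

definition rooted_weighted_tree :: "'a rw_tree \<Rightarrow> bool" where
  "rooted_weighted_tree T \<longleftrightarrow>
     real_tree (tree_metric T) \<and>
     tree_root T \<in> tree_points T \<and>
     prob_space (tree_mass T) \<and>
     space (tree_mass T) = tree_points T \<and>
     sets (tree_mass T) = sigma_sets (tree_points T) {U. openin (tree_top T) U}"

definition tree_isomorphism :: "'a rw_tree \<Rightarrow> 'b rw_tree \<Rightarrow> ('a \<Rightarrow> 'b) \<Rightarrow> bool" where
  "tree_isomorphism T1 T2 f \<longleftrightarrow>
     bij_betw f (tree_points T1) (tree_points T2) \<and>
     (\<forall>x\<in>tree_points T1. \<forall>y\<in>tree_points T1. tree_dist T2 (f x) (f y) = tree_dist T1 x y) \<and>
     f (tree_root T1) = tree_root T2 \<and>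
     distr (tree_mass T1) (tree_mass T2) f = tree_mass T2"

definition fringe_subtree :: "'a rw_tree \<Rightarrow> 'a \<Rightarrow> 'a set" where
  "fringe_subtree T x = {y \<in> tree_points T. x \<in> tree_seg T (tree_root T) y}"

text \<open>
  Branch points and leaves are taken relative to a set \<open>A\<close> of points of the tree, quantifying
  over the segments inside \<open>A\<close>. They are needed for the whole tree and for the subtree spanned
  by the mass, and the latter need not be closed, so that it is not always a real tree itself.
\<close>

definition segment_within :: "'a rw_tree \<Rightarrow> 'a set \<Rightarrow> 'a \<Rightarrow> 'a \<Rightarrow> bool" where
  "segment_within T A x y \<longleftrightarrow> x \<in> A \<and> y \<in> A \<and> tree_seg T x y \<subseteq> A"

definition branch_points :: "'a rw_tree \<Rightarrow> 'a set \<Rightarrow> 'a set" where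
  "branch_points T A =
     {x. \<exists>u v w. u \<noteq> x \<and> v \<noteq> x \<and> w \<noteq> x \<and>
        segment_within T A x u \<and> segment_within T A x v \<and> segment_within T A x w \<and>
        tree_seg T x u \<inter> tree_seg T x v = {x} \<and>
        tree_seg T x u \<inter> tree_seg T x w = {x} \<and>
        tree_seg T x v \<inter> tree_seg T x w = {x}}"

definition leaves :: "'a rw_tree \<Rightarrow> 'a set \<Rightarrow> 'a set" where
  "leaves T A =
     {x \<in> A. \<forall>u v. segment_within T A u v \<and> x \<in> tree_seg T u v \<longrightarrow> x = u \<or> x = v}"

definition closed_support :: "'a rw_tree \<Rightarrow> 'a set" where
  "closed_support T =
     {x \<in> tree_points T. \<forall>U. openin (tree_top T) U \<and> x \<in> U \<longrightarrow> measure (tree_mass T) U > 0}"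

definition mass_span :: "'a rw_tree \<Rightarrow> 'a set" where
  "mass_span T = (\<Union>x\<in>closed_support T. tree_seg T (tree_root T) x)"


section \<open>Mass-structural equivalence\<close>

text \<open>
  Convention at the root: it is treated as if one more edge were attached below it. So the root
  is a branch point as soon as two non-trivial segments meet only there, and it is
  never a leaf. No other point is affected. Without this convention there are classes with
  no interval partition tree.

  First, let \<open>[0, 1]\<close> be rooted at \<open>0\<close> and have mass \<open>1\<close> at \<open>1\<close>. If the root were an isolated
  leaf there would be two special points, but the only candidate for the representative is
  the one-point tree.

  Second, take an edge from the root to a vertex carrying two further edges, each ending in
  an atom of mass \<open>1/2\<close>. It has three special points; the only candidate for the representative
  has the branch point at height \<open>0\<close>, i.e. at the root, where just two edges meet.
\<close>

definition rooted_branch_points :: "'a rw_tree \<Rightarrow> 'a set \<Rightarrow> 'a set" where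
  "rooted_branch_points T A =
     branch_points T A \<union>
     {x. x = tree_root T \<and>
        (\<exists>u v. u \<noteq> x \<and> v \<noteq> x \<and> segment_within T A x u \<and> segment_within T A x v \<and>
           tree_seg T x u \<inter> tree_seg T x v = {x})}"

definition rooted_leaves :: "'a rw_tree \<Rightarrow> 'a set \<Rightarrow> 'a set" where
  "rooted_leaves T A = leaves T A - {tree_root T}"

definition atom_locations :: "'a rw_tree \<Rightarrow> 'a set" where
  "atom_locations T = {x \<in> tree_points T. measure (tree_mass T) {x} > 0}"

definition isolated_leaves :: "'a rw_tree \<Rightarrow> 'a set \<Rightarrow> 'a set" where
  "isolated_leaves T A =
     rooted_leaves T A - tree_top T derived_set_of rooted_branch_points T A"

definition special_points :: "'a rw_tree \<Rightarrow> 'a set" where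
  "special_points T =
     atom_locations T \<union> rooted_branch_points T (mass_span T) \<union> isolated_leaves T (mass_span T)"

definition mass_structural_isomorphism :: "'a rw_tree \<Rightarrow> 'b rw_tree \<Rightarrow> ('a \<Rightarrow> 'b) \<Rightarrow> bool" where
  "mass_structural_isomorphism T1 T2 \<phi> \<longleftrightarrow>
     bij_betw \<phi> (special_points T1) (special_points T2) \<and>
     (\<forall>x\<in>special_points T1.
        measure (tree_mass T1) (tree_seg T1 (tree_root T1) x) =
          measure (tree_mass T2) (tree_seg T2 (tree_root T2) (\<phi> x)) \<and>
        measure (tree_mass T1) {x} = measure (tree_mass T2) {\<phi> x} \<and>
        measure (tree_mass T1) (fringe_subtree T1 x) =
          measure (tree_mass T2) (fringe_subtree T2 (\<phi> x))) \<and>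
     (\<forall>x\<in>special_points T1. \<forall>y\<in>special_points T1.
        x \<in> tree_seg T1 (tree_root T1) y \<longleftrightarrow> \<phi> x \<in> tree_seg T2 (tree_root T2) (\<phi> y))"


section \<open>Interval partition trees\<close>

text \<open>
  The spanning property is \<open>T = Span(p)\<close>. This amounts to every leaf other than the root being in
  the closed support. The spacing condition holds trivially at the root, so the
  convention about the root plays no part in it.
\<close>

definition ip_tree :: "'a rw_tree \<Rightarrow> bool" where
  "ip_tree T \<longleftrightarrow>
     rooted_weighted_tree T \<and>
     tree_points T = mass_span T \<and>
     (\<forall>x\<in>tree_points T. x \<in> branch_points T (tree_points T) \<or> x \<in> closed_support T \<longrightarrow>
        tree_dist T (tree_root T) x + measure (tree_mass T) (fringe_subtree T x) = 1)"


section \<open>The two equivalence relations\<close>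

text \<open>
  A separable metric space has at most continuum many points, and a real tree with more than one
  point has exactly that many. So a tree with points in \<open>'a\<close> and any tree equivalent to it that
  equals its span have copies in \<open>'a\<close>, and it is enough to take
  the classes among the trees with points in \<open>'a\<close>, for each type \<open>'a\<close>.
\<close>

definition mass_structural_rel :: "('a rw_tree \<times> 'a rw_tree) set" where
  "mass_structural_rel =
     {(T1, T2). rooted_weighted_tree T1 \<and> rooted_weighted_tree T2 \<and>
        (\<exists>\<phi>. mass_structural_isomorphism T1 T2 \<phi>)}"

definition isomorphism_rel :: "('a rw_tree \<times> 'a rw_tree) set" where
  "isomorphism_rel =
     {(T1, T2). rooted_weighted_tree T1 \<and> rooted_weighted_tree T2 \<and>
        (\<exists>f. tree_isomorphism T1 T2 f)}"

end

theory Submission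
  imports Defs
begin

text \<open>
  Let \<open>h\<close> be the distance from the root, \<open>gp\<close> the Gromov product at the root, which is the height
  of the branching of two points, \<open>F x\<close> the fringe of \<open>x\<close> and \<open>G x\<close> its mass. A real tree is the
  same as a geodesic space that is 0-hyperbolic at the root, and everything can be said in terms
  of \<open>h\<close>, \<open>gp\<close> and the order they define.

  Uniqueness. In an interval partition tree, \<open>h = 1 - G\<close> at special points, branch points are
  special, and the points below special ones are dense. Hence a mass-structural isomorphism
  preserves \<open>h\<close> and \<open>gp\<close> and extends by completeness to an isometry. It preserves mass because
  fringes generate the Borel sets and \<open>G\<close> is determined by the data at special points: where
  \<open>G x < 1 - h x\<close>, the point lies in a gap above a special point \<open>k\<close>, and the mass above \<open>k\<close> in
  this direction is the supremum of the masses of the tubes \<open>(k, x] \<union> F x\<close> with \<open>x\<close> special.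

  Existence. The spacing condition dictates the new height \<open>1 - G x\<close> of a point and the new
  height \<open>1 - G (x \<and> y)\<close> of a branching. These define a tree, in which points of equal data are
  identified and the jumps of \<open>G\<close> become segments. The image of the mass makes it an interval
  partition tree with the same special points.
\<close>

section \<open>Pointed hyperbolic geodesic spaces\<close>

text \<open>Special points can be sparse: mass may be spread along a segment whose only special
  points are its ends, and then the fringe masses at special points do not determine
  \<open>G\<close> along it. The prescribed masses of segments from the root have to enter, and
  tubes are the sets through which they do. The unions of fringes and tubes that occur may be
  uncountable; their index sets are closed under meets, so a decreasing sequence is cofinal in them
  and countable additivity suffices. In the construction, points that represent a Cauchy sequence of
  the new tree need not converge in the old one, because stretches on which \<open>G\<close> is
  constant collapse. Completeness is therefore obtained from filters of the old order and not from
  limits of representatives.\<close>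

locale pointed_tree = Metric_space M d for M :: "'a set" and d :: "'a \<Rightarrow> 'a \<Rightarrow> real" +
  fixes r :: 'a
  assumes root [simp]: "r \<in> M"
    and hyp0: "\<lbrakk>x \<in> M; y \<in> M; z \<in> M\<rbrakk> \<Longrightarrow>
      min (d r x + d r y - d x y) (d r y + d r z - d y z) \<le> d r x + d r z - d x z"
    and geo: "\<lbrakk>x \<in> M; 0 \<le> t; t \<le> d r x\<rbrakk> \<Longrightarrow> \<exists>y\<in>M. d r y = t \<and> d y x = d r x - t"
begin

section \<open>Heights, Gromov products and the order at the root\<close>

definition h :: "'a \<Rightarrow> real" where "h x = d r x"

definition gp :: "'a \<Rightarrow> 'a \<Rightarrow> real" where "gp x y = (d r x + d r y - d x y) / 2"

definition le :: "'a \<Rightarrow> 'a \<Rightarrow> bool"  (infix "\<sqsubseteq>" 50)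
  where "x \<sqsubseteq> y \<longleftrightarrow> x \<in> M \<and> y \<in> M \<and> gp x y = h x"

definition lt :: "'a \<Rightarrow> 'a \<Rightarrow> bool"  (infix "\<sqsubset>" 50)
  where "x \<sqsubset> y \<longleftrightarrow> x \<sqsubseteq> y \<and> x \<noteq> y"

definition between :: "'a \<Rightarrow> 'a \<Rightarrow> 'a set"
  where "between x y = {z \<in> M. d x z + d z y = d x y}"

lemma d_eq: "d x y = h x + h y - 2 * gp x y"
  by (simp add: h_def gp_def field_simps)

lemma h_nonneg [simp]: "0 \<le> h x"
  by (simp add: h_def)

lemma h_root [simp]: "h r = 0"
  by (simp add: h_def)

lemma h_zero_iff: "x \<in> M \<Longrightarrow> h x = 0 \<longleftrightarrow> x = r"
  by (auto simp: h_def)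

lemma gp_commute: "gp x y = gp y x"
  by (simp add: gp_def commute)

lemma gp_self [simp]: "x \<in> M \<Longrightarrow> gp x x = h x"
  by (simp add: gp_def h_def)

lemma gp_le1: "\<lbrakk>x \<in> M; y \<in> M\<rbrakk> \<Longrightarrow> gp x y \<le> h x"
  using triangle[of r x y] by (simp add: gp_def h_def)

lemma gp_le2: "\<lbrakk>x \<in> M; y \<in> M\<rbrakk> \<Longrightarrow> gp x y \<le> h y"
  using gp_le1[of y x] by (simp add: gp_commute)

lemma gp_nonneg: "\<lbrakk>x \<in> M; y \<in> M\<rbrakk> \<Longrightarrow> 0 \<le> gp x y"
  using triangle[of x r y] by (simp add: gp_def commute)

lemma gp_root [simp]: "x \<in> M \<Longrightarrow> gp r x = 0" "x \<in> M \<Longrightarrow> gp x r = 0"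
  by (auto simp: gp_def commute)

lemma hyp: "\<lbrakk>x \<in> M; y \<in> M; z \<in> M\<rbrakk> \<Longrightarrow> min (gp x y) (gp y z) \<le> gp x z"
  using hyp0[of x y z] by (auto simp: gp_def min_def split: if_splits)

lemma gp_ge: "\<lbrakk>x \<in> M; y \<in> M\<rbrakk> \<Longrightarrow> h x - d x y \<le> gp x y"
  using triangle[of r y x] by (simp add: gp_def h_def commute)

lemma leD: "x \<sqsubseteq> y \<Longrightarrow> x \<in> M" "x \<sqsubseteq> y \<Longrightarrow> y \<in> M" "x \<sqsubseteq> y \<Longrightarrow> gp x y = h x"
  "x \<sqsubseteq> y \<Longrightarrow> gp y x = h x"
  by (auto simp: le_def gp_commute)

lemma leI: "\<lbrakk>x \<in> M; y \<in> M; h x \<le> gp x y\<rbrakk> \<Longrightarrow> x \<sqsubseteq> y"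
  using gp_le1[of x y] by (auto simp: le_def)

lemma le_refl: "x \<in> M \<Longrightarrow> x \<sqsubseteq> x"
  by (simp add: le_def)

lemma le_h: "x \<sqsubseteq> y \<Longrightarrow> h x \<le> h y"
  using gp_le2[of x y] by (auto simp: le_def)

lemma le_trans: "\<lbrakk>x \<sqsubseteq> y; y \<sqsubseteq> z\<rbrakk> \<Longrightarrow> x \<sqsubseteq> z"
  using hyp[of x y z] le_h[of x y] by (auto simp: leD intro!: leI)

lemma le_d: "x \<sqsubseteq> y \<Longrightarrow> d x y = h y - h x"
  by (simp add: d_eq leD)

lemma le_antisym: "\<lbrakk>x \<sqsubseteq> y; h y \<le> h x\<rbrakk> \<Longrightarrow> x = y"
  using le_d[of x y] nonneg[of x y] by (simp add: leD)

lemma le_linear: "\<lbrakk>x \<sqsubseteq> z; y \<sqsubseteq> z; h x \<le> h y\<rbrakk> \<Longrightarrow> x \<sqsubseteq> y"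
  using hyp[of x z y] by (auto simp: leD intro!: leI)

lemma root_le: "x \<in> M \<Longrightarrow> r \<sqsubseteq> x"
  by (simp add: le_def)

lemma ltD: "x \<sqsubset> y \<Longrightarrow> x \<sqsubseteq> y" "x \<sqsubset> y \<Longrightarrow> x \<in> M" "x \<sqsubset> y \<Longrightarrow> y \<in> M" "x \<sqsubset> y \<Longrightarrow> h x < h y"
  "x \<sqsubset> y \<Longrightarrow> x \<noteq> y" "x \<sqsubset> y \<Longrightarrow> gp x y = h x"
  using le_antisym[of x y] by (auto simp: lt_def leD not_le[symmetric])

lemma ltI: "\<lbrakk>x \<sqsubseteq> y; h x < h y\<rbrakk> \<Longrightarrow> x \<sqsubset> y"
  by (auto simp: lt_def)

lemma lt_le_trans: "\<lbrakk>x \<sqsubset> y; y \<sqsubseteq> z\<rbrakk> \<Longrightarrow> x \<sqsubset> z"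
  by (rule ltI, rule le_trans, erule ltD(1), assumption,
      rule order_less_le_trans, erule ltD(4), erule le_h)

lemma le_linear': "\<lbrakk>x \<sqsubseteq> z; y \<sqsubseteq> z\<rbrakk> \<Longrightarrow> x \<sqsubseteq> y \<or> y \<sqsubset> x"
  using le_linear[of x z y] le_linear[of y z x] by (cases "h x \<le> h y") (auto intro!: ltI)

text \<open>Of three pairwise Gromov products the two smallest agree; since
  \<open>gp x x' = h x\<close>, passing to a lower point truncates the product at its height. Most
  computations with \<open>gp\<close> rest on this.\<close>

lemma gp_below: "\<lbrakk>x \<sqsubseteq> x'; y \<in> M\<rbrakk> \<Longrightarrow> gp x y = min (h x) (gp x' y)"
proof -
  assume a: "x \<sqsubseteq> x'" and y: "y \<in> M"
  note x = leD[OF a]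
  have "min (h x) (gp x' y) \<le> gp x y" using hyp[of x x' y] x y by simp
  moreover have "min (h x) (gp x y) \<le> gp x' y" using hyp[of x' x y] x y by simp
  moreover have "gp x y \<le> h x" using gp_le1 x y by simp
  ultimately show ?thesis by linarith
qed

lemma gp_mono: "\<lbrakk>x \<sqsubseteq> x'; y \<sqsubseteq> y'\<rbrakk> \<Longrightarrow> gp x y \<le> gp x' y'"
proof -
  assume a: "x \<sqsubseteq> x'" "y \<sqsubseteq> y'"
  have "gp x y \<le> gp x' y" using gp_below[OF a(1) leD(1)[OF a(2)]] by simp
  also have "\<dots> \<le> gp x' y'" using gp_below[OF a(2) leD(2)[OF a(1)]] by (simp add: gp_commute)
  finally show ?thesis .
qed

text \<open>For \<open>0 \<le> t \<le> h x\<close> the choice is unique, by \<open>le_linear\<close>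
  and \<open>le_antisym\<close>.\<close>

definition pt :: "'a \<Rightarrow> real \<Rightarrow> 'a" where "pt x t = (SOME y. y \<sqsubseteq> x \<and> h y = t)"

lemma pt:
  assumes "x \<in> M" "0 \<le> t" "t \<le> h x"
  shows pt_le: "pt x t \<sqsubseteq> x" and h_pt: "h (pt x t) = t"
proof -
  obtain y where "y \<in> M" "d r y = t" "d y x = d r x - t"
    using geo[of x t] assms by (auto simp: h_def)
  then have "y \<sqsubseteq> x \<and> h y = t"
    using assms by (auto simp: le_def h_def gp_def)
  then have "pt x t \<sqsubseteq> x \<and> h (pt x t) = t"
    unfolding pt_def by (rule someI)
  then show "pt x t \<sqsubseteq> x" "h (pt x t) = t" by auto
qed

lemma pt_in: "\<lbrakk>x \<in> M; 0 \<le> t; t \<le> h x\<rbrakk> \<Longrightarrow> pt x t \<in> M"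
  using leD(1) pt_le by blast

definition meet :: "'a \<Rightarrow> 'a \<Rightarrow> 'a" where "meet x y = pt x (gp x y)"

lemma
  assumes "x \<in> M" "y \<in> M"
  shows meet_le1: "meet x y \<sqsubseteq> x" and h_meet: "h (meet x y) = gp x y" and meet_le2: "meet x y \<sqsubseteq> y"
proof -
  show 1: "meet x y \<sqsubseteq> x" and 2: "h (meet x y) = gp x y"
    using assms pt[of x "gp x y"] by (auto simp: meet_def gp_nonneg gp_le1)
  then show "meet x y \<sqsubseteq> y"
    using assms hyp[of "meet x y" x y] by (intro leI) (auto simp: leD)
qed

lemma meet_in [simp]: "\<lbrakk>x \<in> M; y \<in> M\<rbrakk> \<Longrightarrow> meet x y \<in> M"
  using leD(1) meet_le1 by blast

lemma meet_greatest: "\<lbrakk>z \<sqsubseteq> x; z \<sqsubseteq> y\<rbrakk> \<Longrightarrow> z \<sqsubseteq> meet x y"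
proof (rule le_linear[of _ x])
  assume a: "z \<sqsubseteq> x" "z \<sqsubseteq> y"
  then show "meet x y \<sqsubseteq> x" "h z \<le> h (meet x y)"
    using hyp[of x z y] by (auto simp: leD meet_le1 h_meet)
qed

lemma meet_commute: "\<lbrakk>x \<in> M; y \<in> M\<rbrakk> \<Longrightarrow> meet x y = meet y x"
  by (intro le_antisym) (auto simp: h_meet gp_commute intro!: meet_greatest meet_le1 meet_le2)

lemma meet_lt: "\<lbrakk>x \<in> M; y \<in> M; \<not> x \<sqsubseteq> y\<rbrakk> \<Longrightarrow> meet x y \<sqsubset> x"
  using meet_le1[of x y] meet_le2[of x y] by (auto simp: lt_def)

lemma meet_le: "x \<sqsubseteq> y \<Longrightarrow> meet x y = x"
  using le_antisym[OF meet_le1[of x y]] by (simp add: h_meet leD)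

lemma h_lt_exists:
  assumes "x \<sqsubset> y" obtains z where "x \<sqsubset> z" "z \<sqsubset> y"
proof -
  let ?t = "(h x + h y) / 2"
  have *: "h x < h y" "x \<in> M" "y \<in> M" using ltD[OF assms] by auto
  then have z: "pt y ?t \<sqsubseteq> y" "h (pt y ?t) = ?t"
    using h_nonneg[of x] pt[of y ?t] by auto
  then have "pt y ?t \<sqsubset> y" using * by (intro ltI) simp_all
  moreover have "x \<sqsubset> pt y ?t"
    using z * le_linear[OF ltD(1)[OF assms] z(1)] by (intro ltI) simp_all
  ultimately show ?thesis using that by blast
qed

text \<open>A path from \<open>x\<close> of length at most \<open>h x - h z\<close> cannot descend
  past \<open>z\<close>. So the fringe of a point strictly below \<open>x\<close> is a neighbourhood
  of \<open>x\<close>.\<close>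

lemma le_ball: "\<lbrakk>z \<sqsubseteq> x; y \<in> M; d x y \<le> h x - h z\<rbrakk> \<Longrightarrow> z \<sqsubseteq> y"
proof -
  assume a: "z \<sqsubseteq> x" "y \<in> M" "d x y \<le> h x - h z"
  have "h z \<le> gp z y" using gp_below[OF a(1,2)] gp_ge[of x y] leD[OF a(1)] a by simp
  then show ?thesis using leD[OF a(1)] a by (intro leI)
qed

subsection \<open>Metric intervals\<close>

text \<open>This is hyperbolicity with the base point eliminated: the heights cancel, and what
  remains is an inequality between the six Gromov products of four points. It moves hyperbolicity
  from \<open>r\<close> to every other base point.\<close>

lemma four_point:
  assumes "x \<in> M" "y \<in> M" "z \<in> M" "w \<in> M"
  shows "d x y + d z w \<le> max (d x z + d y w) (d x w + d y z)"
proof -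
  have *: "min (c + g) (e + f) \<le> a + b"
    if "min c f \<le> a" "min e g \<le> a" "min c e \<le> b" "min f g \<le> b" for a b c e f g :: real
    using that by (smt (verit))
  have "min (gp x z + gp y w) (gp x w + gp y z) \<le> gp x y + gp z w"
    using assms hyp[of x z y] hyp[of x w y] hyp[of z x w] hyp[of z y w]
    by (intro *) (simp_all add: gp_commute)
  then show ?thesis by (simp add: d_eq min_def max_def split: if_splits)
qed

lemma between_commute: "between x y = between y x"
  by (auto simp: between_def commute add.commute)

lemma between_d:
  assumes "x \<in> M" "y \<in> M" "z \<in> between x y" "w \<in> between x y"
  shows "d z w = \<bar>d x z - d x w\<bar>"
proof -
  have m: "z \<in> M" "w \<in> M" "d x z + d z y = d x y" "d x w + d w y = d x y"
    using assms by (auto simp: between_def)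
  then show ?thesis
    using four_point[of x y z w] assms(1,2) mdist_reverse_triangle[of z x w]
    by (auto simp: commute max_def abs_if split: if_splits)
qed

lemma between_exists:
  assumes "x \<in> M" "y \<in> M" "0 \<le> t" "t \<le> d x y"
  shows "\<exists>z \<in> between x y. d x z = t"
proof -
  \<comment> \<open>An interval descends from \<open>x\<close> to the meet and climbs from there to
    \<open>y\<close>. The descending half is treated here; exchanging \<open>x\<close> and
    \<open>y\<close> gives the other.\<close>
  have *: "\<exists>z \<in> between x y. d x z = t" if "x \<in> M" "y \<in> M" "0 \<le> t" "t \<le> h x - gp x y" for x y t
  proof -
    have t: "0 \<le> h x - t" using that gp_nonneg[of x y] by linarith
    define z where "z = pt x (h x - t)"
    have z: "z \<sqsubseteq> x" "h z = h x - t" using that t by (auto simp: z_def pt)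
    have "gp z y = gp x y" using gp_below[OF z(1) that(2)] z that by simp
    then have "d z y = d x y - t" using z by (simp add: d_eq)
    moreover have "d x z = t" using le_d[OF z(1)] z by (simp add: commute)
    ultimately show ?thesis using leD[OF z(1)] by (intro bexI[of _ z]) (auto simp: between_def)
  qed
  show ?thesis
  proof (cases "t \<le> h x - gp x y")
    case False
    then obtain z where "z \<in> between y x" "d y z = d x y - t"
      using *[of y x "d x y - t"] assms by (auto simp: d_eq gp_commute)
    then show ?thesis using assms by (intro bexI[of _ z]) (auto simp: between_def commute)
  qed (use * assms in auto)
qed

lemma between_isometric:
  assumes "x \<in> M" "y \<in> M"
  shows "d x ` between x y = {0..d x y}"
proof
  show "d x ` between x y \<subseteq> {0..d x y}"
  proof clarify
    fix z assume "z \<in> between x y"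
    then have "d x z + d z y = d x y" by (simp add: between_def)
    then show "d x z \<in> {0..d x y}" using nonneg[of z y] nonneg[of x z]
      unfolding atLeastAtMost_iff by linarith
  qed
  show "{0..d x y} \<subseteq> d x ` between x y" using between_exists[OF assms] by fastforce
qed

lemma median:
  assumes "x \<in> M" "y \<in> M" "z \<in> M"
  shows "\<exists>q. q \<in> between x y \<and> q \<in> between x z \<and> q \<in> between y z"
proof -
  \<comment> \<open>The median lies at a distance from \<open>x\<close> equal to the Gromov product
    of \<open>y\<close> and \<open>z\<close> based at \<open>x\<close>.\<close>
  have g: "0 \<le> (d x y + d x z - d y z) / 2" "(d x y + d x z - d y z) / 2 \<le> d x y"
    using assms triangle[of y x z] triangle[of x y z] by (auto simp: commute)
  then obtain q where q: "q \<in> M" "d x q = (d x y + d x z - d y z) / 2" "d x q + d q y = d x y"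
    using between_exists[OF assms(1,2) g] by (auto simp: between_def)
  have "d q z \<le> d x z - d x q"
    using four_point[of q z x y] q assms triangle[of x q z] triangle[of y q z]
    by (auto simp: commute max_def split: if_splits)
  then have "d q z = d x z - d x q" using triangle[of x q z] q(1) assms by linarith
  then show ?thesis using q assms by (intro exI[of _ q]) (auto simp: between_def commute)
qed

lemma between_path:
  assumes "x \<in> M" "y \<in> M"
  shows "simple_path_trace (metric (M,d)) x y (between x y)"
proof (cases "x = y")
  case True
  have "between x y = {x}" using True assms by (auto simp: between_def commute)
  moreover have "pathin mtopology (\<lambda>_. x)" using assms by (simp add: pathin_def)
  ultimately show ?thesis
    unfolding simple_path_trace_def using True by (intro exI[of _ "\<lambda>_. x"]) (auto simp: image_constant_conv)
next
  case False
  define D where "D = d x y"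
  have D: "D > 0" using False assms by (simp add: D_def)
  obtain g where g: "\<And>t. \<lbrakk>0 \<le> t; t \<le> 1\<rbrakk> \<Longrightarrow> g t \<in> between x y \<and> d x (g t) = t * D"
  proof -
    have "\<exists>z. 0 \<le> t \<longrightarrow> t \<le> 1 \<longrightarrow> z \<in> between x y \<and> d x z = t * D" for t
    proof (cases "0 \<le> t \<and> t \<le> 1")
      case True
      then have "0 \<le> t * D" "t * D \<le> d x y" using D by (auto simp: D_def mult_left_le_one_le)
      then show ?thesis using between_exists[OF assms] by blast
    qed auto
    then show ?thesis using that by metis
  qed
  have gM: "g t \<in> M" if "0 \<le> t" "t \<le> 1" for t using g[OF that] by (simp add: between_def)
  have dg: "d (g s) (g t) = \<bar>s - t\<bar> * D" if "0 \<le> t" "t \<le> 1" "0 \<le> s" "s \<le> 1" for s t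
  proof -
    have "d (g s) (g t) = \<bar>s * D - t * D\<bar>"
      using between_d[OF assms, of "g s" "g t"] g that by auto
    also have "\<dots> = \<bar>(s - t) * D\<bar>" by (simp add: algebra_simps)
    finally show ?thesis using D by (simp add: abs_mult)
  qed
  have b_x: "d x z = 0 \<Longrightarrow> z \<in> between x y \<Longrightarrow> z = x" for z
    using assms by (auto simp: between_def)
  have "pathin mtopology g"
    unfolding pathin_def continuous_map_to_metric
  proof (intro ballI allI impI)
    fix t \<epsilon> :: real assume t: "t \<in> topspace (top_of_set {0..1})" and e: "0 < \<epsilon>"
    have "g u \<in> mball (g t) \<epsilon>" if "u \<in> {0..1} \<inter> ball t (\<epsilon> / D)" for u
    proof -
      have "\<bar>t - u\<bar> * D < \<epsilon>" using that D by (simp add: dist_real_def field_simps)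
      then show ?thesis using that t by (auto simp: gM dg)
    qed
    moreover have "openin (top_of_set {0..1}) ({0..1} \<inter> ball t (\<epsilon> / D))"
      by (simp add: openin_open_Int)
    ultimately show "\<exists>U. openin (top_of_set {0..1}) U \<and> t \<in> U \<and> (\<forall>u\<in>U. g u \<in> mball (g t) \<epsilon>)"
      using t e D by (intro exI[of _ "{0..1} \<inter> ball t (\<epsilon> / D)"]) auto
  qed
  moreover have "g 0 = x" using g[of 0] b_x by auto
  moreover have "g 1 = y"
    using g[of 1] gM[of 1] assms by (auto simp: between_def D_def)
  moreover have "inj_on g {0..1}"
  proof (rule inj_onI)
    fix s t :: real assume "s \<in> {0..1}" "t \<in> {0..1}" "g s = g t"
    then have "\<bar>s - t\<bar> * D = 0" using dg[of t s] gM by auto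
    then show "s = t" using D by auto
  qed
  moreover have "g ` {0..1} = between x y"
  proof
    show "g ` {0..1} \<subseteq> between x y" using g by auto
    show "between x y \<subseteq> g ` {0..1}"
    proof
      fix z assume z: "z \<in> between x y"
      define t where "t = d x z / D"
      have "d x z \<le> D" using between_isometric[OF assms] z by (auto simp: D_def)
      then have t: "0 \<le> t" "t \<le> 1" using D by (auto simp: t_def)
      have "d (g t) z = 0" using between_d[OF assms, of "g t" z] g[OF t] z D by (auto simp: t_def)
      then have "z = g t" using z gM[OF t] by (auto simp: between_def)
      then show "z \<in> g ` {0..1}" using t by auto
    qed
  qed
  ultimately show ?thesis unfolding simple_path_trace_def by auto
qed

text \<open>A path joining two sides of \<open>q\<close> passes through \<open>q\<close>: the points whose Gromov product with
  a given point, based at \<open>q\<close>, is positive form an open set, and so do the others.\<close>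

lemma path_through:
  fixes a b :: real
  assumes g: "continuous_map (top_of_set {a..b}) mtopology g" and ab: "a \<le> b"
    and q: "q \<in> between (g a) (g b)"
  shows "q \<in> g ` {a..b}"
proof (rule ccontr)
  assume q': "q \<notin> g ` {a..b}"
  have gM: "g t \<in> M" if "t \<in> {a..b}" for t
    using continuous_map_image_subset_topspace[OF g] that by auto
  have qM: "q \<in> M" using q by (simp add: between_def)
  \<comment> \<open>Twice the Gromov product based at \<open>q\<close>; the four-point condition
    makes it hyperbolic as well.\<close>
  let ?s = "\<lambda>x y. d q x + d q y - d x y"
  have hq: "min (?s x y) (?s y z) \<le> ?s x z" if "x \<in> M" "y \<in> M" "z \<in> M" for x y z
    using four_point[of q y x z] four_point[of q z x y] that qM by (auto simp: commute max_def min_def split: if_splits)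
  define A where "A = {z \<in> M. z \<noteq> q \<and> ?s (g a) z > 0}"
  define B where "B = {z \<in> M. z \<noteq> q \<and> ?s (g a) z \<le> 0}"
  have ga: "g a \<in> M" using gM[of a] ab by simp
  \<comment> \<open>A point nearer to \<open>z\<close> than \<open>q\<close> is lies on the same
    side of \<open>q\<close> as \<open>z\<close>, so that \<open>d q z\<close> serves as radius for
    both sets.\<close>
  have near: "?s z w > 0" if "z \<in> M" "z \<noteq> q" "w \<in> mball z (d q z)" for z w
    using that qM triangle[of q w z] by (auto simp: commute)
  have oA: "openin mtopology A"
    unfolding openin_mtopology
  proof (intro conjI allI impI)
    fix z assume z: "z \<in> A"
    have "mball z (d q z) \<subseteq> A"
    proof
      fix w assume w: "w \<in> mball z (d q z)"
      then show "w \<in> A" using near[OF _ _ w] hq[of "g a" z w] z ga qM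
        by (auto simp: A_def min_def commute split: if_splits)
    qed
    then show "\<exists>e>0. mball z e \<subseteq> A" using z qM by (intro exI[of _ "d q z"]) (auto simp: A_def)
  qed (auto simp: A_def)
  have oB: "openin mtopology B"
    unfolding openin_mtopology
  proof (intro conjI allI impI)
    fix z assume z: "z \<in> B"
    have "mball z (d q z) \<subseteq> B"
    proof
      fix w assume w: "w \<in> mball z (d q z)"
      then show "w \<in> B" using near[OF _ _ w] hq[of "g a" w z] z ga qM
        by (auto simp: B_def min_def commute split: if_splits)
    qed
    then show "\<exists>e>0. mball z e \<subseteq> B" using z qM by (intro exI[of _ "d q z"]) (auto simp: B_def)
  qed (auto simp: B_def)
  have con: "connectedin mtopology (g ` {a..b})"
    using connectedin_continuous_map_image[OF g, of "{a..b}"] by simp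
  have sub: "g ` {a..b} \<subseteq> A \<union> B" using gM q' by (fastforce simp: A_def B_def)
  have dis: "A \<inter> B \<inter> g ` {a..b} = {}" by (auto simp: A_def B_def)
  have gAB: "g a \<in> A" "g b \<in> B"
  proof -
    have "g a \<noteq> q" "g b \<noteq> q" using q' ab by force+
    moreover have "g b \<in> M" using gM ab by simp
    moreover have "d q (g a) + d q (g b) - d (g a) (g b) = 0"
      using q by (simp add: between_def commute)
    ultimately show "g a \<in> A" "g b \<in> B" using ga qM by (auto simp: A_def B_def)
  qed
  have "g a \<in> g ` {a..b}" "g b \<in> g ` {a..b}" using ab by auto
  then have ne: "A \<inter> g ` {a..b} \<noteq> {}" "B \<inter> g ` {a..b} \<noteq> {}"
    using gAB by blast+
  show False by (rule connectedinD[OF con oA oB sub dis ne])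
qed

text \<open>By \<open>path_through\<close> a path covers the whole interval. If it also visited a
  point \<open>g c\<close> off the interval, it would pass through the median of \<open>x\<close>,
  \<open>y\<close> and \<open>g c\<close> both before and after time \<open>c\<close>, against
  injectivity.\<close>

theorem simple_path_trace_iff:
  assumes "x \<in> M" "y \<in> M"
  shows "simple_path_trace (metric (M,d)) x y S \<longleftrightarrow> S = between x y"
proof
  assume "simple_path_trace (metric (M,d)) x y S"
  then obtain g :: "real \<Rightarrow> 'a"
    where g: "continuous_map (top_of_set {0..1}) mtopology g" "g 0 = x" "g 1 = y"
    "g ` {0..1} = S" "inj_on g {0..1} \<or> S = {x}"
    unfolding simple_path_trace_def pathin_def mtopology_of by blast
  have sub: "continuous_map (top_of_set {a..b}) mtopology g" if "0 \<le> a" "b \<le> 1" for a b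
    by (rule continuous_map_from_subtopology_mono[OF g(1)]) (use that in auto)
  show "S = between x y"
  proof
    show "between x y \<subseteq> S"
    proof
      fix q assume "q \<in> between x y"
      then have "q \<in> g ` {0..1}" by (intro path_through[OF g(1)]) (simp_all add: g(2,3))
      then show "q \<in> S" by (simp add: g(4))
    qed
    show "S \<subseteq> between x y"
    proof
      fix z assume "z \<in> S"
      then obtain c where c: "c \<in> {0..1}" "z = g c" using g by auto
      then have zM: "z \<in> M" using continuous_map_image_subset_topspace[OF g(1)] by auto
      obtain q where q: "q \<in> between x y" "q \<in> between x z" "q \<in> between y z"
        using median[OF assms zM] by blast
      show "z \<in> between x y"
      proof (cases "inj_on g {0..1}")
        case True
        have "q \<in> g ` {0..c}"
          by (intro path_through[OF sub]) (use c q g(2) in simp_all)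
        then obtain s where s: "s \<in> {0..c}" "q = g s" by auto
        have "q \<in> g ` {c..1}"
          by (intro path_through[OF sub]) (use c q g(3) in \<open>simp_all add: between_commute\<close>)
        then obtain t where t: "t \<in> {c..1}" "q = g t" by auto
        have "s = t" using inj_onD[OF True, of s t] s t c by simp
        then have "s = c" using s t by auto
        then show ?thesis using s c q by simp
      next
        case False
        then have "S = {x}" using g by auto
        then have "z = x" using \<open>z \<in> S\<close> by auto
        then show ?thesis using assms by (auto simp: between_def)
      qed
    qed
  qed
next
  assume "S = between x y" then show "simple_path_trace (metric (M,d)) x y S"
    using between_path[OF assms] by simp
qed

lemma seg_eq: "\<lbrakk>x \<in> M; y \<in> M\<rbrakk> \<Longrightarrow> seg (metric (M,d)) x y = between x y"
  by (simp add: seg_def simple_path_trace_iff)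

lemma real_tree_metric:
  assumes "mcomplete" "separable_space mtopology" "mbounded M"
  shows "real_tree (metric (M,d))"
proof -
  have "isometric_to_interval (metric (M,d)) (seg (metric (M,d)) x y)" if "x \<in> M" "y \<in> M" for x y
    unfolding isometric_to_interval_def seg_eq[OF that]
    using between_isometric[OF that] between_d[OF that]
    by (intro exI[of _ 0] exI[of _ "d x y"] exI[of _ "d x"]) (auto simp: dist_real_def)
  then show ?thesis
    using assms by (auto simp: real_tree_def simple_path_trace_iff)
qed

lemma between_root: "x \<in> M \<Longrightarrow> between r x = {z. z \<sqsubseteq> x}"
  by (auto simp: between_def le_def h_def gp_def)

end

section \<open>Real trees are hyperbolic and geodesic\<close>

locale real_tree_space = Metric_space M d for M :: "'a set" and d :: "'a \<Rightarrow> 'a \<Rightarrow> real" +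
  assumes real_tree: "real_tree (metric (M,d))"
begin

abbreviation sg :: "'a \<Rightarrow> 'a \<Rightarrow> 'a set" where "sg \<equiv> seg (metric (M,d))"

lemma sg_unique: "\<lbrakk>x \<in> M; y \<in> M; simple_path_trace (metric (M,d)) x y S\<rbrakk> \<Longrightarrow> S = sg x y"
  using real_tree unfolding real_tree_def seg_def by (simp add: the1_equality)

lemma sg_path: "\<lbrakk>x \<in> M; y \<in> M\<rbrakk> \<Longrightarrow> simple_path_trace (metric (M,d)) x y (sg x y)"
  using real_tree unfolding real_tree_def seg_def by (simp add: theI')

lemma sg_obtain_path:
  assumes "x \<in> M" "y \<in> M"
  obtains g :: "real \<Rightarrow> 'a" where "continuous_map (top_of_set {0..1}) mtopology g" "g 0 = x" "g 1 = y"
    "g ` {0..1} = sg x y" "inj_on g {0..1} \<or> sg x y = {x}"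
  using sg_path[OF assms] unfolding simple_path_trace_def pathin_def mtopology_of by blast

lemma sg_ends: "\<lbrakk>x \<in> M; y \<in> M\<rbrakk> \<Longrightarrow> x \<in> sg x y \<and> y \<in> sg x y"
  by (erule (1) sg_obtain_path) (metis atLeastAtMost_iff image_eqI order_refl zero_le_one)

lemma sg_subset: "\<lbrakk>x \<in> M; y \<in> M; z \<in> sg x y\<rbrakk> \<Longrightarrow> z \<in> M"
  by (erule (1) sg_obtain_path) (use continuous_map_image_subset_topspace in fastforce)

text \<open>The isometry onto a real interval is not assumed to send ends to ends. Composed with the
  injective path it is a continuous injective function on \<open>{0..1}\<close>, hence monotone, so
  the ends do correspond; a change of sign fixes the orientation.\<close>

lemma sg_coordinate:
  assumes x: "x \<in> M" and y: "y \<in> M"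
  obtains f :: "'a \<Rightarrow> real" where "\<And>u v. \<lbrakk>u \<in> sg x y; v \<in> sg x y\<rbrakk> \<Longrightarrow> d u v = \<bar>f u - f v\<bar>"
    "f x \<le> f y" "f ` sg x y = {f x..f y}"
proof -
  obtain a b :: real and f where f: "f ` sg x y = {a..b}"
    and iso: "\<And>u v. \<lbrakk>u \<in> sg x y; v \<in> sg x y\<rbrakk> \<Longrightarrow> dist (f u) (f v) = d u v"
  proof -
    have "isometric_to_interval (metric (M,d)) (sg x y)"
      using real_tree x y unfolding real_tree_def by simp
    then obtain a b :: real and f where f: "f ` sg x y = {a..b}"
      "\<forall>u\<in>sg x y. \<forall>v\<in>sg x y. dist (f u) (f v) = mdist (metric (M,d)) u v"
      unfolding isometric_to_interval_def by (elim exE conjE) (rule that, assumption+)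
    show ?thesis by (rule that[OF f(1)]) (use f(2) in simp)
  qed
  obtain g :: "real \<Rightarrow> 'a" where g: "continuous_map (top_of_set {0..1}) mtopology g" "g 0 = x" "g 1 = y"
    "g ` {0..1} = sg x y" "inj_on g {0..1} \<or> sg x y = {x}"
    using sg_obtain_path[OF x y] by blast
  have ends: "x \<in> sg x y" "y \<in> sg x y" using sg_ends[OF x y] by auto
  define k where "k = f \<circ> g"
  have gs: "g t \<in> sg x y" if "t \<in> {0..1}" for t using g(4) that by blast
  have "continuous_map (top_of_set {0..1}) euclidean k"
    unfolding Met_TC.continuous_map_to_metric[simplified]
  proof (intro ballI allI impI)
    fix t e :: real assume t: "t \<in> topspace (top_of_set {0..1})" and e: "0 < e"
    then obtain U where U: "openin (top_of_set {0..1}) U" "t \<in> U" "\<forall>y\<in>U. g y \<in> mball (g t) e"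
      using g(1) unfolding continuous_map_to_metric by blast
    have "U \<subseteq> {0..1}" using U(1) openin_imp_subset by blast
    then have "\<forall>u\<in>U. dist (k t) (k u) < e"
      using U(2,3) iso[OF gs gs] by (auto simp: k_def subset_iff)
    then show "\<exists>U. openin (top_of_set {0..1}) U \<and> t \<in> U \<and> (\<forall>y\<in>U. dist (k t) (k y) < e)"
      using U by blast
  qed
  then have cont: "continuous_on {0..1} k" by simp
  have bet: "(k 0 \<le> k t \<and> k t \<le> k 1) \<or> (k 1 \<le> k t \<and> k t \<le> k 0)" if "t \<in> {0..1}" for t
  proof (cases "inj_on g {0..1}")
    case True
    have "inj_on k {0..1}"
    proof (rule inj_onI)
      fix s t :: real assume st: "s \<in> {0..1}" "t \<in> {0..1}" "k s = k t"
      then have "d (g s) (g t) = 0" using iso[of "g s" "g t"] gs by (simp add: k_def)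
      then have "g s = g t" using gs[OF st(1)] gs[OF st(2)] sg_subset[OF x y] by simp
      then show "s = t" using True st by (simp add: inj_on_def)
    qed
    moreover have "t = 0 \<or> t = 1 \<or> (0 < t \<and> t < 1)" using that by auto
    ultimately show ?thesis using continuous_inj_imp_mono[OF _ _ cont, of t] by fastforce
  next
    case False
    then have "sg x y = {x}" using g(5) by blast
    then have "g t = x" "g 0 = x" using gs that by auto
    then show ?thesis by (auto simp: k_def)
  qed
  have fb: "(f x \<le> f z \<and> f z \<le> f y) \<or> (f y \<le> f z \<and> f z \<le> f x)" if z: "z \<in> sg x y" for z
  proof -
    obtain t where t: "t \<in> {0..1}" "z = g t" using z g(4) by blast
    then show ?thesis using bet[OF t(1)] g(2,3) by (simp add: k_def)
  qed
  have fx: "f x \<in> {a..b}" "f y \<in> {a..b}" using imageI[OF ends(1), of f] imageI[OF ends(2), of f] f by simp_all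
  have ab: "\<exists>z\<in>sg x y. f z = t" if "a \<le> t" "t \<le> b" for t
  proof -
    have "t \<in> f ` sg x y" using f that by simp
    then show ?thesis by blast
  qed
  show ?thesis
  proof (cases "f x \<le> f y")
    case True
    have "f ` sg x y = {f x..f y}"
    proof
      show "f ` sg x y \<subseteq> {f x..f y}" using fb True by fastforce
      show "{f x..f y} \<subseteq> f ` sg x y" using fx unfolding f by auto
    qed
    then show ?thesis using that[of f] iso True by (simp add: dist_real_def)
  next
    case False
    have "(\<lambda>z. - f z) ` sg x y = {- f x..- f y}"
    proof
      show "(\<lambda>z. - f z) ` sg x y \<subseteq> {- f x..- f y}" using fb False by fastforce
      show "{- f x..- f y} \<subseteq> (\<lambda>z. - f z) ` sg x y"
      proof
        fix t assume "t \<in> {- f x..- f y}"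
        then have "a \<le> - t" "- t \<le> b" using fx by auto
        then obtain z where "z \<in> sg x y" "f z = - t" using ab by blast
        then show "t \<in> (\<lambda>z. - f z) ` sg x y" by (auto simp: image_iff intro!: bexI[of _ z])
      qed
    qed
    moreover have "d u v = \<bar>- f u - - f v\<bar>" if "u \<in> sg x y" "v \<in> sg x y" for u v
      using iso[OF that] by (simp add: dist_real_def)
    ultimately show ?thesis using that[of "\<lambda>z. - f z"] False by simp
  qed
qed

lemma
  assumes x: "x \<in> M" and y: "y \<in> M"
  shows sg_between: "z \<in> sg x y \<Longrightarrow> d x z + d z y = d x y"
    and sg_linear: "\<lbrakk>z \<in> sg x y; w \<in> sg x y\<rbrakk> \<Longrightarrow> d z w = \<bar>d x z - d x w\<bar>"
    and sg_exists: "\<lbrakk>0 \<le> t; t \<le> d x y\<rbrakk> \<Longrightarrow> \<exists>z\<in>sg x y. d x z = t"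
proof -
  obtain f :: "'a \<Rightarrow> real" where f: "\<And>u v. \<lbrakk>u \<in> sg x y; v \<in> sg x y\<rbrakk> \<Longrightarrow> d u v = \<bar>f u - f v\<bar>"
    "f x \<le> f y" "f ` sg x y = {f x..f y}"
    using sg_coordinate[OF x y] by blast
  have e: "x \<in> sg x y" "y \<in> sg x y" using sg_ends[OF x y] by auto
  have b: "f x \<le> f z" "f z \<le> f y" if "z \<in> sg x y" for z using f(3) that by auto
  have dx: "d x z = f z - f x" if "z \<in> sg x y" for z using f(1)[OF e(1) that] b[OF that] by simp
  show "d x z + d z y = d x y" if "z \<in> sg x y" 
    using f(1)[OF that e(2)] dx[OF that] dx[OF e(2)] b[OF that] by simp
  show "d z w = \<bar>d x z - d x w\<bar>" if "z \<in> sg x y" "w \<in> sg x y"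
    using f(1)[OF that] dx[OF that(1)] dx[OF that(2)] by simp
  show "\<exists>z\<in>sg x y. d x z = t" if "0 \<le> t" "t \<le> d x y"
  proof -
    have "f x + t \<in> f ` sg x y" unfolding f(3) using that dx[OF e(2)] by simp
    then obtain z where "z \<in> sg x y" "f z = f x + t" by (metis imageE)
    then show ?thesis using dx[of z] by (intro bexI[of _ z]) simp_all
  qed
qed

lemma sg_same: "x \<in> M \<Longrightarrow> sg x x = {x}"
proof -
  assume x: "x \<in> M"
  have "z = x" if "z \<in> sg x x" for z
  proof -
    have "d x z + d z x = 0" using sg_between[OF x x that] x by simp
    then show ?thesis using sg_subset[OF x x that] x commute[of x z] by simp
  qed
  then show ?thesis using sg_ends[OF x x] by blast
qed

text \<open>Two simple paths that meet only at \<open>m\<close> concatenate to a simple path, and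
  uniqueness of simple paths identifies its trace with the segment.\<close>

lemma sg_concat:
  assumes x: "x \<in> M" and m: "m \<in> M" and y: "y \<in> M" and meet: "sg x m \<inter> sg m y \<subseteq> {m}"
  shows "sg x y = sg x m \<union> sg m y"
proof (cases "x = m \<or> y = m")
  case True
  then show ?thesis using sg_same sg_ends x y m by auto
next
  case False
  obtain g1 :: "real \<Rightarrow> 'a" where g1: "continuous_map (top_of_set {0..1}) mtopology g1" "g1 0 = x" "g1 1 = m"
    "g1 ` {0..1} = sg x m" "inj_on g1 {0..1} \<or> sg x m = {x}"
    using sg_obtain_path[OF x m] by blast
  obtain g2 :: "real \<Rightarrow> 'a" where g2: "continuous_map (top_of_set {0..1}) mtopology g2" "g2 0 = m" "g2 1 = y"
    "g2 ` {0..1} = sg m y" "inj_on g2 {0..1} \<or> sg m y = {m}"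
    using sg_obtain_path[OF m y] by blast
  have i1: "inj_on g1 {0..1}" and i2: "inj_on g2 {0..1}"
    using g1(5) g2(5) False sg_ends[OF x m] sg_ends[OF m y] by auto
  define g where "g = (\<lambda>t::real. if t \<le> 1/2 then (g1 \<circ> (\<lambda>t. 2 * t)) t else (g2 \<circ> (\<lambda>t. 2 * t - 1)) t)"
  have cont: "continuous_map (top_of_set {0..1}) mtopology g"
    unfolding g_def
  proof (intro continuous_map_cases_le continuous_map_compose, force, force)
    show "continuous_map (subtopology (top_of_set {0..1}) {x \<in> topspace (top_of_set {0..1}). x \<le> 1/2})
            (top_of_set {0..1}) ((*) 2 :: real \<Rightarrow> real)"
      by (auto simp: continuous_map_in_subtopology continuous_map_from_subtopology)
    have "continuous_map (subtopology (top_of_set {0..1}) {x. 0 \<le> x \<and> x \<le> 1 \<and> 1 \<le> x * 2})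
       euclideanreal (\<lambda>t. 2 * t - 1)"
      by (intro continuous_intros) (force intro: continuous_map_from_subtopology)
    then show "continuous_map (subtopology (top_of_set {0..1}) {x \<in> topspace (top_of_set {0..1}). 1/2 \<le> x})
       (top_of_set {0..1}) (\<lambda>t::real. 2 * t - 1)"
      by (force simp: continuous_map_in_subtopology)
    show "(g1 \<circ> (*) 2) t = (g2 \<circ> (\<lambda>t. 2 * t - 1)) t" if "t = 1/2" for t :: real
    proof -
      have a: "2 * t = 1" "2 * t - 1 = 0" using that by simp_all
      show ?thesis unfolding o_def a using g1(3) g2(2) by simp
    qed
  qed (use g1(1) g2(1) in auto)
  have L: "g t \<in> sg x m" if "t \<in> {0..1/2}" for t
  proof -
    have "g1 (2 * t) \<in> g1 ` {0..1}" using that by (intro imageI) auto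
    then show ?thesis using that g1(4) by (simp add: g_def)
  qed
  have gR: "g t = g2 (2 * t - 1)" if "t \<in> {1/2..1}" for t
  proof (cases "t = 1/2")
    case True
    then have a: "2 * t = 1" "2 * t - 1 = 0" by simp_all
    have "g t = g1 (2 * t)" using True by (simp add: g_def)
    then show ?thesis unfolding a using g1(3) g2(2) by simp
  qed (use that in \<open>simp add: g_def\<close>)
  have R: "g t \<in> sg m y" if "t \<in> {1/2..1}" for t
  proof -
    have "g2 (2 * t - 1) \<in> g2 ` {0..1}" using that by (intro imageI) auto
    then show ?thesis using that g2(4) gR[OF that] by simp
  qed
  have half: "t = 1/2" if "t \<in> {1/2..1}" "g t = m" for t
  proof -
    have "g2 (2 * t - 1) = g2 0" using gR[OF that(1)] that(2) g2(2) by simp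
    then have "2 * t - 1 = 0" using inj_onD[OF i2, of "2 * t - 1" 0] that(1) by simp
    then show ?thesis by simp
  qed
  have LL: "s = t" if "s \<in> {0..1/2}" "t \<in> {0..1/2}" "g s = g t" for s t
    using inj_onD[OF i1, of "2 * s" "2 * t"] that by (simp add: g_def)
  have RR: "s = t" if "s \<in> {1/2..1}" "t \<in> {1/2..1}" "g s = g t" for s t
    using inj_onD[OF i2, of "2 * s - 1" "2 * t - 1"] that gR by simp
  have gh: "g (1/2) = m" using g1(3) by (simp add: g_def)
  have LR: "s = t" if "s \<in> {0..1/2}" "t \<in> {1/2..1}" "g s = g t" for s t
  proof -
    have "g t = m" using L[OF that(1)] R[OF that(2)] that(3) meet by auto
    moreover from this have "g s = g (1/2)" using that gh by simp
    then have "s = 1/2" using LL[of s "1/2"] that(1) by simp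
    ultimately show ?thesis using half[OF that(2)] by simp
  qed
  have "inj_on g {0..1}"
  proof (rule inj_onI)
    fix s t :: real assume st: "s \<in> {0..1}" "t \<in> {0..1}" "g s = g t"
    consider "s \<le> 1/2" "t \<le> 1/2" | "s \<le> 1/2" "t \<ge> 1/2" | "s \<ge> 1/2" "t \<le> 1/2" | "s \<ge> 1/2" "t \<ge> 1/2"
      by linarith
    then show "s = t" 
      using LL[of s t] LR[of s t] LR[of t s] RR[of s t] st by cases simp_all
  qed
  moreover have "g ` {0..1} = sg x m \<union> sg m y"
  proof
    show "g ` {0..1} \<subseteq> sg x m \<union> sg m y"
    proof
      fix z assume "z \<in> g ` {0..1}"
      then obtain t where t: "t \<in> {0..1}" "z = g t" by blast
      show "z \<in> sg x m \<union> sg m y" using L[of t] R[of t] t by (cases "t \<le> 1/2") auto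
    qed
    show "sg x m \<union> sg m y \<subseteq> g ` {0..1}"
    proof
      fix z assume "z \<in> sg x m \<union> sg m y"
      then consider t where "t \<in> {0..1}" "z = g1 t" | t where "t \<in> {0..1}" "z = g2 t"
        using g1(4) g2(4) by blast
      then show "z \<in> g ` {0..1}"
      proof cases
        case 1 then show ?thesis by (intro image_eqI[of _ _ "t/2"]) (auto simp: g_def)
      next
        case 2
        have a: "2 * ((t+1)/2) - 1 = t" by (simp add: field_simps)
        have "g ((t+1)/2) = g2 t" using gR[of "(t+1)/2"] 2(1) unfolding a by simp
        then show ?thesis using 2 by (intro image_eqI[of _ _ "(t+1)/2"]) auto
      qed
    qed
  qed
  moreover have "g 0 = x" "g 1 = y" using g1(2) g2(3) by (simp_all add: g_def)
  ultimately have "simple_path_trace (metric (M,d)) x y (sg x m \<union> sg m y)"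
    unfolding simple_path_trace_def pathin_def mtopology_of using cont by blast
  then show ?thesis using sg_unique[OF x y] by simp
qed

lemma sg_iff:
  assumes x: "x \<in> M" and y: "y \<in> M"
  shows "z \<in> sg x y \<longleftrightarrow> z \<in> M \<and> d x z + d z y = d x y"
proof
  assume "z \<in> M \<and> d x z + d z y = d x y"
  then have z: "z \<in> M" "d x z + d z y = d x y" by auto
  have "sg x z \<inter> sg z y \<subseteq> {z}"
  proof
    fix q assume q: "q \<in> sg x z \<inter> sg z y"
    then have qM: "q \<in> M" using sg_subset x z by blast
    have "d x q + d q z = d x z" "d z q + d q y = d z y"
      using q sg_between x y z by auto
    then have "d q z \<le> 0" using triangle[OF x qM y] z(2) commute[of z q] by linarith
    then have "d q z = 0" using nonneg[of q z] by linarith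
    then show "q \<in> {z}" using qM z(1) by simp
  qed
  then have "sg x y = sg x z \<union> sg z y" by (rule sg_concat[OF x z(1) y])
  then show "z \<in> sg x y" using sg_ends[OF x z(1)] by simp
qed (use sg_between sg_subset x y in blast)

text \<open>The median is the last common point of the segments from \<open>w\<close> to
  \<open>x\<close> and to \<open>y\<close>. Beyond it they are disjoint, so \<open>sg_concat\<close>
  puts it on the segment from \<open>x\<close> to \<open>y\<close> as well.\<close>

lemma median:
  assumes w: "w \<in> M" and x: "x \<in> M" and y: "y \<in> M"
  shows "\<exists>m\<in>M. d w m + d m x = d w x \<and> d w m + d m y = d w y \<and> d x m + d m y = d x y"
proof -
  define K where "K = sg w x \<inter> sg w y"
  have wK: "w \<in> K" using sg_ends w x y by (simp add: K_def)
  have KM: "q \<in> M" "d w q + d q x = d w x" "d w q + d q y = d w y" if "q \<in> K" for q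
    using that w x y by (auto simp: K_def sg_iff)
  have bd: "d w q \<le> d w x" if "q \<in> K" for q 
    using KM(2)[OF that] nonneg[of q x] by linarith
  define \<sigma> where "\<sigma> = Sup (d w ` K)"
  have bdd: "bdd_above (d w ` K)" using bd by (intro bdd_aboveI[of _ "d w x"]) blast
  have \<sigma>: "d w q \<le> \<sigma>" if "q \<in> K" for q unfolding \<sigma>_def by (rule cSUP_upper[OF that bdd])
  have "\<sigma> \<le> d w x" unfolding \<sigma>_def using wK bd by (intro cSUP_least) auto
  moreover have "0 \<le> \<sigma>" using \<sigma>[OF wK] nonneg[of w w] by linarith
  ultimately obtain m where m: "m \<in> sg w x" "d w m = \<sigma>" using sg_exists[OF w x] by blast
  have mM: "m \<in> M" using m(1) sg_subset w x by blast
  \<comment> \<open>The supremum is attained: \<open>m\<close> is chosen on the segment to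
    \<open>x\<close> only, and points of \<open>K\<close> close to it show that it also lies on the
    segment to \<open>y\<close>.\<close>
  have "d w m + d m y \<le> d w y"
  proof (rule field_le_epsilon)
    fix e :: real assume "0 < e"
    then have "\<sigma> - e/2 < Sup (d w ` K)" by (simp add: \<sigma>_def)
    then obtain q where q: "q \<in> K" "\<sigma> - e/2 < d w q"
      using less_cSup_iff[OF _ bdd] wK by blast
    have "q \<in> sg w x" using q by (simp add: K_def)
    from sg_linear[OF w x m(1) this] have "d m q < e/2" "d m q = \<sigma> - d w q"
      using q \<sigma>[OF q(1)] m(2) by auto
    then show "d w m + d m y \<le> d w y + e"
      using triangle[OF mM KM(1)[OF q(1)] y] KM(3)[OF q(1)] m(2) q(2) by linarith
  qed
  then have my: "d w m + d m y = d w y" using triangle[OF w mM y] by linarith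
  have mx: "d w m + d m x = d w x" using m(1) sg_iff w x by blast
  have "sg x m \<inter> sg m y \<subseteq> {m}"
  proof
    fix q assume q: "q \<in> sg x m \<inter> sg m y"
    then have qM: "q \<in> M" using sg_subset x mM by blast
    have e: "d x q + d q m = d x m" "d m q + d q y = d m y"
      using q sg_between x y mM by auto
    have "d w q + d q x = d w x" "d w q + d q y = d w y" "d w q = d w m + d m q"
      using e mx my triangle[OF w mM qM] triangle[OF w qM x] triangle[OF w qM y]
        commute[of q m] commute[of q x] commute[of m x] by linarith+
    then have "q \<in> K" "d w q = \<sigma> + d m q" using w x y qM by (auto simp: K_def sg_iff m(2))
    then have "d m q = 0" using \<sigma>[of q] nonneg[of m q] by linarith
    then show "q \<in> {m}" using qM mM by simp
  qed
  from sg_concat[OF x mM y this] have "m \<in> sg x y" using sg_ends[OF x mM] by simp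
  then have "d x m + d m y = d x y" using sg_iff[OF x y] by simp
  then show ?thesis using mM mx my by (intro bexI[of _ m] conjI)
qed

lemma pointed: assumes r: "r \<in> M" shows "pointed_tree M d r"
proof
  show "r \<in> M" by fact
  show "\<exists>y\<in>M. d r y = t \<and> d y x = d r x - t" if x: "x \<in> M" "0 \<le> t" "t \<le> d r x" for x t
  proof -
    obtain y where y: "y \<in> sg r x" "d r y = t" using sg_exists[OF r x] by blast
    then have "y \<in> M" "d r y + d y x = d r x" using sg_iff[OF r x(1), of y] by simp_all
    then show ?thesis using y by (intro bexI[of _ y]) simp_all
  qed
  fix x y z assume x: "x \<in> M" and y: "y \<in> M" and z: "z \<in> M"
  \<comment> \<open>Here \<open>a\<close> and \<open>b\<close> are the branchings of
    \<open>y\<close> with \<open>x\<close> and with \<open>z\<close>. Both lie on the one segment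
    from \<open>r\<close> to \<open>y\<close>; the lower of them therefore lies on the way to all
    three points.\<close>
  have *: "2 * d r a \<le> d r x + d r z - d x z"
    if "a \<in> M" "b \<in> M" "d r a + d a x = d r x" "d r a + d a y = d r y" "d r b + d b y = d r y"
      "d r b + d b z = d r z" "d r a \<le> d r b" "x \<in> M" "z \<in> M" for a b x z
  proof -
    have "a \<in> sg r y" "b \<in> sg r y" using that sg_iff[OF r y] by auto
    from sg_linear[OF r y this] have "d a b = d r b - d r a" using that(7) by simp
    then show ?thesis using that triangle[of a b z] triangle[of x a z] commute[of a x] by linarith
  qed
  obtain a where a: "a \<in> M" "d r a + d a x = d r x" "d r a + d a y = d r y" "d x a + d a y = d x y"
    using median[OF r x y] by blast
  obtain b where b: "b \<in> M" "d r b + d b y = d r y" "d r b + d b z = d r z" "d y b + d b z = d y z"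
    using median[OF r y z] by blast
  have "d r x + d r y - d x y = 2 * d r a" "d r y + d r z - d y z = 2 * d r b"
    using a b commute[of x a] commute[of y b] by linarith+
  moreover have "2 * d r a \<le> d r x + d r z - d x z" if "d r a \<le> d r b"
    by (rule *[OF a(1) b(1) a(2,3) b(2,3) that x z])
  moreover have "2 * d r b \<le> d r z + d r x - d z x" if "d r b \<le> d r a"
    by (rule *[OF b(1) a(1) b(3,2) a(3,2) that z x])
  ultimately show "min (d r x + d r y - d x y) (d r y + d r z - d y z) \<le> d r x + d r z - d x z"
    using commute[of x z] by (cases "d r a \<le> d r b") (simp_all add: min_def)
qed

end

lemma real_tree_pointed: "\<lbrakk>real_tree m; r \<in> mspace m\<rbrakk> \<Longrightarrow> pointed_tree (mspace m) (mdist m) r"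
  by (rule real_tree_space.pointed) (simp_all add: real_tree_space_def real_tree_space_axioms_def)

section \<open>Weighted trees in terms of the order\<close>

context pointed_tree
begin

lemma between_above: "x \<sqsubseteq> u \<Longrightarrow> z \<in> between x u \<longleftrightarrow> x \<sqsubseteq> z \<and> z \<sqsubseteq> u"
proof
  assume xu: "x \<sqsubseteq> u" and "z \<in> between x u"
  then have z: "z \<in> M" "d x z + d z u = h u - h x" by (simp_all add: between_def le_d)
  have m: "x \<in> M" "u \<in> M" using leD[OF xu] by simp_all
  have "gp x z = h x \<and> gp z u = h z"
    using gp_le1[OF m(1) z(1)] gp_le1[OF z(1) m(2)] z(2) d_eq[of x z] d_eq[of z u] by linarith
  then show "x \<sqsubseteq> z \<and> z \<sqsubseteq> u" using m z(1) by (simp add: le_def)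
next
  assume xu: "x \<sqsubseteq> u" and "x \<sqsubseteq> z \<and> z \<sqsubseteq> u"
  then show "z \<in> between x u"
    using le_d[OF xu] le_d[of x z] le_d[of z u] leD(2)[of x z] by (simp add: between_def)
qed

lemma between_below:
  assumes z: "z \<sqsubseteq> x" and u: "u \<in> M" and g: "gp x u \<le> h z"
  shows "z \<in> between x u"
proof -
  have "gp z u = gp x u" using gp_below[OF z u] g by simp
  then have "d z u = h z + h u - 2 * gp x u" by (simp add: d_eq)
  then show ?thesis using le_d[OF z] leD[OF z] d_eq[of x u] commute[of x z] by (simp add: between_def)
qed

text \<open>A segment from \<open>x\<close> to a point not above \<open>x\<close> starts downwards,
  and two such segments share an initial piece. So of several segments that meet only at
  \<open>x\<close>, at most one goes down.\<close>

lemma below_common: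
  assumes x: "x \<in> M" and u: "u \<in> M" "\<not> x \<sqsubseteq> u" and v: "v \<in> M" "\<not> x \<sqsubseteq> v"
  shows "\<exists>z. z \<sqsubset> x \<and> z \<in> between x u \<and> z \<in> between x v"
proof -
  let ?t = "max (gp x u) (gp x v)"
  have "gp x u < h x" "gp x v < h x" using leI[OF x u(1)] leI[OF x v(1)] u(2) v(2) by linarith+
  then have t: "0 \<le> ?t" "?t < h x" using gp_nonneg[OF x u(1)] by auto
  then have z: "pt x ?t \<sqsubseteq> x" "h (pt x ?t) = ?t" using pt[OF x, of ?t] by simp_all
  then have "pt x ?t \<sqsubset> x" using t(2) by (intro ltI) simp_all
  moreover have "pt x ?t \<in> between x u" "pt x ?t \<in> between x v"
    using between_below[OF z(1) u(1)] between_below[OF z(1) v(1)] z(2) by simp_all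
  ultimately show ?thesis by blast
qed

lemma between_above_inter:
  assumes u: "x \<sqsubseteq> u" and v: "x \<sqsubseteq> v"
  shows "between x u \<inter> between x v = {x} \<longleftrightarrow> gp u v = h x"
proof
  have m: "u \<in> M" "v \<in> M" "x \<in> M" using leD u v by blast+
  have w: "x \<sqsubseteq> meet u v" using u v by (rule meet_greatest)
  have "meet u v \<in> between x u \<inter> between x v"
    using w meet_le1[OF m(1,2)] meet_le2[OF m(1,2)] between_above u v by simp
  moreover assume "between x u \<inter> between x v = {x}"
  ultimately have "meet u v = x" by simp
  then show "gp u v = h x" using h_meet[OF m(1,2)] by simp
next
  assume g: "gp u v = h x"
  have m: "u \<in> M" "v \<in> M" "x \<in> M" using leD u v by blast+
  show "between x u \<inter> between x v = {x}"
  proof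
    show "between x u \<inter> between x v \<subseteq> {x}"
    proof
      fix z assume "z \<in> between x u \<inter> between x v"
      then have z: "x \<sqsubseteq> z" "z \<sqsubseteq> u" "z \<sqsubseteq> v" using between_above u v by auto
      then have "h z \<le> h x" using le_h[OF meet_greatest[OF z(2,3)]] g h_meet[OF m(1,2)] by simp
      then show "z \<in> {x}" using le_antisym[OF z(1)] by simp
    qed
    show "{x} \<subseteq> between x u \<inter> between x v" using m by (simp add: between_def)
  qed
qed

section \<open>Branch points, tips and fringes in terms of the order\<close>

definition downset :: "'a set \<Rightarrow> bool" where
  "downset A \<longleftrightarrow> A \<subseteq> M \<and> (\<forall>x\<in>A. \<forall>y. y \<sqsubseteq> x \<longrightarrow> y \<in> A)"

text \<open>Two upward arms suffice: the third is the segment down to the root, and at the root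
  itself it is supplied by the convention.\<close>

definition branch :: "'a set \<Rightarrow> 'a set" where
  "branch A = {x. \<exists>u\<in>A. \<exists>v\<in>A. x \<sqsubset> u \<and> x \<sqsubset> v \<and> gp u v = h x}"

definition tips :: "'a set \<Rightarrow> 'a set" where
  "tips A = {x \<in> A. x \<noteq> r \<and> (\<forall>y\<in>A. x \<sqsubseteq> y \<longrightarrow> y = x)}"

definition F :: "'a \<Rightarrow> 'a set" where "F x = {y. x \<sqsubseteq> y}"

lemma downsetD: "\<lbrakk>downset A; x \<in> A; y \<sqsubseteq> x\<rbrakk> \<Longrightarrow> y \<in> A"
  by (auto simp: downset_def)

lemma between_downset:
  assumes A: "downset A" and x: "x \<sqsubseteq> u" and u: "u \<in> A"
  shows "between x u \<subseteq> A" "between u x \<subseteq> A"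
proof -
  show "between x u \<subseteq> A" using between_above[OF x] downsetD[OF A u] by blast
  then show "between u x \<subseteq> A" using between_commute by simp
qed

lemma F_subset: "F x \<subseteq> M"
  using leD(2) by (auto simp: F_def)

lemma gp_lipschitz: "\<lbrakk>x \<in> M; y \<in> M; z \<in> M\<rbrakk> \<Longrightarrow> gp x z \<le> gp x y + d y z"
proof -
  assume "x \<in> M" "y \<in> M" "z \<in> M"
  then have "d r z \<le> d r y + d y z" "d x y \<le> d x z + d z y" by (simp_all add: triangle)
  then show ?thesis using commute[of z y] unfolding gp_def by argo
qed

lemma closedin_F: assumes x: "x \<in> M" shows "closedin mtopology (F x)"
  unfolding closedin_metric
proof (intro conjI allI impI)
  show "F x \<subseteq> M" by (rule F_subset)
  fix y assume y: "y \<in> M - F x"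
  then have e: "0 < h x - gp x y" using leI[OF x, of y] by (force simp: F_def)
  have "disjnt (F x) (mball y (h x - gp x y))"
    unfolding disjnt_iff
  proof (intro allI notI, elim conjE)
    fix z assume "z \<in> F x" "z \<in> mball y (h x - gp x y)"
    then have z: "x \<sqsubseteq> z" "z \<in> M" "d y z < h x - gp x y" by (simp_all add: F_def)
    then show False using gp_lipschitz[OF x, of y z] y leD(3)[OF z(1)] by simp
  qed
  then show "\<exists>e>0. disjnt (F x) (mball y e)" using e by blast
qed

text \<open>Balls are described by the functions \<open>h\<close> and \<open>gp q\<close>, whose superlevel sets are fringes or
  countable unions of fringes.\<close>

lemma open_in_sigma_F:
  assumes D: "countable D" "D \<subseteq> M" and dense: "\<And>x e. \<lbrakk>x \<in> M; 0 < e\<rbrakk> \<Longrightarrow> \<exists>y\<in>D. d x y < e"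
    and U: "openin mtopology U"
  shows "U \<in> sigma_sets M (F ` M)"
proof -
  define S where "S = sigma M (F ` M)"
  have pow: "F ` M \<subseteq> Pow M" using F_subset by blast
  have sp: "space S = M" and st: "sets S = sigma_sets M (F ` M)"
    using pow by (simp_all add: S_def)
  have F: "F x \<in> sets S" if "x \<in> M" for x unfolding st using that by (intro sigma_sets.Basic) simp
  have hm: "h \<in> borel_measurable S"
    unfolding borel_measurable_iff_greater
  proof
    fix t
    \<comment> \<open>The points higher than \<open>t\<close> form an uncountable union of fringes.
      Rational heights on the segments to a countable dense set are enough.\<close>
    define I where "I = {(q, s). q \<in> D \<and> s \<in> \<rat> \<and> t < s \<and> 0 \<le> s \<and> s \<le> h q}"
    have "I \<subseteq> D \<times> \<rat>" by (auto simp: I_def)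
    then have cI: "countable I" using D(1) countable_rat by (meson countable_SIGMA countable_subset)
    have "{w \<in> space S. t < h w} = (\<Union>(q, s)\<in>I. F (pt q s))"
    proof
      show "(\<Union>(q, s)\<in>I. F (pt q s)) \<subseteq> {w \<in> space S. t < h w}"
      proof clarify
        fix q s w assume "(q, s) \<in> I" "w \<in> F (pt q s)"
        then have a: "q \<in> M" "t < s" "0 \<le> s" "s \<le> h q" "pt q s \<sqsubseteq> w" using D(2) by (auto simp: I_def F_def)
        then show "w \<in> space S \<and> t < h w" using le_h[OF a(5)] h_pt[of q s] leD(2)[OF a(5)] sp by simp
      qed
      show "{w \<in> space S. t < h w} \<subseteq> (\<Union>(q, s)\<in>I. F (pt q s))"
      proof
        fix w assume "w \<in> {w \<in> space S. t < h w}"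
        then have w: "w \<in> M" "t < h w" using sp by simp_all
        then obtain q where q: "q \<in> D" "d w q < h w - t" using dense[of w "h w - t"] by auto
        then have qM: "q \<in> M" using D(2) by blast
        have gt: "t < gp w q" using gp_ge[OF w(1) qM] q(2) by linarith
        obtain s where s: "s \<in> \<rat>" "t < s" "0 \<le> s" "s \<le> gp w q"
        proof (cases "t < 0")
          case True
          then show ?thesis using gp_nonneg[OF w(1) qM] by (intro that[of 0]) simp_all
        next
          case False
          obtain s where "s \<in> \<rat>" "t < s" "s < gp w q" using Rats_dense_in_real[OF gt] by blast
          then show ?thesis using False by (intro that[of s]) simp_all
        qed
        have sq: "s \<le> h q" using s(4) gp_le2[OF w(1) qM] by linarith
        have p: "pt q s \<sqsubseteq> q" "h (pt q s) = s" using pt[OF qM s(3) sq] by simp_all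
        have "gp (pt q s) w = s" using gp_below[OF p(1) w(1)] s(4) p(2) gp_commute[of w q] by simp
        then have "pt q s \<sqsubseteq> w" using p w(1) leD(1)[OF p(1)] by (simp add: le_def)
        moreover have "(q, s) \<in> I" using q s sq by (simp add: I_def)
        ultimately show "w \<in> (\<Union>(q, s)\<in>I. F (pt q s))" by (auto simp: F_def)
      qed
    qed
    moreover have "(\<Union>i\<in>I. F (pt (fst i) (snd i))) \<in> sets S"
    proof (rule sets.countable_UN''[OF cI])
      fix i assume "i \<in> I"
      then have "fst i \<in> M" "0 \<le> snd i" "snd i \<le> h (fst i)" using D(2) by (auto simp: I_def)
      then show "F (pt (fst i) (snd i)) \<in> sets S" by (intro F pt_in)
    qed
    ultimately show "{w \<in> space S. t < h w} \<in> sets S" by (simp add: case_prod_beta)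
  qed
  have gm: "gp q \<in> borel_measurable S" if q: "q \<in> M" for q
    unfolding borel_measurable_iff_ge
  proof
    fix a
    consider "a \<le> 0" | "0 < a" "a \<le> h q" | "h q < a" by linarith
    then show "{w \<in> space S. a \<le> gp q w} \<in> sets S"
    proof cases
      case 1
      then have "{w \<in> space S. a \<le> gp q w} = space S" using gp_nonneg[OF q] sp by force
      then show ?thesis by simp
    next
      case 2
      then have p: "pt q a \<sqsubseteq> q" "h (pt q a) = a" using pt[OF q] by simp_all
      have "{w \<in> space S. a \<le> gp q w} = F (pt q a)"
        using gp_below[OF p(1)] p leD(1)[OF p(1)] by (auto simp: sp F_def le_def)
      then show ?thesis using F leD(1)[OF p(1)] by simp
    next
      case 3
      then have "{w \<in> space S. a \<le> gp q w} = {}" using gp_le1[OF q] sp by force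
      then show ?thesis by (simp only: sets.empty_sets)
    qed
  qed
  have ball: "mball q e \<in> sets S" if q: "q \<in> M" for q e
  proof -
    have "(\<lambda>x. h q + h x - 2 * gp q x) \<in> borel_measurable S" using hm gm[OF q] by measurable
    then have "{x \<in> space S. h q + h x - 2 * gp q x < e} \<in> sets S"
      unfolding borel_measurable_iff_less by blast
    moreover have "mball q e = {x \<in> space S. h q + h x - 2 * gp q x < e}"
      using q by (auto simp: sp d_eq)
    ultimately show ?thesis by simp
  qed
  define J where "J = {(q, n::nat). q \<in> D \<and> mball q (1 / Suc n) \<subseteq> U}"
  have "J \<subseteq> D \<times> UNIV" by (auto simp: J_def)
  then have cJ: "countable J" using D(1) by (meson countable_SIGMA countable_subset countableI_type)
  have "U = (\<Union>i\<in>J. mball (fst i) (1 / Suc (snd i)))"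
  proof
    show "(\<Union>i\<in>J. mball (fst i) (1 / Suc (snd i))) \<subseteq> U" by (auto simp: J_def)
    show "U \<subseteq> (\<Union>i\<in>J. mball (fst i) (1 / Suc (snd i)))"
    proof
      fix x assume x: "x \<in> U"
      then have xM: "x \<in> M" using U openin_mtopology by blast
      obtain e where e: "e > 0" "mball x e \<subseteq> U" using U x openin_mtopology by blast
      obtain n where n: "1 / Suc n < e / 2" using nat_approx_posE[of "e/2"] e(1) by auto
      obtain q where q: "q \<in> D" "d x q < 1 / Suc n" using dense[OF xM, of "1 / Suc n"] by auto
      have qM: "q \<in> M" using q D(2) by blast
      have "mball q (1 / Suc n) \<subseteq> mball x e"
        using q n xM commute[of q x] by (intro mball_subset) linarith+
      then have "(q, n) \<in> J" using q e by (simp add: J_def)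
      moreover have "x \<in> mball q (1 / Suc n)" using q(2) qM xM commute[of x q] by simp
      ultimately show "x \<in> (\<Union>i\<in>J. mball (fst i) (1 / Suc (snd i)))" by (intro UN_I[of "(q,n)"]) simp_all
    qed
  qed
  moreover have "(\<Union>i\<in>J. mball (fst i) (1 / Suc (snd i))) \<in> sets S"
    by (rule sets.countable_UN''[OF cJ]) (use ball D(2) in \<open>auto simp: J_def\<close>)
  ultimately show ?thesis by (simp add: st)
qed

section \<open>Countable cofinality of sets closed under meets\<close>

definition meet_closed :: "'a set \<Rightarrow> bool" where
  "meet_closed V \<longleftrightarrow> V \<subseteq> M \<and> (\<forall>u\<in>V. \<forall>v\<in>V. meet u v \<in> V)"

lemma meet_closed_below:
  assumes V: "\<And>v. v \<in> V \<Longrightarrow> v \<sqsubseteq> x"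
  shows "meet_closed V"
  unfolding meet_closed_def
proof (intro conjI ballI)
  show "V \<subseteq> M" using V leD(1) by blast
  fix u v assume uv: "u \<in> V" "v \<in> V"
  consider "u \<sqsubseteq> v" | "v \<sqsubseteq> u" using le_linear'[OF V V, OF uv] ltD(1) by blast
  then show "meet u v \<in> V"
  proof cases
    case 1 then show ?thesis using meet_le uv(1) by simp
  next
    case 2 then show ?thesis using meet_le[OF 2] meet_commute[OF leD(2,1), OF 2 2] uv(2) by simp
  qed
qed

text \<open>Heights replace countability. If the infimum of the heights is attained, its point is
  least; otherwise iterated meets of points whose heights tend to the infimum descend below every
  point of \<open>V\<close>.\<close>

lemma meet_closed_cofinal:
  assumes V: "meet_closed V" "V \<noteq> {}"
  shows "\<exists>e::nat \<Rightarrow> 'a. (\<forall>n. e n \<in> V) \<and> (\<forall>m n. m \<le> n \<longrightarrow> e n \<sqsubseteq> e m) \<and> (\<forall>v\<in>V. \<exists>n. e n \<sqsubseteq> v)"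
proof -
  define \<alpha> where "\<alpha> = Inf (h ` V)"
  have bdd: "bdd_below (h ` V)" by (intro bdd_belowI[of _ 0]) auto
  have \<alpha>: "\<alpha> \<le> h v" if "v \<in> V" for v unfolding \<alpha>_def by (rule cINF_lower[OF bdd that])
  have VM: "v \<in> M" if "v \<in> V" for v using V(1) that by (auto simp: meet_closed_def)
  have mV: "meet u v \<in> V" if "u \<in> V" "v \<in> V" for u v using V(1) that by (auto simp: meet_closed_def)
  show ?thesis
  proof (cases "\<exists>v\<in>V. h v = \<alpha>")
    case True
    then obtain v where v: "v \<in> V" "h v = \<alpha>" by blast
    have "v \<sqsubseteq> u" if u: "u \<in> V" for u
    proof -
      have "h v \<le> h (meet u v)" using \<alpha>[OF mV[OF u v(1)]] v(2) by simp
      then have "meet u v = v" using le_antisym[OF meet_le2[OF VM[OF u] VM[OF v(1)]]] by simp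
      then show ?thesis using meet_le1[OF VM[OF u] VM[OF v(1)]] by simp
    qed
    then show ?thesis using v(1) by (intro exI[of _ "\<lambda>_. v"]) simp
  next
    case False
    have "\<exists>w\<in>V. h w < \<alpha> + 1 / Suc n" for n
    proof -
      have "Inf (h ` V) < \<alpha> + 1 / Suc n" by (simp add: \<alpha>_def)
      then show ?thesis using cInf_less_iff[of "h ` V"] bdd V(2) by auto
    qed
    then obtain w where w: "\<And>n. w n \<in> V" "\<And>n. h (w n) < \<alpha> + 1 / Suc n" by metis
    define e where "e = rec_nat (w 0) (\<lambda>n x. meet x (w (Suc n)))"
    have e0: "e 0 = w 0" and eS: "e (Suc n) = meet (e n) (w (Suc n))" for n by (simp_all add: e_def)
    have eV: "e n \<in> V" for n by (induction n) (simp_all add: e0 eS w mV)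
    have dec: "e n \<sqsubseteq> e m" if "m \<le> n" for m n
      using that
    proof (induction rule: dec_induct)
      case base show ?case using le_refl VM eV by blast
    next
      case (step n)
      have "e (Suc n) \<sqsubseteq> e n" unfolding eS by (rule meet_le1) (use VM eV w in blast)+
      then show ?case using step le_trans by blast
    qed
    have hw: "h (e n) \<le> h (w n)" for n
    proof (cases n)
      case (Suc k)
      show ?thesis unfolding Suc eS by (rule le_h, rule meet_le2) (use VM eV w in blast)+
    qed (simp add: e0)
    have "\<exists>n. e n \<sqsubseteq> v" if v: "v \<in> V" for v
    proof -
      \<comment> \<open>\<open>v\<close> and \<open>e n\<close> need not be comparable. The meet of
        \<open>v\<close> with \<open>e 0\<close> lies on the same segment as every
        \<open>e n\<close>, and there heights decide the order.\<close>
      let ?x = "meet v (e 0)"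
      have x: "?x \<in> V" "?x \<sqsubseteq> e 0" "?x \<sqsubseteq> v" using mV[OF v eV] meet_le2 meet_le1 VM v eV by blast+
      then have "0 < h ?x - \<alpha>" using \<alpha>[OF x(1)] False by force
      then obtain n where "1 / Suc n < h ?x - \<alpha>" using nat_approx_posE by blast
      then have "h (e n) \<le> h ?x" using hw[of n] w(2)[of n] by linarith
      then have "e n \<sqsubseteq> ?x" using le_linear[OF dec[of 0 n] x(2)] by simp
      then show ?thesis using le_trans x(3) by blast
    qed
    then show ?thesis using eV dec by blast
  qed
qed

end

section \<open>Measure, support and span of a weighted tree\<close>

locale wtree =
  fixes T :: "'a rw_tree"
  assumes rw: "rooted_weighted_tree T"
begin

abbreviation "P \<equiv> tree_points T"
abbreviation "p \<equiv> tree_mass T"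

end

sublocale wtree \<subseteq> pointed_tree "tree_points T" "tree_dist T" "tree_root T"
  using rw real_tree_pointed by (auto simp: rooted_weighted_tree_def)

sublocale wtree \<subseteq> mass: prob_space "tree_mass T"
  using rw by (auto simp: rooted_weighted_tree_def)

context wtree
begin

notation le (infix "\<sqsubseteq>" 50)
notation lt (infix "\<sqsubset>" 50)

abbreviation "r \<equiv> tree_root T"
abbreviation "d \<equiv> tree_dist T"

lemma real_tree_T: "real_tree (tree_metric T)"
  using rw by (simp add: rooted_weighted_tree_def)

lemma tree_top_eq: "tree_top T = mtopology"
  by (simp add: mtopology_of_def)

lemma seg_between: "\<lbrakk>x \<in> P; y \<in> P\<rbrakk> \<Longrightarrow> tree_seg T x y = between x y"
  using seg_eq[of x y] by simp

lemma seg_root: "x \<in> P \<Longrightarrow> tree_seg T r x = {z. z \<sqsubseteq> x}"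
  by (simp add: seg_between between_root)

lemma fringe_eq: "x \<in> P \<Longrightarrow> fringe_subtree T x = F x"
  using leD(2) by (auto simp: fringe_subtree_def F_def seg_root)

lemma height_bounded: "\<exists>R. \<forall>x\<in>P. h x \<le> R"
proof -
  have "mbounded P" using real_tree_T by (simp add: real_tree_def)
  then obtain c B where cB: "P \<subseteq> mcball c B" by (auto simp: mbounded_def)
  have "h x \<le> d r c + B" if "x \<in> P" for x
  proof -
    have "x \<in> mcball c B" using that cB by blast
    then show ?thesis using triangle[OF root, of c x] by (simp add: h_def)
  qed
  then show ?thesis by blast
qed

lemma countable_dense:
  obtains D where "countable D" "D \<subseteq> P" "\<And>x e. \<lbrakk>x \<in> P; 0 < e\<rbrakk> \<Longrightarrow> \<exists>y\<in>D. d x y < e"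
proof -
  have "separable_space mtopology" using real_tree_T by (simp add: real_tree_def tree_top_eq)
  then obtain D where D: "countable D" "D \<subseteq> P" "mtopology closure_of D = P"
    by (auto simp: separable_space_def)
  have "\<exists>y\<in>D. d x y < e" if "x \<in> P" "0 < e" for x e
  proof -
    have "x \<in> mtopology closure_of D" using D(3) that by simp
    then show ?thesis using that unfolding metric_closure_of by fastforce
  qed
  then show ?thesis using that D by blast
qed

lemma Cauchy_limit:
  fixes \<sigma> :: "nat \<Rightarrow> 'a"
  assumes "\<And>n. \<sigma> n \<in> P" and "\<And>e. 0 < e \<Longrightarrow> \<exists>N. \<forall>m\<ge>N. \<forall>n\<ge>N. d (\<sigma> m) (\<sigma> n) < e"
  shows "\<exists>a\<in>P. \<forall>e>0. \<exists>N. \<forall>n\<ge>N. d (\<sigma> n) a < e"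
proof -
  have "mcomplete" using real_tree_T by (simp add: real_tree_def mcomplete_of_def)
  moreover have "MCauchy \<sigma>" unfolding MCauchy_def using assms by blast
  ultimately obtain a where "limitin mtopology \<sigma> a sequentially" by (auto simp: mcomplete_def)
  then show ?thesis unfolding limit_metric_sequentially by blast
qed

lemma
  shows space_p: "space p = P"
    and sets_p: "sets p = sigma_sets P {U. openin mtopology U}"
  using rw by (simp_all add: rooted_weighted_tree_def tree_top_eq)

lemma open_sets [measurable]: "openin mtopology U \<Longrightarrow> U \<in> sets p"
  unfolding sets_p by (intro sigma_sets.Basic) simp

lemma closed_sets: "closedin mtopology C \<Longrightarrow> C \<in> sets p"
proof -
  assume C: "closedin mtopology C"
  then have "space p - (P - C) \<in> sets p" by (intro sets.compl_sets open_sets) (simp add: closedin_def)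
  moreover have "space p - (P - C) = C" using closedin_subset[OF C] space_p by auto
  ultimately show ?thesis by simp
qed

lemma F_sets [simp]: "x \<in> P \<Longrightarrow> F x \<in> sets p"
  by (intro closed_sets closedin_F)

lemma singleton_sets [simp]: "x \<in> P \<Longrightarrow> {x} \<in> sets p"
  by (intro closed_sets) (simp add: closedin_Hausdorff_sing_eq[OF Hausdorff_space_mtopology])

lemma ball_sets [simp]: "mball x e \<in> sets p"
  by (intro open_sets openin_mball)

lemma sets_p_F: "sets p = sigma_sets P (F ` P)"
proof
  obtain D where D: "countable D" "D \<subseteq> P" "\<And>x e. \<lbrakk>x \<in> P; 0 < e\<rbrakk> \<Longrightarrow> \<exists>y\<in>D. d x y < e"
    using countable_dense by blast
  show "sets p \<subseteq> sigma_sets P (F ` P)" unfolding sets_p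
    by (intro sigma_sets_mono) (use open_in_sigma_F[OF D] in blast)
  show "sigma_sets P (F ` P) \<subseteq> sets p"
  proof -
    have "F ` P \<subseteq> sets p" using F_sets by blast
    then show ?thesis using sets.sigma_sets_subset[of "F ` P" p] space_p by simp
  qed
qed

definition G :: "'a \<Rightarrow> real" where "G x = measure p (F x)"

definition supp :: "'a set" where "supp = {x \<in> P. \<forall>e>0. 0 < measure p (mball x e)}"

definition span :: "'a set" where "span = {z. \<exists>x\<in>supp. z \<sqsubseteq> x}"

lemma closed_support_eq: "closed_support T = supp"
proof (intro set_eqI iffI)
  fix x assume "x \<in> closed_support T"
  then show "x \<in> supp" by (auto simp: closed_support_def supp_def tree_top_eq)
next
  fix x assume x: "x \<in> supp"
  have "0 < measure p U" if U: "openin mtopology U" "x \<in> U" for U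
  proof -
    obtain e where e: "e > 0" "mball x e \<subseteq> U" using U openin_mtopology by blast
    then have "measure p (mball x e) \<le> measure p U"
      by (intro mass.finite_measure_mono open_sets[OF U(1)])
    moreover have "0 < measure p (mball x e)" using x e by (simp add: supp_def)
    ultimately show ?thesis by linarith
  qed
  then show "x \<in> closed_support T" using x by (simp add: closed_support_def supp_def tree_top_eq)
qed

lemma supp_in: "x \<in> supp \<Longrightarrow> x \<in> P"
  by (simp add: supp_def)

lemma mass_span_eq: "mass_span T = span"
  unfolding mass_span_def span_def closed_support_eq by (auto simp: seg_root supp_in)

lemma downset_span: "downset span"
  unfolding downset_def span_def using leD(1) le_trans by blast

lemma downset_P: "downset P"
  unfolding downset_def using leD(1) by blast

lemma supp_span: "x \<in> supp \<Longrightarrow> x \<in> span"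
  using le_refl supp_in by (auto simp: span_def)

text \<open>By separability the complement of the support is covered by countably many null balls,
  with centres in a dense set and radii \<open>1 / Suc n\<close>.\<close>

lemma supp_hit:
  assumes A: "A \<in> sets p" "0 < measure p A"
  shows "\<exists>x\<in>A. x \<in> supp"
proof (rule ccontr)
  assume no: "\<not> (\<exists>x\<in>A. x \<in> supp)"
  obtain D where D: "countable D" "D \<subseteq> P" "\<And>x e. \<lbrakk>x \<in> P; 0 < e\<rbrakk> \<Longrightarrow> \<exists>y\<in>D. d x y < e"
    using countable_dense by blast
  define J where "J = {(q, n::nat). q \<in> D \<and> measure p (mball q (1 / Suc n)) = 0}"
  have "J \<subseteq> D \<times> UNIV" by (auto simp: J_def)
  then have cJ: "countable J" using D(1) by (meson countable_SIGMA countable_subset countableI_type)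
  define N where "N = (\<Union>i\<in>J. mball (fst i) (1 / Suc (snd i)))"
  have "N \<in> null_sets p" unfolding N_def
  proof (rule null_sets_UN'[OF cJ])
    fix i assume "i \<in> J"
    then have "measure p (mball (fst i) (1 / Suc (snd i))) = 0" by (auto simp: J_def)
    then show "mball (fst i) (1 / Suc (snd i)) \<in> null_sets p"
      by (simp add: null_sets_def mass.emeasure_eq_measure)
  qed
  then have N: "N \<in> sets p" "measure p N = 0" by (auto simp: null_sets_def measure_def)
  have "A \<subseteq> N"
  proof
    fix x assume x: "x \<in> A"
    then have xP: "x \<in> P" using A(1) sets.sets_into_space space_p by blast
    have "x \<notin> supp" using no x by blast
    then obtain e where e: "e > 0" "\<not> 0 < measure p (mball x e)" using xP by (auto simp: supp_def)
    obtain n where n: "1 / Suc n < e / 2" using nat_approx_posE[of "e/2"] e(1) by auto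
    obtain q where q: "q \<in> D" "d x q < 1 / Suc n" using D(3)[OF xP, of "1 / Suc n"] by auto
    have qP: "q \<in> P" using q D(2) by blast
    have "mball q (1 / Suc n) \<subseteq> mball x e"
      using q n xP commute[of q x] by (intro mball_subset) linarith+
    then have "measure p (mball q (1 / Suc n)) \<le> measure p (mball x e)"
      by (intro mass.finite_measure_mono) simp_all
    then have "measure p (mball q (1 / Suc n)) = 0" using e(2) measure_nonneg[of p "mball q (1 / Suc n)"] by linarith
    then have "(q, n) \<in> J" using q by (simp add: J_def)
    moreover have "x \<in> mball q (1 / Suc n)" using q(2) qP xP commute[of x q] by simp
    ultimately show "x \<in> N" unfolding N_def by (intro UN_I[of "(q,n)"]) simp_all
  qed
  then have "measure p A \<le> measure p N" using N(1) by (rule mass.finite_measure_mono)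
  then show False using A(2) N(2) by simp
qed

text \<open>Off the support there is no mass, so an inclusion has to be checked at support points
  only. This matters because spacing, and strict decrease of \<open>G\<close>, give information
  exactly there.\<close>

lemma measure_supp_mono:
  assumes A: "A \<in> sets p" and B: "B \<in> sets p" and sub: "A \<inter> supp \<subseteq> B"
  shows "measure p A \<le> measure p B"
proof (rule ccontr)
  assume "\<not> ?thesis"
  moreover have "measure p A \<le> measure p (A - B) + measure p B"
  proof -
    have "measure p A \<le> measure p ((A - B) \<union> B)"
      using A B by (intro mass.finite_measure_mono sets.Un) auto
    also have "\<dots> \<le> measure p (A - B) + measure p B" using A B by (intro measure_Un_le sets.Diff)
    finally show ?thesis .
  qed
  ultimately have "0 < measure p (A - B)" by linarith
  then obtain x where "x \<in> A - B" "x \<in> supp" using supp_hit[of "A - B"] A B by blast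
  then show False using sub by blast
qed

text \<open>Along a decreasing cofinal sequence the sets increase, so the possibly uncountable union
  is a countable one, measurable and with the limit of the masses as its mass.\<close>

lemma cofinal_bound:
  assumes V: "meet_closed V" "V \<noteq> {}"
    and Q: "\<And>v. v \<in> V \<Longrightarrow> Q v \<in> sets p" "\<And>v. v \<in> V \<Longrightarrow> measure p (Q v) \<le> c"
      "\<And>u v. \<lbrakk>u \<in> V; v \<in> V; u \<sqsubseteq> v\<rbrakk> \<Longrightarrow> Q v \<subseteq> Q u"
  shows "(\<Union>v\<in>V. Q v) \<in> sets p \<and> measure p (\<Union>v\<in>V. Q v) \<le> c"
proof -
  obtain e :: "nat \<Rightarrow> 'a" where e: "\<And>n. e n \<in> V" "\<And>m n. m \<le> n \<Longrightarrow> e n \<sqsubseteq> e m" "\<And>v. v \<in> V \<Longrightarrow> \<exists>n. e n \<sqsubseteq> v"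
    using meet_closed_cofinal[OF V] by blast
  have eq: "(\<Union>v\<in>V. Q v) = (\<Union>n. Q (e n))"
  proof
    show "(\<Union>v\<in>V. Q v) \<subseteq> (\<Union>n. Q (e n))"
    proof
      fix x assume "x \<in> (\<Union>v\<in>V. Q v)"
      then obtain v where v: "v \<in> V" "x \<in> Q v" by blast
      obtain n where "e n \<sqsubseteq> v" using e(3)[OF v(1)] by blast
      then show "x \<in> (\<Union>n. Q (e n))" using Q(3)[OF e(1) v(1)] v(2) by blast
    qed
    show "(\<Union>n. Q (e n)) \<subseteq> (\<Union>v\<in>V. Q v)" using e(1) by (intro UN_least UN_upper)
  qed
  have inc: "incseq (\<lambda>n. Q (e n))" unfolding incseq_def by (intro allI impI Q(3) e)
  have rng: "range (\<lambda>n. Q (e n)) \<subseteq> sets p" by (intro image_subsetI Q(1) e(1))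
  have "measure p (\<Union>n. Q (e n)) \<le> c"
    by (rule LIMSEQ_le_const2[OF mass.finite_Lim_measure_incseq[OF rng inc]])
      (intro exI[of _ 0] allI impI Q(2) e(1))
  moreover have "(\<Union>n. Q (e n)) \<in> sets p" using rng by blast
  ultimately show ?thesis by (simp add: eq)
qed

lemma F_antimono: "x \<sqsubseteq> y \<Longrightarrow> F y \<subseteq> F x"
  using le_trans by (auto simp: F_def)

lemma G_antimono: "x \<sqsubseteq> y \<Longrightarrow> G y \<le> G x"
  unfolding G_def using F_antimono leD(1) by (intro mass.finite_measure_mono) auto

lemma G_nonneg [simp]: "0 \<le> G x"
  by (simp add: G_def)

lemma G_root [simp]: "G r = 1"
proof -
  have "F r = space p" using root_le F_subset space_p by (auto simp: F_def)
  then show ?thesis by (simp add: G_def mass.prob_space)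
qed

lemma G_le_1: "G x \<le> 1"
  by (simp add: G_def)

text \<open>The fringes of points climbing to \<open>x\<close> decrease to \<open>F x\<close>, so
  \<open>G\<close> is continuous from below. From above it may jump, at atoms and at branch
  points.\<close>

lemma G_left_cont:
  assumes x: "x \<in> P" "x \<noteq> r" and c: "\<And>y. y \<sqsubset> x \<Longrightarrow> c \<le> G y"
  shows "c \<le> G x"
proof -
  have hx: "0 < h x" using x h_zero_iff[of x] h_nonneg[of x] by linarith
  define y where "y n = pt x (h x * (1 - 1 / Suc n))" for n :: nat
  have t: "0 \<le> h x * (1 - 1 / Suc n)" "h x * (1 - 1 / Suc n) < h x" for n
    using hx by simp_all
  have y: "y n \<sqsubseteq> x" "h (y n) = h x * (1 - 1 / Suc n)" for n
    using pt[OF x(1) t(1) less_imp_le[OF t(2)]] by (simp_all add: y_def)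
  have yx: "y n \<sqsubset> x" for n using y t by (intro ltI) simp_all
  have yy: "y m \<sqsubseteq> y n" if "m \<le> n" for m n
    using that hx y by (intro le_linear[OF y(1) y(1)]) (simp add: frac_le)
  have F: "F x = (\<Inter>n. F (y n))"
  proof
    show "F x \<subseteq> (\<Inter>n. F (y n))" using F_antimono[OF y(1)] by blast
    show "(\<Inter>n. F (y n)) \<subseteq> F x"
    proof
      fix z assume "z \<in> (\<Inter>n. F (y n))"
      then have z: "y n \<sqsubseteq> z" for n by (auto simp: F_def)
      have zP: "z \<in> P" using leD(2)[OF z] .
      have "h x * (1 - 1 / Suc n) \<le> gp x z" for n
        using gp_mono[OF y(1) le_refl[OF zP], of n] leD(3)[OF z, of n] y(2)[of n] by simp
      moreover have "(\<lambda>n. h x * (1 - 1 / Suc n)) \<longlonglongrightarrow> h x * (1 - 0)"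
        by (intro tendsto_intros LIMSEQ_Suc[OF lim_1_over_n])
      ultimately have "h x \<le> gp x z" using LIMSEQ_le_const2[of _ "h x" "gp x z"] by auto
      then show "z \<in> F x" using leI[OF x(1) zP] by (simp add: F_def)
    qed
  qed
  have "decseq (\<lambda>n. F (y n))" unfolding decseq_def using yy F_antimono by blast
  moreover have "range (\<lambda>n. F (y n)) \<subseteq> sets p" using F_sets leD(1)[OF y(1)] by blast
  ultimately have "(\<lambda>n. measure p (F (y n))) \<longlonglongrightarrow> measure p (F x)"
    unfolding F by (intro mass.finite_Lim_measure_decseq)
  then show ?thesis unfolding G_def[symmetric]
    by (rule LIMSEQ_le_const) (use c[OF yx] in blast)
qed

lemma F_nbhd: "y \<sqsubset> x \<Longrightarrow> mball x (h x - h y) \<subseteq> F y"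
  using le_ball[OF ltD(1)] by (auto simp: F_def)

lemma G_pos_supp: assumes "y \<sqsubset> x" "x \<in> supp" shows "0 < G y"
proof -
  have "0 < measure p (mball x (h x - h y))" using assms ltD(4) by (auto simp: supp_def)
  also have "\<dots> \<le> G y" unfolding G_def
    using F_nbhd[OF assms(1)] ltD(2)[OF assms(1)] by (intro mass.finite_measure_mono) simp_all
  finally show ?thesis .
qed

lemma G_pos_span: "\<lbrakk>x \<in> P; 0 < G x\<rbrakk> \<Longrightarrow> x \<in> span"
proof -
  assume "x \<in> P" "0 < G x"
  then obtain y where "y \<in> F x" "y \<in> supp" using supp_hit[of "F x"] by (auto simp: G_def)
  then show ?thesis by (auto simp: span_def F_def)
qed

lemma atom_supp: "\<lbrakk>x \<in> P; 0 < measure p {x}\<rbrakk> \<Longrightarrow> x \<in> supp"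
  using supp_hit[of "{x}"] by auto

section \<open>Special points in terms of the order\<close>

definition "limit_of B x \<longleftrightarrow> (\<forall>e>0. \<exists>y\<in>B. y \<noteq> x \<and> y \<in> P \<and> d x y < e)"

lemma derived_iff: "x \<in> P \<Longrightarrow> x \<in> tree_top T derived_set_of B \<longleftrightarrow> limit_of B x"
  unfolding tree_top_eq metric_derived_set_of limit_of_def by auto

lemma within_iff:
  "\<lbrakk>A \<subseteq> P\<rbrakk> \<Longrightarrow> segment_within T A x u \<longleftrightarrow> x \<in> A \<and> u \<in> A \<and> between x u \<subseteq> A"
  unfolding segment_within_def using seg_between by (metis subsetD)

lemma rooted_branch_points_eq:
  assumes A: "downset A"
  shows "rooted_branch_points T A = branch A"
proof
  have AP: "A \<subseteq> P" using A by (simp add: downset_def)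
  have key: "x \<in> branch A"
    if "u \<in> A" "v \<in> A" "x \<sqsubseteq> u" "x \<sqsubseteq> v" "u \<noteq> x" "v \<noteq> x" "tree_seg T x u \<inter> tree_seg T x v = {x}" for x u v
  proof -
    have "between x u \<inter> between x v = {x}" using that leD(1,2) by (metis seg_between)
    then show ?thesis using that between_above_inter[OF that(3,4)] unfolding branch_def lt_def by blast
  qed
  show "rooted_branch_points T A \<subseteq> branch A"
  proof
    fix x assume "x \<in> rooted_branch_points T A"
    then consider (b) "x \<in> branch_points T A" | (r) "x = r" "\<exists>u v. u \<noteq> x \<and> v \<noteq> x \<and> segment_within T A x u \<and>
        segment_within T A x v \<and> tree_seg T x u \<inter> tree_seg T x v = {x}"
      unfolding rooted_branch_points_def by blast
    then show "x \<in> branch A"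
    proof cases
      case b
      then obtain u v w where n: "u \<noteq> x" "v \<noteq> x" "w \<noteq> x"
        and s: "segment_within T A x u" "segment_within T A x v" "segment_within T A x w"
        and i: "tree_seg T x u \<inter> tree_seg T x v = {x}" "tree_seg T x u \<inter> tree_seg T x w = {x}"
          "tree_seg T x v \<inter> tree_seg T x w = {x}"
        unfolding branch_points_def by blast
      have m: "x \<in> A" "u \<in> A" "v \<in> A" "w \<in> A" using s by (auto simp: segment_within_def)
      then have mP: "x \<in> P" "u \<in> P" "v \<in> P" "w \<in> P" using AP by blast+
      \<comment> \<open>At most one of the three segments goes down, so two of them go up and
        witness \<open>branch\<close>.\<close>
      have two: "x \<sqsubseteq> a \<or> x \<sqsubseteq> b"
        if a: "a \<in> P" and b: "b \<in> P" and ab: "tree_seg T x a \<inter> tree_seg T x b = {x}" for a b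
      proof (rule ccontr)
        assume "\<not> ?thesis"
        then obtain z where "z \<sqsubset> x" "z \<in> between x a" "z \<in> between x b"
          using below_common[OF mP(1) a _ b] by blast
        moreover have "between x a \<inter> between x b = {x}" using a b ab mP by (simp add: seg_between)
        ultimately have "z \<sqsubset> x" "z = x" by blast+
        then show False using ltD(5) by blast
      qed
      then show ?thesis
        using two[OF mP(2,3) i(1)] two[OF mP(2,4) i(2)] two[OF mP(3,4) i(3)]
          key[OF m(2,3) _ _ n(1,2) i(1)] key[OF m(2,4) _ _ n(1,3) i(2)] key[OF m(3,4) _ _ n(2,3) i(3)]
        by blast
    next
      case r
      then obtain u v where s: "u \<noteq> x" "v \<noteq> x" "segment_within T A x u" "segment_within T A x v"
        "tree_seg T x u \<inter> tree_seg T x v = {x}" by blast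
      then have m: "u \<in> A" "v \<in> A" by (auto simp: segment_within_def)
      then have "x \<sqsubseteq> u" "x \<sqsubseteq> v" using root_le AP r by blast+
      then show ?thesis using key[OF m] s by blast
    qed
  qed
  show "branch A \<subseteq> rooted_branch_points T A"
  proof
    fix x assume "x \<in> branch A"
    then obtain u v where uv: "u \<in> A" "v \<in> A" "x \<sqsubset> u" "x \<sqsubset> v" "gp u v = h x"
      by (auto simp: branch_def)
    then have le: "x \<sqsubseteq> u" "x \<sqsubseteq> v" and n: "u \<noteq> x" "v \<noteq> x" using ltD by blast+
    have xA: "x \<in> A" using downsetD[OF A uv(1) le(1)] .
    have xP: "x \<in> P" "u \<in> P" "v \<in> P" using xA uv AP by blast+
    have i: "tree_seg T x u \<inter> tree_seg T x v = {x}"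
      using between_above_inter[OF le] uv(5) xP by (simp add: seg_between)
    have w: "segment_within T A x u" "segment_within T A x v"
      using within_iff[OF AP] xA uv between_downset[OF A] le by blast+
    show "x \<in> rooted_branch_points T A"
    proof (cases "x = r")
      case True
      then show ?thesis unfolding rooted_branch_points_def using n w i by blast
    next
      case False
      have rA: "r \<in> A" using downsetD[OF A xA root_le[OF xP(1)]] .
      have wr: "segment_within T A x r"
        using within_iff[OF AP] xA rA between_downset[OF A root_le[OF xP(1)] xA] by blast
      \<comment> \<open>Away from the root, the segment from \<open>x\<close> down to
        \<open>r\<close> serves as the third arm.\<close>
      have ir: "tree_seg T x a \<inter> tree_seg T x r = {x}" if "x \<sqsubseteq> a" for a
      proof -
        have "between x a \<inter> between x r = {x}"
        proof
          show "between x a \<inter> between x r \<subseteq> {x}"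
          proof
            fix z assume z: "z \<in> between x a \<inter> between x r"
            then have "x \<sqsubseteq> z" using between_above[OF that] by blast
            moreover have "z \<sqsubseteq> x" using z between_root[OF xP(1)] between_commute[of x r] by blast
            ultimately show "z \<in> {x}" using le_antisym le_h by blast
          qed
          show "{x} \<subseteq> between x a \<inter> between x r" using xP by (simp add: between_def)
        qed
        then show ?thesis using seg_between xP leD(2)[OF that] root by simp
      qed
      have "x \<in> branch_points T A"
        unfolding branch_points_def using n w wr i ir[OF le(1)] ir[OF le(2)] False
        by (intro CollectI exI[of _ u] exI[of _ v] exI[of _ r] conjI) simp_all
      then show ?thesis by (simp add: rooted_branch_points_def)
    qed
  qed
qed

lemma rooted_leaves_eq:
  assumes A: "downset A"
  shows "rooted_leaves T A = tips A"
proof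
  have AP: "A \<subseteq> P" using A by (simp add: downset_def)
  show "rooted_leaves T A \<subseteq> tips A"
  proof
    fix x assume "x \<in> rooted_leaves T A"
    then have x: "x \<in> A" "x \<noteq> r" and l: "\<And>u v. \<lbrakk>segment_within T A u v; x \<in> tree_seg T u v\<rbrakk> \<Longrightarrow> x = u \<or> x = v"
      by (auto simp: rooted_leaves_def leaves_def)
    have "y = x" if y: "y \<in> A" "x \<sqsubseteq> y" for y
    proof -
      have yP: "y \<in> P" using y AP by blast
      have rA: "r \<in> A" using downsetD[OF A y(1) root_le[OF yP]] .
      have "segment_within T A r y"
        using within_iff[OF AP] rA y(1) between_downset(1)[OF A root_le[OF yP] y(1)] by blast
      moreover have "x \<in> tree_seg T r y" using y(2) seg_root[OF yP] by simp
      ultimately show ?thesis using l x(2) by blast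
    qed
    then show "x \<in> tips A" using x by (auto simp: tips_def)
  qed
  show "tips A \<subseteq> rooted_leaves T A"
  proof
    fix x assume "x \<in> tips A"
    then have x: "x \<in> A" "x \<noteq> r" and mx: "\<And>y. \<lbrakk>y \<in> A; x \<sqsubseteq> y\<rbrakk> \<Longrightarrow> y = x" by (auto simp: tips_def)
    have xP: "x \<in> P" using x AP by blast
    have "x = u \<or> x = v" if w: "segment_within T A u v" "x \<in> tree_seg T u v" for u v
    proof (rule ccontr)
      assume ne: "\<not> (x = u \<or> x = v)"
      have uA: "u \<in> A" "v \<in> A" using w by (auto simp: segment_within_def)
      then have uP: "u \<in> P" "v \<in> P" using AP by blast+
      \<comment> \<open>By maximality of \<open>x\<close> both halves of the segment through
        \<open>x\<close> would start downwards and overlap, so that going through \<open>x\<close>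
        would be a detour.\<close>
      have "\<not> x \<sqsubseteq> u" "\<not> x \<sqsubseteq> v" using mx uA ne by blast+
      then obtain z where z: "z \<sqsubset> x" "z \<in> between x u" "z \<in> between x v"
        using below_common[OF xP uP(1) _ uP(2)] by blast
      have zP: "z \<in> P" "d z x > 0" using ltD[OF z(1)] xP by auto
      have "d x z + d z u = d x u" "d x z + d z v = d x v" "d u x + d x v = d u v"
        using z w(2) uP by (auto simp: between_def seg_between)
      then show False
        using triangle[OF uP(1) zP(1) uP(2)] zP(2) commute[of u x] commute[of u z] commute[of x z] by linarith
    qed
    then show "x \<in> rooted_leaves T A" using x by (auto simp: rooted_leaves_def leaves_def)
  qed
qed

lemma special_points_eq:
  "special_points T = {x \<in> P. 0 < measure p {x}} \<union> branch span \<union> {x \<in> tips span. \<not> limit_of (branch span) x}"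
proof -
  have "span \<subseteq> P" using downset_span by (simp add: downset_def)
  then have "tips span \<subseteq> P" by (auto simp: tips_def)
  then have "isolated_leaves T span = {x \<in> tips span. \<not> limit_of (branch span) x}"
    using derived_iff
    by (auto simp: isolated_leaves_def rooted_leaves_eq[OF downset_span] rooted_branch_points_eq[OF downset_span])
  then show ?thesis
    by (simp add: special_points_def atom_locations_def mass_span_eq rooted_branch_points_eq[OF downset_span])
qed

lemma special_in: "x \<in> special_points T \<Longrightarrow> x \<in> span \<and> x \<in> P"
proof -
  assume "x \<in> special_points T"
  then consider "x \<in> P" "0 < measure p {x}" | "x \<in> branch span" | "x \<in> tips span" unfolding special_points_eq by blast
  then have "x \<in> span"
  proof cases
    case 1 then show ?thesis by (intro supp_span atom_supp)
  next
    case 2 then show ?thesis unfolding branch_def using downsetD[OF downset_span] ltD(1) by blast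
  qed (simp add: tips_def)
  then show ?thesis using downset_span by (auto simp: downset_def)
qed

end

section \<open>The two equivalence relations\<close>

lemma mass_structural_isomorphism_id: "mass_structural_isomorphism T T id"
  by (simp add: mass_structural_isomorphism_def)

lemma mass_structural_isomorphism_sym:
  assumes "mass_structural_isomorphism T1 T2 \<phi>"
  shows "mass_structural_isomorphism T2 T1 (inv_into (special_points T1) \<phi>)"
proof -
  let ?\<psi> = "inv_into (special_points T1) \<phi>"
  have b: "bij_betw \<phi> (special_points T1) (special_points T2)"
    using assms by (simp add: mass_structural_isomorphism_def)
  have "?\<psi> y \<in> special_points T1 \<and> \<phi> (?\<psi> y) = y" if "y \<in> special_points T2" for y
    using b that bij_betw_inv_into_right bij_betwE bij_betw_inv_into by metis
  then show ?thesis
    using assms bij_betw_inv_into[OF b] unfolding mass_structural_isomorphism_def by metis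
qed

lemma mass_structural_isomorphism_trans:
  assumes "mass_structural_isomorphism T1 T2 \<phi>" "mass_structural_isomorphism T2 T3 \<psi>"
  shows "mass_structural_isomorphism T1 T3 (\<psi> \<circ> \<phi>)"
proof -
  have b: "bij_betw \<phi> (special_points T1) (special_points T2)"
    "bij_betw \<psi> (special_points T2) (special_points T3)"
    using assms by (simp_all add: mass_structural_isomorphism_def)
  have "\<phi> x \<in> special_points T2" if "x \<in> special_points T1" for x using b(1) that bij_betwE by blast
  then show ?thesis
    using assms bij_betw_trans[OF b] unfolding mass_structural_isomorphism_def by simp
qed

lemma equiv_mass_structural_rel: "equiv {T. rooted_weighted_tree T} mass_structural_rel"
proof (rule equivI)
  show "mass_structural_rel \<subseteq> {T. rooted_weighted_tree T} \<times> {T. rooted_weighted_tree T}"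
    by (auto simp: mass_structural_rel_def)
  show "refl_on {T. rooted_weighted_tree T} mass_structural_rel"
    using mass_structural_isomorphism_id by (auto simp: refl_on_def mass_structural_rel_def)
  show "sym mass_structural_rel"
    using mass_structural_isomorphism_sym by (auto simp: sym_def mass_structural_rel_def)
  show "trans mass_structural_rel"
    using mass_structural_isomorphism_trans unfolding trans_def mass_structural_rel_def by blast
qed

section \<open>Isometries and the comparison of masses along them\<close>

locale tree_pair = T1: wtree T1 + T2: wtree T2 for T1 :: "'a rw_tree" and T2 :: "'b rw_tree"

locale tree_isometry = tree_pair T1 T2 for T1 :: "'a rw_tree" and T2 :: "'b rw_tree" +
  fixes f :: "'a \<Rightarrow> 'b"
  assumes bij: "bij_betw f (tree_points T1) (tree_points T2)"
    and isometry: "\<lbrakk>x \<in> tree_points T1; y \<in> tree_points T1\<rbrakk> \<Longrightarrow> tree_dist T2 (f x) (f y) = tree_dist T1 x y"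
    and root_f: "f (tree_root T1) = tree_root T2"
begin

lemma f_in [simp]: "x \<in> T1.P \<Longrightarrow> f x \<in> T2.P"
  using bij bij_betwE by blast

lemma f_surj: assumes "y \<in> T2.P" obtains x where "x \<in> T1.P" "y = f x"
  using assms bij unfolding bij_betw_def by blast

lemma f_inj: "\<lbrakk>x \<in> T1.P; y \<in> T1.P\<rbrakk> \<Longrightarrow> f x = f y \<longleftrightarrow> x = y"
  using bij unfolding bij_betw_def inj_on_def by blast

lemma h_f [simp]: "x \<in> T1.P \<Longrightarrow> T2.h (f x) = T1.h x"
  using isometry[of "tree_root T1" x] by (simp add: T1.h_def T2.h_def root_f)

lemma gp_f [simp]: "\<lbrakk>x \<in> T1.P; y \<in> T1.P\<rbrakk> \<Longrightarrow> T2.gp (f x) (f y) = T1.gp x y"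
  using isometry[of x y] T1.d_eq[of x y] T2.d_eq[of "f x" "f y"] by simp

lemma le_f [simp]: "\<lbrakk>x \<in> T1.P; y \<in> T1.P\<rbrakk> \<Longrightarrow> T2.le (f x) (f y) \<longleftrightarrow> T1.le x y"
  by (simp add: T1.le_def T2.le_def)

lemma lt_f [simp]: "\<lbrakk>x \<in> T1.P; y \<in> T1.P\<rbrakk> \<Longrightarrow> T2.lt (f x) (f y) \<longleftrightarrow> T1.lt x y"
  by (simp add: T1.lt_def T2.lt_def f_inj)

lemma vimage_F: "x \<in> T1.P \<Longrightarrow> f -` T2.F (f x) \<inter> T1.P = T1.F x"
  using T1.F_subset[of x] by (auto simp: T1.F_def T2.F_def)

lemma measurable_f: "f \<in> measurable T1.p T2.p"
proof (rule measurable_sigma_sets[OF T2.sets_p_F])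
  show "T2.F ` T2.P \<subseteq> Pow T2.P" using T2.F_subset by blast
  show "f \<in> space T1.p \<rightarrow> T2.P" by (simp add: T1.space_p)
  fix y assume "y \<in> T2.F ` T2.P"
  then obtain x where "x \<in> T1.P" "y = T2.F (f x)" using f_surj by blast
  then show "f -` y \<inter> space T1.p \<in> T1.mass.events" using vimage_F by (simp add: T1.space_p)
qed

lemma inverse: "tree_isometry T2 T1 (inv_into T1.P f)"
proof -
  let ?g = "inv_into T1.P f"
  have g: "?g y \<in> T1.P" "f (?g y) = y" if "y \<in> T2.P" for y
    using bij that unfolding bij_betw_def by (auto intro: inv_into_into f_inv_into_f)
  show ?thesis
  proof
    show "bij_betw ?g T2.P T1.P" by (rule bij_betw_inv_into[OF bij])
    show "T1.d (?g x) (?g y) = T2.d x y" if "x \<in> T2.P" "y \<in> T2.P" for x y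
      using isometry[OF g(1) g(1), OF that] g that by simp
    show "?g T2.r = T1.r"
      using g[of T2.r] root_f f_inj[of "?g T2.r" T1.r] by simp
  qed
qed

text \<open>Two fringes are nested or disjoint. Together with the empty set they form an
  intersection-stable generator of the Borel sets, and finite measures need to be compared on it
  only.\<close>

lemma distr_eqI:
  assumes G: "\<And>x. x \<in> T1.P \<Longrightarrow> T2.G (f x) = T1.G x"
  shows "distr T1.p T2.p f = T2.p"
proof (rule measure_eqI_generator_eq)
  let ?E = "insert {} (T2.F ` T2.P)"
  show "Int_stable ?E"
  proof (rule Int_stableI)
    have *: "T2.F x \<inter> T2.F y = {} \<or> (\<exists>z\<in>T2.P. T2.F x \<inter> T2.F y = T2.F z)"
      if xy: "x \<in> T2.P" "y \<in> T2.P" for x y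
    proof (cases "T2.F x \<inter> T2.F y = {}")
      case False
      then obtain z where "T2.le x z" "T2.le y z" by (auto simp: T2.F_def)
      then have "T2.le x y \<or> T2.le y x" using T2.le_linear' T2.ltD(1) by blast
      then have "T2.F x \<inter> T2.F y = T2.F y \<or> T2.F x \<inter> T2.F y = T2.F x"
        using T2.F_antimono by blast
      then show ?thesis using xy by blast
    qed simp
    fix a b assume "a \<in> ?E" "b \<in> ?E"
    then show "a \<inter> b \<in> ?E" using * by (elim insertE imageE) auto
  qed
  show "?E \<subseteq> Pow T2.P" using T2.F_subset by blast
  show "sets (distr T1.p T2.p f) = sigma_sets T2.P ?E" "sets T2.p = sigma_sets T2.P ?E"
  proof -
    have "sigma_sets T2.P ?E = sigma_sets T2.P (T2.F ` T2.P)"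
    proof
      show "sigma_sets T2.P ?E \<subseteq> sigma_sets T2.P (T2.F ` T2.P)"
        by (intro sigma_sets_mono) (auto intro: sigma_sets.Empty sigma_sets.Basic)
      show "sigma_sets T2.P (T2.F ` T2.P) \<subseteq> sigma_sets T2.P ?E"
        by (intro sigma_sets_mono') blast
    qed
    then show "sets (distr T1.p T2.p f) = sigma_sets T2.P ?E" "sets T2.p = sigma_sets T2.P ?E"
      using T2.sets_p_F by simp_all
  qed
  show "emeasure (distr T1.p T2.p f) X = emeasure T2.p X" if X: "X \<in> ?E" for X
  proof (cases "X = {}")
    case False
    then obtain y where "y \<in> T2.P" "X = T2.F y" using X by blast
    then obtain x where x: "x \<in> T1.P" "X = T2.F (f x)" using f_surj by blast
    have "emeasure (distr T1.p T2.p f) X = emeasure T1.p (T1.F x)"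
      using x vimage_F by (subst emeasure_distr[OF measurable_f]) (simp_all add: T1.space_p)
    also have "\<dots> = emeasure T2.p X"
      using G[OF x(1)] x by (simp add: T1.mass.emeasure_eq_measure T2.mass.emeasure_eq_measure T1.G_def T2.G_def)
    finally show ?thesis .
  qed simp
  have "T2.P = T2.F T2.r" using T2.root_le T2.F_subset by (auto simp: T2.F_def)
  then show "range (\<lambda>_::nat. T2.P) \<subseteq> ?E" by auto
  show "(\<Union>i::nat. T2.P) = T2.P" by simp
  show "emeasure (distr T1.p T2.p f) T2.P \<noteq> \<infinity>" 
  proof -
    interpret D: prob_space "distr T1.p T2.p f" by (rule T1.mass.prob_space_distr[OF measurable_f])
    show ?thesis by (simp add: D.emeasure_eq_measure)
  qed
qed

end

section \<open>Isomorphisms are mass-structural\<close>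

context wtree
begin

lemma below_sets [simp]: assumes x: "x \<in> P" shows "{z. z \<sqsubseteq> x} \<in> sets p"
proof (intro closed_sets, unfold closedin_metric, intro conjI allI impI)
  show "{z. z \<sqsubseteq> x} \<subseteq> P" using leD(1) by blast
  fix y assume "y \<in> P - {z. z \<sqsubseteq> x}"
  then have y: "y \<in> P" "\<not> y \<sqsubseteq> x" by simp_all
  \<comment> \<open>The radius is halved because both \<open>h\<close> and the Gromov product with
    \<open>x\<close> may change by the distance moved.\<close>
  then have e: "0 < (h y - gp y x) / 2" using leI[OF y(1) x] by fastforce
  have "disjnt {z. z \<sqsubseteq> x} (mball y ((h y - gp y x) / 2))"
    unfolding disjnt_iff
  proof (intro allI notI, elim conjE)
    fix z assume "z \<in> {z. z \<sqsubseteq> x}" "z \<in> mball y ((h y - gp y x) / 2)"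
    then have z: "z \<sqsubseteq> x" "z \<in> P" "d y z < (h y - gp y x) / 2" by simp_all
    have "gp x z \<le> gp x y + d y z" by (rule gp_lipschitz[OF x y(1) z(2)])
    moreover have "h y - d y z \<le> h z" using gp_ge[OF y(1) z(2)] gp_le2[OF y(1) z(2)] by linarith
    moreover have "gp x z = h z" using leD(4)[OF z(1)] .
    ultimately show False using z(3) gp_commute[of x y] by argo
  qed
  then show "\<exists>e>0. disjnt {z. z \<sqsubseteq> x} (mball y e)" using e by blast
qed

end

locale tree_iso = tree_isometry T1 T2 f for T1 :: "'a rw_tree" and T2 :: "'b rw_tree" and f +
  assumes mass_f: "distr (tree_mass T1) (tree_mass T2) f = tree_mass T2"
begin

lemma measure_f: "\<lbrakk>A \<in> T2.mass.events\<rbrakk> \<Longrightarrow> measure T2.p A = measure T1.p (f -` A \<inter> T1.P)"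
  using measure_distr[OF measurable_f, of A] by (simp add: mass_f T1.space_p)

lemma measure_F: "x \<in> T1.P \<Longrightarrow> measure T2.p (T2.F (f x)) = measure T1.p (T1.F x)"
  using measure_f[of "T2.F (f x)"] vimage_F by simp

lemma measure_below: "x \<in> T1.P \<Longrightarrow> measure T2.p {z. T2.le z (f x)} = measure T1.p {z. T1.le z x}"
proof -
  assume x: "x \<in> T1.P"
  have "f -` {z. T2.le z (f x)} \<inter> T1.P = {z. T1.le z x}" using x T1.leD(1) by auto
  then show ?thesis using measure_f[of "{z. T2.le z (f x)}"] x by simp
qed

lemma measure_point: "x \<in> T1.P \<Longrightarrow> measure T2.p {f x} = measure T1.p {x}"
proof -
  assume x: "x \<in> T1.P"
  then have "f -` {f x} \<inter> T1.P = {x}" using f_inj by auto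
  then show ?thesis using measure_f[of "{f x}"] x by simp
qed

lemma supp_f: "x \<in> T1.P \<Longrightarrow> f x \<in> T2.supp \<longleftrightarrow> x \<in> T1.supp"
proof -
  assume x: "x \<in> T1.P"
  have "f -` T2.mball (f x) e \<inter> T1.P = T1.mball x e" for e using x isometry by auto
  then have "measure T2.p (T2.mball (f x) e) = measure T1.p (T1.mball x e)" for e
    using measure_f[of "T2.mball (f x) e"] by simp
  then show ?thesis using x by (simp add: T1.supp_def T2.supp_def)
qed

lemma span_P: "T1.span \<subseteq> T1.P" "T2.span \<subseteq> T2.P"
  using T1.downset_span T2.downset_span by (simp_all add: T1.downset_def T2.downset_def)

lemma span_f: "x \<in> T1.P \<Longrightarrow> f x \<in> T2.span \<longleftrightarrow> x \<in> T1.span"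
proof -
  assume x: "x \<in> T1.P"
  show ?thesis
  proof
    assume "f x \<in> T2.span"
    then obtain y where y: "y \<in> T2.supp" "T2.le (f x) y" by (auto simp: T2.span_def)
    obtain z where "z \<in> T1.P" "y = f z" using f_surj[OF T2.supp_in[OF y(1)]] .
    then show "x \<in> T1.span" using y x supp_f by (auto simp: T1.span_def)
  next
    assume "x \<in> T1.span"
    then obtain z where "z \<in> T1.supp" "T1.le x z" by (auto simp: T1.span_def)
    then have "f z \<in> T2.supp" "T2.le (f x) (f z)" using x supp_f T1.supp_in by simp_all
    then show "f x \<in> T2.span" unfolding T2.span_def by blast
  qed
qed

lemma span_image: "T2.span = f ` T1.span"
proof
  show "T2.span \<subseteq> f ` T1.span"
  proof
    fix y assume y: "y \<in> T2.span"
    then obtain x where "x \<in> T1.P" "y = f x" using f_surj span_P by blast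
    then show "y \<in> f ` T1.span" using span_f y by blast
  qed
  show "f ` T1.span \<subseteq> T2.span" using span_f span_P by blast
qed

lemma branch_f: "x \<in> T1.P \<Longrightarrow> f x \<in> T2.branch T2.span \<longleftrightarrow> x \<in> T1.branch T1.span"
proof -
  assume x: "x \<in> T1.P"
  have "(T2.lt (f x) (f u) \<and> T2.lt (f x) (f v) \<and> T2.gp (f u) (f v) = T2.h (f x)) \<longleftrightarrow>
      (T1.lt x u \<and> T1.lt x v \<and> T1.gp u v = T1.h x)" if "u \<in> T1.span" "v \<in> T1.span" for u v
    using that span_P x by (simp add: subset_iff)
  then show ?thesis unfolding T1.branch_def T2.branch_def span_image by auto
qed

lemma tips_f: "x \<in> T1.P \<Longrightarrow> f x \<in> T2.tips T2.span \<longleftrightarrow> x \<in> T1.tips T1.span"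
proof -
  assume x: "x \<in> T1.P"
  have "(T2.le (f x) (f u) \<longrightarrow> f u = f x) \<longleftrightarrow> (T1.le x u \<longrightarrow> u = x)" if "u \<in> T1.span" for u
    using that span_P x f_inj by (simp add: subset_iff)
  moreover have "f x \<noteq> T2.r \<longleftrightarrow> x \<noteq> T1.r" using f_inj[OF x T1.root] root_f by simp
  moreover have "f x \<in> T2.span \<longleftrightarrow> x \<in> T1.span" using span_f x by simp
  ultimately show ?thesis unfolding T1.tips_def T2.tips_def span_image by auto
qed

lemma limit_f: "x \<in> T1.P \<Longrightarrow> T2.limit_of (T2.branch T2.span) (f x) \<longleftrightarrow> T1.limit_of (T1.branch T1.span) x"
proof -
  assume x: "x \<in> T1.P"
  have "(\<exists>y\<in>T2.branch T2.span. y \<noteq> f x \<and> y \<in> T2.P \<and> T2.d (f x) y < e) \<longleftrightarrow>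
    (\<exists>y\<in>T1.branch T1.span. y \<noteq> x \<and> y \<in> T1.P \<and> T1.d x y < e)" for e
  proof
    assume "\<exists>y\<in>T2.branch T2.span. y \<noteq> f x \<and> y \<in> T2.P \<and> T2.d (f x) y < e"
    then obtain y where y: "y \<in> T2.branch T2.span" "y \<noteq> f x" "y \<in> T2.P" "T2.d (f x) y < e" by blast
    obtain z where z: "z \<in> T1.P" "y = f z" using f_surj[OF y(3)] .
    then show "\<exists>y\<in>T1.branch T1.span. y \<noteq> x \<and> y \<in> T1.P \<and> T1.d x y < e"
      using y branch_f x isometry by (intro bexI[of _ z]) auto
  next
    assume "\<exists>y\<in>T1.branch T1.span. y \<noteq> x \<and> y \<in> T1.P \<and> T1.d x y < e"
    then obtain z where z: "z \<in> T1.branch T1.span" "z \<noteq> x" "z \<in> T1.P" "T1.d x z < e" by blast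
    then show "\<exists>y\<in>T2.branch T2.span. y \<noteq> f x \<and> y \<in> T2.P \<and> T2.d (f x) y < e"
      using branch_f x isometry f_inj by (intro bexI[of _ "f z"]) auto
  qed
  then show ?thesis by (simp add: T1.limit_of_def T2.limit_of_def)
qed

lemma special_f: "x \<in> T1.P \<Longrightarrow> f x \<in> special_points T2 \<longleftrightarrow> x \<in> special_points T1"
  unfolding T1.special_points_eq T2.special_points_eq
  using measure_point branch_f tips_f limit_f by simp

theorem mass_structural: "mass_structural_isomorphism T1 T2 f"
proof -
  have S: "special_points T1 \<subseteq> T1.P" "special_points T2 \<subseteq> T2.P"
    using T1.special_in T2.special_in by blast+
  have "f ` special_points T1 = special_points T2"
  proof
    show "f ` special_points T1 \<subseteq> special_points T2" using S special_f by blast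
    show "special_points T2 \<subseteq> f ` special_points T1"
    proof
      fix y assume y: "y \<in> special_points T2"
      then obtain x where "x \<in> T1.P" "y = f x" using f_surj S by blast
      then show "y \<in> f ` special_points T1" using special_f y by blast
    qed
  qed
  then have "bij_betw f (special_points T1) (special_points T2)"
    using bij S by (auto simp: bij_betw_def intro: inj_on_subset)
  moreover have "x \<in> T1.P" if "x \<in> special_points T1" for x using S that by blast
  ultimately show ?thesis
    unfolding mass_structural_isomorphism_def
    by (simp add: T1.seg_root T2.seg_root T1.fringe_eq T2.fringe_eq measure_F measure_below measure_point)
qed

end

lemma tree_isoI:
  "\<lbrakk>rooted_weighted_tree T1; rooted_weighted_tree T2; tree_isomorphism T1 T2 f\<rbrakk> \<Longrightarrow> tree_iso T1 T2 f"
  by unfold_locales (simp_all add: tree_isomorphism_def)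

lemma tree_isomorphism_sym:
  assumes "rooted_weighted_tree T1" "rooted_weighted_tree T2" "tree_isomorphism T1 T2 f"
  shows "tree_isomorphism T2 T1 (inv_into (tree_points T1) f)"
proof -
  interpret tree_iso T1 T2 f by (rule tree_isoI) fact+
  let ?g = "inv_into T1.P f"
  interpret I: tree_isometry T2 T1 ?g by (rule inverse)
  have gf: "?g (f x) = x" if "x \<in> T1.P" for x using bij that by (simp add: bij_betw_def)
  have "distr T2.p T1.p ?g = distr (distr T1.p T2.p f) T1.p ?g" by (simp add: mass_f)
  also have "\<dots> = distr T1.p T1.p (?g \<circ> f)" by (rule distr_distr[OF I.measurable_f measurable_f])
  also have "\<dots> = distr T1.p T1.p (\<lambda>x. x)" by (rule distr_cong) (simp_all add: gf T1.space_p)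
  finally have "distr T2.p T1.p ?g = T1.p" by (simp add: distr_id)
  then show ?thesis unfolding tree_isomorphism_def using I.bij I.isometry I.root_f by simp
qed

lemma tree_isomorphism_trans:
  assumes "rooted_weighted_tree T1" "rooted_weighted_tree T2" "rooted_weighted_tree T3"
    and "tree_isomorphism T1 T2 f" "tree_isomorphism T2 T3 g"
  shows "tree_isomorphism T1 T3 (g \<circ> f)"
proof -
  interpret A: tree_iso T1 T2 f by (rule tree_isoI) fact+
  interpret B: tree_iso T2 T3 g by (rule tree_isoI) fact+
  have "distr A.T1.p B.T2.p (g \<circ> f) = B.T2.p"
    using distr_distr[OF B.measurable_f A.measurable_f] A.mass_f B.mass_f by simp
  then show ?thesis unfolding tree_isomorphism_def
    using bij_betw_trans[OF A.bij B.bij] A.isometry B.isometry A.root_f B.root_f by simp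
qed

lemma equiv_isomorphism_rel: "equiv {T. rooted_weighted_tree T} isomorphism_rel"
proof (rule equivI)
  show "isomorphism_rel \<subseteq> {T. rooted_weighted_tree T} \<times> {T. rooted_weighted_tree T}"
    by (auto simp: isomorphism_rel_def)
  have "tree_isomorphism T T (\<lambda>x. x)" for T :: "'a rw_tree"
    by (simp add: tree_isomorphism_def distr_id bij_betw_def)
  then show "refl_on {T. rooted_weighted_tree T} (isomorphism_rel :: ('a rw_tree \<times> 'a rw_tree) set)"
    by (auto simp: refl_on_def isomorphism_rel_def)
  show "sym isomorphism_rel"
    using tree_isomorphism_sym unfolding sym_def isomorphism_rel_def by blast
  show "trans isomorphism_rel"
    using tree_isomorphism_trans unfolding trans_def isomorphism_rel_def by blast
qed

section \<open>Uniqueness\<close>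

context wtree
begin

lemma branch_spec: "branch span \<subseteq> special_points T"
  by (auto simp: special_points_eq)

text \<open>If there were no special point above \<open>z\<close>, the fringe of \<open>z\<close> would be a chain, whose top
  would be an isolated leaf.\<close>

lemma special_above:
  assumes full: "P = span" and z: "z \<in> P" "z = r \<or> (\<exists>y. z \<sqsubset> y)"
  shows "\<exists>x\<in>special_points T. z \<sqsubseteq> x"
proof (rule ccontr)
  assume none: "\<not> ?thesis"
  have chain: "a \<sqsubseteq> b \<or> b \<sqsubseteq> a" if ab: "z \<sqsubseteq> a" "z \<sqsubseteq> b" for a b
  proof (rule ccontr)
    assume n: "\<not> ?thesis"
    have m: "a \<in> P" "b \<in> P" using ab leD(2) by blast+
    have "meet a b \<sqsubset> a" using n m by (intro meet_lt) simp_all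
    moreover have "meet a b \<sqsubset> b" using meet_lt[of b a] meet_commute[of a b] n m by simp
    ultimately have "meet a b \<in> branch span"
      unfolding branch_def using m full h_meet[of a b] by auto
    then have "meet a b \<in> special_points T" using branch_spec by blast
    then show False using none meet_greatest[OF ab] by blast
  qed
  obtain R where R: "\<And>x. x \<in> P \<Longrightarrow> h x \<le> R" using height_bounded by blast
  define H where "H = Sup (h ` F z)"
  have zF: "z \<in> F z" using z le_refl by (simp add: F_def)
  have bdd: "bdd_above (h ` F z)" using R F_subset by (intro bdd_aboveI[of _ R]) blast
  have H: "h y \<le> H" if "z \<sqsubseteq> y" for y
    unfolding H_def by (rule cSUP_upper[OF _ bdd]) (use that in \<open>simp add: F_def\<close>)
  have "\<exists>y. z \<sqsubseteq> y \<and> H - 1 / Suc n < h y" for n :: nat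
  proof -
    have "H - 1 / Suc n < Sup (h ` F z)" by (simp add: H_def)
    then obtain y where "y \<in> F z" "H - 1 / Suc n < h y" using less_cSUP_iff[OF _ bdd] zF by blast
    then show ?thesis by (auto simp: F_def)
  qed
  \<comment> \<open>A sequence climbing in the chain \<open>F z\<close> to its supremal height is
    Cauchy, since distances in a chain are differences of heights. Its limit is the top of the
    chain.\<close>
  then obtain \<sigma> where \<sigma>: "\<And>n. z \<sqsubseteq> \<sigma> n" "\<And>n. H - 1 / Suc n < h (\<sigma> n)" by metis
  have \<sigma>P: "\<sigma> n \<in> P" for n using \<sigma>(1) leD(2) by blast
  have dist: "d (\<sigma> m) (\<sigma> n) = \<bar>h (\<sigma> m) - h (\<sigma> n)\<bar>" for m n
    using chain[OF \<sigma>(1)[of m] \<sigma>(1)[of n]] le_d[of "\<sigma> m" "\<sigma> n"] le_d[of "\<sigma> n" "\<sigma> m"]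
      le_h[of "\<sigma> m" "\<sigma> n"] le_h[of "\<sigma> n" "\<sigma> m"] commute[of "\<sigma> m" "\<sigma> n"] by auto
  have "\<exists>a\<in>P. \<forall>e>0. \<exists>N. \<forall>n\<ge>N. d (\<sigma> n) a < e"
  proof (rule Cauchy_limit[OF \<sigma>P])
    fix e :: real assume "0 < e"
    then obtain N where N: "1 / Suc N < e" using nat_approx_posE by blast
    have *: "H - e < h (\<sigma> n) \<and> h (\<sigma> n) \<le> H" if "N \<le> n" for n
    proof -
      have "1 / Suc n \<le> 1 / Suc N" using that by (simp add: frac_le)
      then show ?thesis using \<sigma>(2)[of n] H[OF \<sigma>(1)] N by (smt (verit))
    qed
    have "d (\<sigma> m) (\<sigma> n) < e" if "N \<le> m" "N \<le> n" for m n
      using *[OF that(1)] *[OF that(2)] unfolding dist by linarith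
    then show "\<exists>N. \<forall>m\<ge>N. \<forall>n\<ge>N. d (\<sigma> m) (\<sigma> n) < e" by blast
  qed
  then obtain a where a: "a \<in> P" "\<And>e. 0 < e \<Longrightarrow> \<exists>N. \<forall>n\<ge>N. d (\<sigma> n) a < e" by blast
  have za: "z \<sqsubseteq> a"
  proof (rule leI[OF z(1) a(1)], rule field_le_epsilon)
    fix e :: real assume "0 < e"
    then obtain N where "d (\<sigma> N) a < e" using a(2) by blast
    then show "h z \<le> gp z a + e"
      using gp_lipschitz[OF z(1) a(1) \<sigma>P[of N]] leD(3)[OF \<sigma>(1)[of N]] commute[of a "\<sigma> N"] by linarith
  qed
  have "H \<le> h a"
  proof (rule field_le_epsilon)
    fix e :: real assume e: "0 < e"
    then obtain N where N: "\<forall>n\<ge>N. d (\<sigma> n) a < e/2" using a(2)[of "e/2"] by auto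
    obtain k where k: "1 / Suc k < e/2" using nat_approx_posE[of "e/2"] e by auto
    have "1 / Suc (max N k) \<le> 1 / Suc k" by (simp add: frac_le)
    moreover have "d (\<sigma> (max N k)) a < e/2" using N by simp
    moreover have "h (\<sigma> (max N k)) - d (\<sigma> (max N k)) a \<le> h a"
      using gp_ge[OF \<sigma>P a(1)] gp_le2[OF \<sigma>P a(1)] order_trans by blast
    ultimately show "H \<le> h a + e" using \<sigma>(2)[of "max N k"] k by linarith
  qed
  then have amax: "y = a" if "a \<sqsubseteq> y" for y
    using le_antisym[OF that] H[OF le_trans[OF za that]] by simp
  show False
  proof (cases "a = r")
    case True
    then have "z = r" using le_antisym[OF za] by simp
    have "P = {r}" using amax root_le True root by blast
    then have "measure p {r} = 1" using mass.prob_space space_p by simp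
    then have "r \<in> special_points T" by (simp add: special_points_eq)
    then show False using none za \<open>z = r\<close> le_refl[OF root] by blast
  next
    case False
    have "a \<in> span" using a(1) full by blast
    then have "a \<in> tips span" unfolding tips_def using False amax by blast
    moreover have "a \<notin> special_points T" using none za by blast
    \<comment> \<open>A tip that is not special is a limit of branch points; those close enough to
      \<open>a\<close> lie above \<open>z\<close> and are special.\<close>
    ultimately have lim: "limit_of (branch span) a" by (simp add: special_points_eq)
    show False
    proof (cases "a = z")
      case True
      then show False using z(2) False amax ltD(1,5) by blast
    next
      case ne: False
      then have "z \<sqsubset> a" using za by (simp add: lt_def)
      then have "0 < h a - h z" using ltD(4) by simp
      then obtain y where y: "y \<in> branch span" "y \<in> P" "d a y < h a - h z"
        using lim unfolding limit_of_def by blast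
      then have "z \<sqsubseteq> y" using le_ball[OF za y(2)] by simp
      then show False using none y(1) branch_spec by blast
    qed
  qed
qed

end

section \<open>Spacing and density of special points in interval partition trees\<close>

locale iptree = wtree T for T :: "'a rw_tree" +
  assumes ip: "ip_tree T"
begin

abbreviation "S \<equiv> special_points T"

lemma full: "P = span"
  using ip by (simp add: ip_tree_def mass_span_eq)

lemma branch_S: "\<lbrakk>x \<sqsubset> u; x \<sqsubset> v; gp u v = h x\<rbrakk> \<Longrightarrow> x \<in> branch P"
  unfolding branch_def using ltD(3) by blast

lemma branch_in_S: "branch P \<subseteq> S"
  using branch_spec full by simp

lemma spacing: assumes "x \<in> branch P \<or> x \<in> supp" shows "G x = 1 - h x"
proof (cases "x = r")
  case False
  have "x \<in> P" using assms supp_in ltD(2) by (auto simp: branch_def)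
  moreover have "x \<in> branch_points T P \<or> x \<in> closed_support T"
    using assms False rooted_branch_points_eq[OF downset_P] closed_support_eq
    unfolding rooted_branch_points_def by blast
  ultimately show ?thesis using ip by (force simp: ip_tree_def fringe_eq G_def h_def)
qed simp

lemma S_cases: assumes "x \<in> S" shows "x \<in> branch P \<or> x \<in> supp"
proof -
  consider "x \<in> P" "0 < measure p {x}" | "x \<in> branch P" | "x \<in> tips span"
    using assms full unfolding special_points_eq by auto
  then show ?thesis
  proof cases
    case 1 then show ?thesis using atom_supp by blast
  next
    case 3
    then obtain y where "y \<in> supp" "x \<sqsubseteq> y" "\<forall>y\<in>span. x \<sqsubseteq> y \<longrightarrow> y = x"
      by (auto simp: tips_def span_def)
    then show ?thesis using supp_span by blast
  qed simp
qed

lemma spacing_S: "x \<in> S \<Longrightarrow> G x = 1 - h x"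
  using S_cases spacing by blast

lemma S_in: "x \<in> S \<Longrightarrow> x \<in> P"
  using special_in by blast

lemma meet_cases:
  assumes "x \<in> P" "y \<in> P"
  shows "meet x y = x \<and> x \<sqsubseteq> y \<or> meet x y = y \<and> y \<sqsubseteq> x \<or> meet x y \<in> branch P"
proof (cases "x \<sqsubseteq> y \<or> y \<sqsubseteq> x")
  case True
  then show ?thesis
  proof
    assume "x \<sqsubseteq> y" then show ?thesis using meet_le by blast
  next
    assume "y \<sqsubseteq> x" then show ?thesis using meet_le[of y x] meet_commute[OF assms] by simp
  qed
next
  case False
  then have "meet x y \<sqsubset> x" "meet y x \<sqsubset> y" using assms by (auto intro: meet_lt)
  then show ?thesis using branch_S[of "meet x y" x y] meet_commute[OF assms] h_meet[OF assms] by simp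
qed

text \<open>A maximal point that is a limit of branch points need not lie below a special point, but
  every point strictly below it does. Hence special points only branch off arbitrarily close to
  \<open>\<xi>\<close>.\<close>

lemma S_dense:
  assumes x: "\<xi> \<in> P" and e: "0 < e"
  shows "\<exists>x\<in>S. h \<xi> - e \<le> gp \<xi> x"
proof (cases "\<xi> = r")
  case True
  then obtain x where "x \<in> S" using special_above[OF full root] by blast
  then show ?thesis using True e S_in by (intro bexI[of _ x]) simp_all
next
  case False
  then have "0 < h \<xi>" using h_zero_iff[OF x] h_nonneg[of \<xi>] by linarith
  then have t: "0 \<le> max 0 (h \<xi> - e)" "max 0 (h \<xi> - e) < h \<xi>" using e by simp_all
  let ?z = "pt \<xi> (max 0 (h \<xi> - e))"
  have z: "?z \<sqsubseteq> \<xi>" "h ?z = max 0 (h \<xi> - e)" using pt[OF x t(1)] t(2) by simp_all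
  then have "?z \<sqsubset> \<xi>" using t(2) by (intro ltI) simp_all
  then obtain x where "x \<in> S" "?z \<sqsubseteq> x" using special_above[OF full leD(1)[OF z(1)]] by blast
  moreover have "h ?z \<le> gp \<xi> x" if "?z \<sqsubseteq> x" for x
    using gp_mono[OF z(1) that] leD(1)[OF z(1)] by simp
  ultimately show ?thesis using z(2) by (intro bexI[of _ x]) fastforce
qed

text \<open>Up to a null set, \<open>F z\<close> is the union of the fringes of the support points
  and branch points \<open>v\<close> above \<open>z\<close>, where
  \<open>G v = 1 - h v \<le> 1 - h z\<close>. Branch points are included to make this family closed
  under meets.\<close>

lemma G_le: assumes z: "z \<in> P" shows "G z \<le> 1 - h z"
proof -
  define V where "V = F z \<inter> (supp \<union> branch P)"
  have "z \<in> span" using z full by blast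
  then obtain w where w: "w \<in> supp" "z \<sqsubseteq> w" by (auto simp: span_def)
  have "V \<noteq> {}" using w by (auto simp: V_def F_def)
  moreover have "meet_closed V"
    unfolding meet_closed_def
  proof (intro conjI ballI)
    show "V \<subseteq> P" using F_subset by (auto simp: V_def)
    fix u v assume uv: "u \<in> V" "v \<in> V"
    then have "z \<sqsubseteq> meet u v" by (intro meet_greatest) (simp_all add: V_def F_def)
    moreover have "u \<in> P" "v \<in> P" using uv F_subset by (auto simp: V_def)
    then have "meet u v = u \<or> meet u v = v \<or> meet u v \<in> branch P" using meet_cases by blast
    ultimately show "meet u v \<in> V" using uv by (auto simp: V_def F_def)
  qed
  moreover have "F v \<in> sets p" if "v \<in> V" for v
  proof -
    have "v \<in> F z" using that by (simp add: V_def)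
    then have "v \<in> P" using F_subset by blast
    then show ?thesis by simp
  qed
  moreover have "measure p (F v) \<le> 1 - h z" if "v \<in> V" for v
    using that spacing[of v] le_h[of z v] by (auto simp: V_def F_def G_def)
  ultimately have *: "(\<Union>v\<in>V. F v) \<in> sets p" "measure p (\<Union>v\<in>V. F v) \<le> 1 - h z"
    using cofinal_bound[of V F "1 - h z"] F_antimono by auto
  have "F z \<inter> supp \<subseteq> (\<Union>v\<in>V. F v)"
  proof
    fix x assume "x \<in> F z \<inter> supp"
    then have "x \<in> V" "x \<in> F x" using le_refl supp_in by (auto simp: V_def F_def)
    then show "x \<in> (\<Union>v\<in>V. F v)" by blast
  qed
  then have "measure p (F z) \<le> measure p (\<Union>v\<in>V. F v)" using z *(1) by (intro measure_supp_mono) simp_all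
  then show ?thesis using *(2) by (simp add: G_def)
qed

end

section \<open>Tubes above a special point, and gaps in the spacing identity\<close>

definition (in wtree) tube :: "'a \<Rightarrow> 'a \<Rightarrow> 'a set" where
  "tube k x = {y. k \<sqsubset> y \<and> y \<sqsubseteq> x} \<union> F x"

text \<open>In contrast to \<open>F x\<close>, the tube also counts the mass on the way from
  \<open>k\<close> to \<open>x\<close>. The formula involves just the quantities that a
  mass-structural isomorphism preserves when \<open>k\<close> and \<open>x\<close> are
  special.\<close>

lemma (in wtree) tube:
  assumes kx: "k \<sqsubset> x"
  shows tube_sets: "tube k x \<in> sets p"
    and measure_tube: "measure p (tube k x) =
      measure p {y. y \<sqsubseteq> x} - measure p {y. y \<sqsubseteq> k} + G x - measure p {x}"
proof -
  have m: "k \<in> P" "x \<in> P" using ltD[OF kx] by simp_all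
  have eq: "tube k x = ({y. y \<sqsubseteq> x} - {y. y \<sqsubseteq> k}) \<union> (F x - {x})"
  proof -
    have "k \<sqsubset> y" if "y \<sqsubseteq> x" "\<not> y \<sqsubseteq> k" for y using le_linear'[OF that(1) ltD(1)[OF kx]] that(2) by blast
    moreover have "\<not> y \<sqsubseteq> k" if "k \<sqsubset> y" for y using ltD(4)[OF that] le_h[of y k] by force
    moreover have "x \<sqsubseteq> x" using le_refl[OF m(2)] .
    ultimately show ?thesis using kx unfolding tube_def F_def by blast
  qed
  have dis: "({y. y \<sqsubseteq> x} - {y. y \<sqsubseteq> k}) \<inter> (F x - {x}) = {}"
    using le_antisym le_h by (auto simp: F_def)
  have a: "{y. y \<sqsubseteq> x} - {y. y \<sqsubseteq> k} \<in> sets p" "F x - {x} \<in> sets p" using m by (auto intro!: sets.Diff)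
  show "tube k x \<in> sets p" unfolding eq using a by (rule sets.Un)
  have sub: "{y. y \<sqsubseteq> k} \<subseteq> {y. y \<sqsubseteq> x}" using le_trans[OF _ ltD(1)[OF kx]] by blast
  have "measure p (tube k x) = measure p ({y. y \<sqsubseteq> x} - {y. y \<sqsubseteq> k}) + measure p (F x - {x})"
    unfolding eq by (rule mass.finite_measure_Union[OF a dis])
  also have "measure p ({y. y \<sqsubseteq> x} - {y. y \<sqsubseteq> k}) = measure p {y. y \<sqsubseteq> x} - measure p {y. y \<sqsubseteq> k}"
    using m sub by (intro mass.finite_measure_Diff) simp_all
  also have "measure p (F x - {x}) = measure p (F x) - measure p {x}"
  proof (rule mass.finite_measure_Diff)
    show "{x} \<subseteq> F x" using le_refl[OF m(2)] by (simp add: F_def)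
  qed (use m in simp_all)
  finally show "measure p (tube k x) =
      measure p {y. y \<sqsubseteq> x} - measure p {y. y \<sqsubseteq> k} + G x - measure p {x}" by (simp add: G_def)
qed

lemma (in wtree) tube_antimono:
  assumes "k \<sqsubset> u" "u \<sqsubseteq> v" shows "tube k v \<subseteq> tube k u"
proof
  fix y assume "y \<in> tube k v"
  then consider "k \<sqsubset> y" "y \<sqsubseteq> v" | "v \<sqsubseteq> y" by (auto simp: tube_def F_def)
  then show "y \<in> tube k u"
  proof cases
    case 1
    then show ?thesis using le_linear'[OF 1(2) assms(2)] ltD(1) by (auto simp: tube_def F_def)
  next
    case 2
    then show ?thesis using le_trans[OF assms(2)] by (simp add: tube_def F_def)
  qed
qed

text \<open>If nothing lies above \<open>z\<close>, its fringe is \<open>{z}\<close> and positive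
  mass makes \<open>z\<close> an atom.\<close>

lemma (in iptree) S_above_pos:
  assumes z: "z \<in> P" and G: "0 < G z"
  shows "\<exists>x\<in>S. z \<sqsubseteq> x"
proof (cases "\<exists>y. z \<sqsubset> y")
  case True
  then show ?thesis using special_above[OF full z] by blast
next
  case False
  then have "F z = {z}" using le_refl[OF z] by (auto simp: F_def lt_def)
  then have "z \<in> S" using G z by (simp add: G_def special_points_eq)
  then show ?thesis using le_refl[OF z] by blast
qed

text \<open>\<open>k\<close> is the last point below \<open>z\<close> at which the spacing identity holds. When it fails at \<open>z\<close>
  itself, the mass branching off at \<open>k\<close> makes \<open>k\<close> special, and none lies between \<open>k\<close> and \<open>z\<close>.\<close>

lemma (in iptree) gap:
  assumes z: "z \<in> P" and Gz: "G z < 1 - h z"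
  shows "\<exists>k\<in>S. k \<sqsubset> z \<and> (\<forall>x. z \<sqsubseteq> x \<longrightarrow> measure p (tube k x) \<le> G z)"
proof -
  define B where "B = {y. y \<sqsubseteq> z \<and> G y = 1 - h y}"
  define \<beta> where "\<beta> = Sup (h ` B)"
  have rB: "r \<in> B" using root_le[OF z] by (simp add: B_def)
  have bdd: "bdd_above (h ` B)" using le_h by (intro bdd_aboveI[of _ "h z"]) (auto simp: B_def)
  have \<beta>: "h y \<le> \<beta>" if "y \<in> B" for y unfolding \<beta>_def by (rule cSUP_upper[OF that bdd])
  have \<beta>z: "\<beta> \<le> h z" unfolding \<beta>_def using rB le_h by (intro cSUP_least) (auto simp: B_def)
  have \<beta>0: "0 \<le> \<beta>" using \<beta>[OF rB] by simp
  define k where "k = pt z \<beta>"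
  have k: "k \<sqsubseteq> z" "h k = \<beta>" using pt[OF z \<beta>0 \<beta>z] by (simp_all add: k_def)
  have kP: "k \<in> P" using leD(1)[OF k(1)] .
  \<comment> \<open>The supremum is attained: left continuity carries the identity up to
    \<open>k\<close>, and \<open>G_le\<close> is the opposite inequality.\<close>
  have "1 - h k \<le> G k"
  proof (cases "k = r")
    case False
    show ?thesis
    proof (rule G_left_cont[OF kP False])
      fix y assume y: "y \<sqsubset> k"
      then have "h y < \<beta>" using ltD(4) k(2) by force
      then obtain b where b: "b \<in> B" "h y < h b" unfolding \<beta>_def using less_cSUP_iff[OF _ bdd] rB by blast
      have "y \<sqsubseteq> z" using le_trans[OF ltD(1)[OF y] k(1)] .
      then have "y \<sqsubseteq> b" using le_linear[of y z b] b by (simp add: B_def)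
      then have "G b \<le> G y" by (rule G_antimono)
      then show "1 - h k \<le> G y" using b \<beta>[OF b(1)] k(2) by (simp add: B_def)
    qed
  qed simp
  then have Gk: "G k = 1 - h k" using G_le[OF kP] by simp
  then have kz: "k \<sqsubset> z" using k(1) Gz by (auto simp: lt_def)
  have noK: "G y \<noteq> 1 - h y" if "k \<sqsubset> y" "y \<sqsubseteq> z" for y
  proof
    assume "G y = 1 - h y"
    then have "y \<in> B" using that by (simp add: B_def)
    then show False using \<beta> ltD(4)[OF that(1)] k(2) by force
  qed
  \<comment> \<open>No mass is lost between \<open>k\<close> and \<open>z\<close>: a support point
    in \<open>F y\<close> but not in \<open>F z\<close> would lie on the way or branch off there,
    and in both cases spacing would hold at a point strictly above \<open>k\<close>.\<close>
  have const: "G y \<le> G z" if y: "k \<sqsubset> y" "y \<sqsubseteq> z" for y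
    unfolding G_def
  proof (rule measure_supp_mono)
    show "F y \<in> sets p" "F z \<in> sets p" using z ltD(3)[OF y(1)] by simp_all
    show "F y \<inter> supp \<subseteq> F z"
    proof
      fix w assume "w \<in> F y \<inter> supp"
      then have w: "y \<sqsubseteq> w" "w \<in> supp" "w \<in> P" using supp_in by (auto simp: F_def)
      have m: "y \<sqsubseteq> meet w z" using meet_greatest[OF w(1) y(2)] .
      have kz: "k \<sqsubset> meet w z" "meet w z \<sqsubseteq> z" using lt_le_trans[OF y(1) m] meet_le2[OF w(3) z] by simp_all
      have "G (meet w z) \<noteq> 1 - h (meet w z)" using noK[OF kz] .
      then have "meet w z \<notin> branch P" "meet w z \<noteq> w" using spacing w(2) by auto
      then show "w \<in> F z" using meet_cases[OF w(3) z] by (auto simp: F_def)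
    qed
  qed
  define V where "V = {y. k \<sqsubset> y \<and> y \<sqsubseteq> z}"
  have zV: "z \<in> V" using kz le_refl[OF z] by (simp add: V_def)
  have mV: "meet_closed V" by (rule meet_closed_below[of _ z]) (simp add: V_def)
  define C where "C = (\<Union>y\<in>V. F y)"
  have C: "C \<in> sets p" "measure p C \<le> G z"
  proof -
    have "F y \<in> sets p" if "y \<in> V" for y using that ltD(3) by (auto simp: V_def)
    moreover have "measure p (F y) \<le> G z" if "y \<in> V" for y using const that by (auto simp: V_def G_def)
    ultimately have "C \<in> sets p \<and> measure p C \<le> G z"
      unfolding C_def using zV by (intro cofinal_bound[OF mV] F_antimono) auto
    then show "C \<in> sets p" "measure p C \<le> G z" by simp_all
  qed
  \<comment> \<open>If \<open>k\<close> carried no atom and no branching, almost all of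
    \<open>F k\<close> would lie above \<open>k\<close> in the direction of \<open>z\<close>. Then
    \<open>G k \<le> G z < 1 - h z \<le> 1 - h k\<close>, against the identity at
    \<open>k\<close>.\<close>
  have "k \<in> S"
  proof (rule ccontr)
    assume kS: "k \<notin> S"
    then have k0: "measure p {k} = 0"
      using kP zero_less_measure_iff[of p "{k}"] by (auto simp: special_points_eq)
    have "measure p (F k) \<le> measure p (C \<union> {k})"
    proof (rule measure_supp_mono)
      show "F k \<in> sets p" using kP by simp
      show "C \<union> {k} \<in> sets p" by (rule sets.Un[OF C(1) singleton_sets[OF kP]])
      show "F k \<inter> supp \<subseteq> C \<union> {k}"
      proof
        fix w assume "w \<in> F k \<inter> supp"
        then have w: "k \<sqsubseteq> w" "w \<in> P" using supp_in by (auto simp: F_def)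
        show "w \<in> C \<union> {k}"
        proof (cases "w = k")
          case False
          then have kw: "k \<sqsubset> w" using w(1) by (simp add: lt_def)
          have m: "k \<sqsubseteq> meet w z" "meet w z \<sqsubseteq> w" "meet w z \<sqsubseteq> z"
            using meet_greatest[OF w(1) k(1)] meet_le1[OF w(2) z] meet_le2[OF w(2) z] by simp_all
          have "meet w z \<noteq> k"
          proof
            assume "meet w z = k"
            then have "k \<in> branch P" using branch_S[OF kw kz] h_meet[OF w(2) z] by simp
            then show False using kS branch_in_S by blast
          qed
          then have "meet w z \<in> V" using m by (auto simp: V_def lt_def)
          then show ?thesis using m(2) by (auto simp: C_def F_def)
        qed simp
      qed
    qed
    also have "\<dots> \<le> measure p C + measure p {k}" using C(1) kP by (intro measure_Un_le) simp_all
    finally have "G k \<le> G z" using C(2) k0 by (simp add: G_def)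
    then show False using Gk Gz le_h[OF k(1)] by linarith
  qed
  moreover have "measure p (tube k x) \<le> G z" if x: "z \<sqsubseteq> x" for x
  proof -
    have "tube k x \<subseteq> C"
    proof
      fix y assume "y \<in> tube k x"
      then consider "k \<sqsubset> y" "y \<sqsubseteq> x" | "z \<sqsubseteq> y" using le_trans[OF x] by (auto simp: tube_def F_def)
      then show "y \<in> C"
      proof cases
        case 1
        then consider "y \<sqsubseteq> z" | "z \<sqsubseteq> y" using le_linear'[OF 1(2) x] ltD(1) by blast
        then show ?thesis
        proof cases
          case a: 1
          then have "y \<in> V" "y \<in> F y" using 1 le_refl[OF leD(1)[OF a]] by (simp_all add: V_def F_def)
          then show ?thesis by (auto simp: C_def)
        next
          case 2
          then show ?thesis using zV by (auto simp: C_def F_def)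
        qed
      next
        case 2
        then show ?thesis using zV by (auto simp: C_def F_def)
      qed
    qed
    then have "measure p (tube k x) \<le> measure p C" using C(1) by (rule mass.finite_measure_mono)
    then show ?thesis using C(2) by simp
  qed
  ultimately show ?thesis using kz by blast
qed

section \<open>Extending a bijection of special points to an isomorphism\<close>

locale ip_pair = T1: iptree T1 + T2: iptree T2 for T1 :: "'a rw_tree" and T2 :: "'b rw_tree" +
  fixes \<phi> :: "'a \<Rightarrow> 'b"
  assumes ms: "mass_structural_isomorphism T1 T2 \<phi>"
begin

sublocale tree_pair T1 T2 ..

lemma \<phi>_in [simp]: "x \<in> T1.S \<Longrightarrow> \<phi> x \<in> T2.S"
  using ms bij_betwE unfolding mass_structural_isomorphism_def by blast

lemma \<phi>_surj: assumes "y \<in> T2.S" obtains x where "x \<in> T1.S" "y = \<phi> x"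
  using ms assms unfolding mass_structural_isomorphism_def bij_betw_def by blast

lemma \<phi>_P [simp]: "x \<in> T1.S \<Longrightarrow> x \<in> T1.P" "x \<in> T1.S \<Longrightarrow> \<phi> x \<in> T2.P"
  using T1.S_in T2.S_in \<phi>_in by blast+

lemma G_\<phi>: "x \<in> T1.S \<Longrightarrow> T2.G (\<phi> x) = T1.G x"
  and below_\<phi>: "x \<in> T1.S \<Longrightarrow> measure T2.p {z. T2.le z (\<phi> x)} = measure T1.p {z. T1.le z x}"
  and point_\<phi>: "x \<in> T1.S \<Longrightarrow> measure T2.p {\<phi> x} = measure T1.p {x}"
  and le_\<phi>: "\<lbrakk>x \<in> T1.S; y \<in> T1.S\<rbrakk> \<Longrightarrow> T2.le (\<phi> x) (\<phi> y) \<longleftrightarrow> T1.le x y"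
proof -
  show "T2.G (\<phi> x) = T1.G x" "measure T2.p {z. T2.le z (\<phi> x)} = measure T1.p {z. T1.le z x}"
    "measure T2.p {\<phi> x} = measure T1.p {x}" if x: "x \<in> T1.S" for x
  proof -
    have "measure T1.p (tree_seg T1 T1.r x) = measure T2.p (tree_seg T2 T2.r (\<phi> x)) \<and>
      measure T1.p {x} = measure T2.p {\<phi> x} \<and>
      measure T1.p (fringe_subtree T1 x) = measure T2.p (fringe_subtree T2 (\<phi> x))"
      using ms x unfolding mass_structural_isomorphism_def by blast
    then show "T2.G (\<phi> x) = T1.G x" "measure T2.p {z. T2.le z (\<phi> x)} = measure T1.p {z. T1.le z x}"
      "measure T2.p {\<phi> x} = measure T1.p {x}"
      using x by (simp_all add: T1.seg_root T2.seg_root T1.fringe_eq T2.fringe_eq T1.G_def T2.G_def)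
  qed
  show "T2.le (\<phi> x) (\<phi> y) \<longleftrightarrow> T1.le x y" if xy: "x \<in> T1.S" "y \<in> T1.S" for x y
  proof -
    have "x \<in> tree_seg T1 T1.r y \<longleftrightarrow> \<phi> x \<in> tree_seg T2 T2.r (\<phi> y)"
      using ms xy unfolding mass_structural_isomorphism_def by blast
    then show ?thesis using xy by (simp add: T1.seg_root T2.seg_root)
  qed
qed

lemma h_\<phi>: "x \<in> T1.S \<Longrightarrow> T2.h (\<phi> x) = T1.h x"
  using G_\<phi>[of x] T1.spacing_S[of x] T2.spacing_S[of "\<phi> x"] by simp

text \<open>Meets of special points are special, so \<open>\<phi>\<close> maps the meet of
  \<open>x\<close> and \<open>y\<close> to a common lower bound of the images, and at the same
  height by \<open>h_\<phi>\<close>.\<close>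

lemma gp_le_\<phi>:
  assumes x: "x \<in> T1.S" and y: "y \<in> T1.S"
  shows "T1.gp x y \<le> T2.gp (\<phi> x) (\<phi> y)"
proof -
  note xy = \<phi>_P[OF x] \<phi>_P[OF y]
  have "T1.meet x y \<in> T1.S"
    using T1.meet_cases[OF xy(1,3)] x y T1.branch_in_S by auto
  moreover have "T1.le (T1.meet x y) x" "T1.le (T1.meet x y) y"
    using xy by (simp_all add: T1.meet_le1 T1.meet_le2)
  ultimately have "T2.le (\<phi> (T1.meet x y)) (\<phi> x)" "T2.le (\<phi> (T1.meet x y)) (\<phi> y)"
    "T2.h (\<phi> (T1.meet x y)) = T1.gp x y"
    using le_\<phi> x y h_\<phi>[of "T1.meet x y"] T1.h_meet xy by simp_all
  then show ?thesis using T2.gp_mono[of "\<phi> (T1.meet x y)" "\<phi> x" "\<phi> (T1.meet x y)" "\<phi> y"]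
    T2.leD(1) by fastforce
qed

text \<open>With the trees exchanged, each inequality proved for \<open>\<phi>\<close> gives the
  opposite one. Most equalities below arise in this way.\<close>

lemma swapped: "ip_pair T2 T1 (inv_into T1.S \<phi>)"
proof
  show "mass_structural_isomorphism T2 T1 (inv_into T1.S \<phi>)"
    by (rule mass_structural_isomorphism_sym[OF ms])
qed

lemma inv_\<phi>: "x \<in> T1.S \<Longrightarrow> inv_into T1.S \<phi> (\<phi> x) = x"
  using ms unfolding mass_structural_isomorphism_def by (simp add: bij_betw_def)

lemma gp_\<phi>:
  assumes x: "x \<in> T1.S" and y: "y \<in> T1.S"
  shows "T2.gp (\<phi> x) (\<phi> y) = T1.gp x y"
proof -
  interpret I: ip_pair T2 T1 "inv_into T1.S \<phi>" by (rule swapped)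
  show ?thesis using gp_le_\<phi>[OF x y] I.gp_le_\<phi>[of "\<phi> x" "\<phi> y"] x y by (simp add: inv_\<phi>)
qed

text \<open>The graph of the isometry to be built. By \<open>S_dense\<close> a point is determined
  by its Gromov products with special points. As a relation it is symmetric in the two trees, which
  a function would not be.\<close>

definition matched :: "'a \<Rightarrow> 'b \<Rightarrow> bool" where
  "matched \<xi> \<eta> \<longleftrightarrow> \<xi> \<in> T1.P \<and> \<eta> \<in> T2.P \<and> (\<forall>x\<in>T1.S. T2.gp \<eta> (\<phi> x) = T1.gp \<xi> x)"

lemma matched_swap: "ip_pair.matched T2 T1 (inv_into T1.S \<phi>) \<eta> \<xi> \<longleftrightarrow> matched \<xi> \<eta>"
proof -
  interpret I: ip_pair T2 T1 "inv_into T1.S \<phi>" by (rule swapped)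
  have "(\<forall>y\<in>T2.S. T1.gp \<xi> (inv_into T1.S \<phi> y) = T2.gp \<eta> y) \<longleftrightarrow> (\<forall>x\<in>T1.S. T2.gp \<eta> (\<phi> x) = T1.gp \<xi> x)"
  proof (intro iffI ballI)
    fix x assume "\<forall>y\<in>T2.S. T1.gp \<xi> (inv_into T1.S \<phi> y) = T2.gp \<eta> y" "x \<in> T1.S"
    then show "T2.gp \<eta> (\<phi> x) = T1.gp \<xi> x" using inv_\<phi>[of x] \<phi>_in[of x] by metis
  next
    fix y assume a: "\<forall>x\<in>T1.S. T2.gp \<eta> (\<phi> x) = T1.gp \<xi> x" "y \<in> T2.S"
    then obtain x where "x \<in> T1.S" "y = \<phi> x" using \<phi>_surj by blast
    then show "T1.gp \<xi> (inv_into T1.S \<phi> y) = T2.gp \<eta> y" using a(1) inv_\<phi>[of x] by simp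
  qed
  then show ?thesis unfolding I.matched_def matched_def by blast
qed

lemma matched_h_le: assumes "matched \<xi> \<eta>" shows "T1.h \<xi> \<le> T2.h \<eta>"
proof (rule field_le_epsilon)
  fix e :: real assume "0 < e"
  have m: "\<xi> \<in> T1.P" "\<eta> \<in> T2.P" "\<And>x. x \<in> T1.S \<Longrightarrow> T2.gp \<eta> (\<phi> x) = T1.gp \<xi> x"
    using assms by (auto simp: matched_def)
  obtain x where x: "x \<in> T1.S" "T1.h \<xi> - e \<le> T1.gp \<xi> x" using T1.S_dense[OF m(1) \<open>0 < e\<close>] by blast
  then show "T1.h \<xi> \<le> T2.h \<eta> + e" using m(3)[OF x(1)] T2.gp_le1[OF m(2), of "\<phi> x"] by simp
qed

lemma matched_h: "matched \<xi> \<eta> \<Longrightarrow> T2.h \<eta> = T1.h \<xi>"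
proof -
  interpret I: ip_pair T2 T1 "inv_into T1.S \<phi>" by (rule swapped)
  assume "matched \<xi> \<eta>"
  then show ?thesis using matched_h_le I.matched_h_le matched_swap by (metis order_antisym)
qed

lemma matched_gp_le:
  assumes "matched \<xi> \<eta>" "matched \<xi>' \<eta>'"
  shows "T1.gp \<xi> \<xi>' \<le> T2.gp \<eta> \<eta>'"
proof (rule field_le_epsilon)
  fix e :: real assume "0 < e"
  have m: "\<xi> \<in> T1.P" "\<eta> \<in> T2.P" "\<xi>' \<in> T1.P" "\<eta>' \<in> T2.P"
    and eq: "\<And>x. x \<in> T1.S \<Longrightarrow> T2.gp \<eta> (\<phi> x) = T1.gp \<xi> x" "\<And>x. x \<in> T1.S \<Longrightarrow> T2.gp \<eta>' (\<phi> x) = T1.gp \<xi>' x"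
    using assms by (auto simp: matched_def)
  obtain x where x: "x \<in> T1.S" "T1.h \<xi> - e \<le> T1.gp \<xi> x" using T1.S_dense[OF m(1) \<open>0 < e\<close>] by blast
  have xP: "x \<in> T1.P" "\<phi> x \<in> T2.P" using x(1) by simp_all
  have "min (T1.gp \<xi>' \<xi>) (T1.gp \<xi> x) \<le> T1.gp \<xi>' x" by (rule T1.hyp[OF m(3,1) xP(1)])
  moreover have "min (T2.gp \<eta> (\<phi> x)) (T2.gp (\<phi> x) \<eta>') \<le> T2.gp \<eta> \<eta>'" by (rule T2.hyp[OF m(2) xP(2) m(4)])
  moreover have "T1.gp \<xi> \<xi>' \<le> T1.h \<xi>" by (rule T1.gp_le1[OF m(1,3)])
  ultimately show "T1.gp \<xi> \<xi>' \<le> T2.gp \<eta> \<eta>' + e"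
    using x(2) eq[OF x(1)] T1.gp_commute[of \<xi>' \<xi>] T2.gp_commute[of "\<phi> x" \<eta>'] \<open>0 < e\<close> by linarith
qed

lemma matched_gp: "\<lbrakk>matched \<xi> \<eta>; matched \<xi>' \<eta>'\<rbrakk> \<Longrightarrow> T2.gp \<eta> \<eta>' = T1.gp \<xi> \<xi>'"
proof -
  interpret I: ip_pair T2 T1 "inv_into T1.S \<phi>" by (rule swapped)
  assume "matched \<xi> \<eta>" "matched \<xi>' \<eta>'"
  then show ?thesis using matched_gp_le I.matched_gp_le matched_swap by (metis order_antisym)
qed

lemma matched_le: "\<lbrakk>matched \<xi> \<eta>; matched \<xi>' \<eta>'\<rbrakk> \<Longrightarrow> T2.le \<eta> \<eta>' \<longleftrightarrow> T1.le \<xi> \<xi>'"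
  using matched_gp[of \<xi> \<eta> \<xi>' \<eta>'] matched_h[of \<xi> \<eta>] by (auto simp: T1.le_def T2.le_def matched_def)

lemma matched_\<phi>: "x \<in> T1.S \<Longrightarrow> matched x (\<phi> x)"
  by (simp add: matched_def gp_\<phi>)

lemma matched_exists:
  assumes \<xi>: "\<xi> \<in> T1.P" shows "\<exists>\<eta>. matched \<xi> \<eta>"
proof -
  have "\<exists>x\<in>T1.S. T1.h \<xi> - 1 / Suc n \<le> T1.gp \<xi> x" for n :: nat by (rule T1.S_dense[OF \<xi>]) simp
  then obtain x where x: "\<And>n. x n \<in> T1.S" "\<And>n::nat. T1.h \<xi> - 1 / Suc n \<le> T1.gp \<xi> (x n)" by metis
  define t where "t n = T1.gp \<xi> (x n)" for n
  have xP: "x n \<in> T1.P" "\<phi> (x n) \<in> T2.P" for n using x(1) by simp_all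
  have t: "0 \<le> t n" "t n \<le> T1.h \<xi>" "t n \<le> T1.h (x n)" "T1.h \<xi> - 1 / Suc n \<le> t n" for n
    using \<xi> xP x(2) by (simp_all add: t_def T1.gp_nonneg T1.gp_le1 T1.gp_le2)
  \<comment> \<open>\<open>\<eta> n\<close> plays the part of the image of the meet of
    \<open>\<xi>\<close> and \<open>x n\<close>: below \<open>\<phi> (x n)\<close>, at the height of
    that meet.\<close>
  define \<eta> where "\<eta> n = T2.pt (\<phi> (x n)) (t n)" for n
  have \<eta>: "T2.le (\<eta> n) (\<phi> (x n))" "T2.h (\<eta> n) = t n" for n
    using T2.pt[OF xP(2) t(1)] t(3) h_\<phi>[OF x(1)] by (simp_all add: \<eta>_def)
  have \<eta>P: "\<eta> n \<in> T2.P" for n using T2.leD(1)[OF \<eta>(1)] .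
  have gp\<eta>: "T2.gp (\<eta> n) (\<phi> y) = min (t n) (T1.gp \<xi> y)" if y: "y \<in> T1.S" for n y
  proof -
    have yP: "y \<in> T1.P" "\<phi> y \<in> T2.P" using y by simp_all
    have "T2.gp (\<eta> n) (\<phi> y) = min (t n) (T1.gp (x n) y)"
      using T2.gp_below[OF \<eta>(1) yP(2)] \<eta>(2) gp_\<phi>[OF x(1) y] by simp
    moreover have "min (T1.gp (x n) \<xi>) (T1.gp \<xi> y) \<le> T1.gp (x n) y" by (rule T1.hyp[OF xP(1) \<xi> yP(1)])
    moreover have "min (T1.gp \<xi> (x n)) (T1.gp (x n) y) \<le> T1.gp \<xi> y" by (rule T1.hyp[OF \<xi> xP(1) yP(1)])
    ultimately show ?thesis using T1.gp_commute[of "x n" \<xi>] unfolding t_def by linarith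
  qed
  have gp\<eta>\<eta>: "T2.gp (\<eta> n) (\<eta> m) = min (t n) (t m)" for n m
  proof -
    have "T2.gp (\<eta> m) (\<eta> n) = min (t m) (min (t n) (T1.gp \<xi> (x m)))"
      using T2.gp_below[OF \<eta>(1)[of m] \<eta>P[of n]] \<eta>(2)[of m] gp\<eta>[OF x(1)[of m], of n]
        T2.gp_commute[of "\<eta> n" "\<phi> (x m)"] by simp
    then show ?thesis using T2.gp_commute[of "\<eta> n" "\<eta> m"] unfolding t_def by linarith
  qed
  have d\<eta>: "T2.d (\<eta> n) (\<eta> m) = \<bar>t n - t m\<bar>" for n m
    using T2.d_eq[of "\<eta> n" "\<eta> m"] \<eta>(2) gp\<eta>\<eta>[of n m] by simp
  have tb: "\<bar>T1.h \<xi> - t n\<bar> \<le> 1 / Suc N" if "N \<le> n" for n N :: nat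
  proof -
    have "1 / real (Suc n) \<le> 1 / Suc N" using that by (simp add: frac_le)
    then show ?thesis using t(2)[of n] t(4)[of n] by linarith
  qed
  have "\<exists>a\<in>T2.P. \<forall>e>0. \<exists>N. \<forall>n\<ge>N. T2.d (\<eta> n) a < e"
  proof (rule T2.Cauchy_limit[OF \<eta>P])
    fix e :: real assume "0 < e"
    then obtain N where N: "1 / Suc N < e / 2" using nat_approx_posE[of "e/2"] by auto
    have "T2.d (\<eta> m) (\<eta> n) < e" if "N \<le> m" "N \<le> n" for m n
      using tb[OF that(1)] tb[OF that(2)] N unfolding d\<eta> by linarith
    then show "\<exists>N. \<forall>m\<ge>N. \<forall>n\<ge>N. T2.d (\<eta> m) (\<eta> n) < e" by blast
  qed
  then obtain a where a: "a \<in> T2.P" "\<And>e. 0 < e \<Longrightarrow> \<exists>N. \<forall>n\<ge>N. T2.d (\<eta> n) a < e" by blast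
  have "T2.gp a (\<phi> y) = T1.gp \<xi> y" if y: "y \<in> T1.S" for y
  proof -
    have yP: "y \<in> T1.P" "\<phi> y \<in> T2.P" using y by simp_all
    have "\<bar>T2.gp a (\<phi> y) - T1.gp \<xi> y\<bar> \<le> e" if e: "0 < e" for e
    proof -
      obtain N where N: "\<forall>n\<ge>N. T2.d (\<eta> n) a < e/2" using a(2)[of "e/2"] e by auto
      obtain k where k: "1 / Suc k < e/2" using nat_approx_posE[of "e/2"] e by auto
      define n where "n = max N k"
      have "T2.d (\<eta> n) a < e/2" using N by (simp add: n_def)
      moreover have "\<bar>T1.h \<xi> - t n\<bar> \<le> 1 / Suc k" using tb[of k n] by (simp add: n_def)
      moreover have "T2.gp (\<phi> y) a \<le> T2.gp (\<phi> y) (\<eta> n) + T2.d (\<eta> n) a"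
        by (rule T2.gp_lipschitz[OF yP(2) \<eta>P a(1)])
      moreover have "T2.gp (\<phi> y) (\<eta> n) \<le> T2.gp (\<phi> y) a + T2.d a (\<eta> n)"
        by (rule T2.gp_lipschitz[OF yP(2) a(1) \<eta>P])
      moreover have "T1.gp \<xi> y \<le> T1.h \<xi>" by (rule T1.gp_le1[OF \<xi> yP(1)])
      ultimately show ?thesis
        using gp\<eta>[OF y, of n] k T2.gp_commute[of "\<phi> y" a] T2.gp_commute[of "\<phi> y" "\<eta> n"]
          T2.commute[of "\<eta> n" a] by linarith
    qed
    then have "\<bar>T2.gp a (\<phi> y) - T1.gp \<xi> y\<bar> \<le> 0" using field_le_epsilon[of "\<bar>T2.gp a (\<phi> y) - T1.gp \<xi> y\<bar>" 0] by simp
    then show ?thesis by simp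
  qed
  then have "matched \<xi> a" using \<xi> a(1) by (simp add: matched_def)
  then show ?thesis by blast
qed

lemma matched_unique: "\<lbrakk>matched \<xi> \<eta>; matched \<xi> \<eta>'\<rbrakk> \<Longrightarrow> \<eta>' = \<eta>"
proof -
  assume a: "matched \<xi> \<eta>" "matched \<xi> \<eta>'"
  then have "T2.d \<eta> \<eta>' = 0"
    using matched_gp[OF a] matched_h[OF a(1)] matched_h[OF a(2)] T2.d_eq[of \<eta> \<eta>']
    by (simp add: matched_def)
  then show ?thesis using a by (simp add: matched_def)
qed

text \<open>Where spacing holds at \<open>z\<close>, \<open>G_le\<close> in the other tree is
  already enough. Otherwise \<open>z\<close> lies in a gap above some special \<open>k\<close>. The
  tubes over \<open>k\<close> in the direction of \<open>z\<close> have mass at most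
  \<open>G z\<close>, their images have the same masses, and these images exhaust the fringe of
  \<open>\<eta>\<close>.\<close>

lemma matched_G_le:
  assumes m: "matched z \<eta>" shows "T2.G \<eta> \<le> T1.G z"
proof (rule ccontr)
  assume n: "\<not> ?thesis"
  have z: "z \<in> T1.P" "\<eta> \<in> T2.P" using m by (simp_all add: matched_def)
  have "T1.G z < 1 - T1.h z" using n T2.G_le[OF z(2)] matched_h[OF m] by linarith
  then obtain k where k: "k \<in> T1.S" "T1.lt k z" and tube: "\<And>x. T1.le z x \<Longrightarrow> measure T1.p (T1.tube k x) \<le> T1.G z"
    using T1.gap[OF z(1)] by blast
  have lt: "T2.lt (\<phi> k) \<eta>"
    using matched_le[OF matched_\<phi>[OF k(1)] m] matched_h[OF matched_\<phi>[OF k(1)]] matched_h[OF m] T1.ltD[OF k(2)]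
    by (intro T2.ltI) simp_all
  define V where "V = T2.F \<eta> \<inter> T2.S"
  have "T2.G \<eta> > 0" using n T1.G_nonneg[of z] by linarith
  \<comment> \<open>Assuming the contrary gives \<open>\<eta>\<close> a fringe of positive mass, and
    this is what provides a special point above it.\<close>
  then have Vne: "V \<noteq> {}" using T2.S_above_pos[OF z(2)] by (auto simp: V_def T2.F_def)
  have mV: "T2.meet_closed V"
    unfolding T2.meet_closed_def
  proof (intro conjI ballI)
    show "V \<subseteq> T2.P" using T2.F_subset by (auto simp: V_def)
    fix u v assume uv: "u \<in> V" "v \<in> V"
    then have "T2.le \<eta> (T2.meet u v)" by (intro T2.meet_greatest) (simp_all add: V_def T2.F_def)
    moreover have "T2.meet u v \<in> T2.S"
      using T2.meet_cases[of u v] uv T2.S_in T2.branch_in_S by (auto simp: V_def)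
    ultimately show "T2.meet u v \<in> V" by (simp add: V_def T2.F_def)
  qed
  have ltV: "T2.lt (\<phi> k) v" if "v \<in> V" for v
    using T2.lt_le_trans[OF lt] that by (simp add: V_def T2.F_def)
  have "measure T2.p (T2.tube (\<phi> k) v) \<le> T1.G z" if v: "v \<in> V" for v
  proof -
    obtain x where x: "x \<in> T1.S" "v = \<phi> x" using \<phi>_surj v by (auto simp: V_def)
    then have zx: "T1.le z x" using matched_le[OF m matched_\<phi>[OF x(1)]] v by (simp add: V_def T2.F_def)
    have "measure T2.p (T2.tube (\<phi> k) v) = measure T1.p (T1.tube k x)"
      using T2.measure_tube[OF ltV[OF v]] T1.measure_tube[OF T1.lt_le_trans[OF k(2) zx]]
        G_\<phi> below_\<phi> point_\<phi> x k(1) by simp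
    then show ?thesis using tube[OF zx] by simp
  qed
  then have "(\<Union>v\<in>V. T2.tube (\<phi> k) v) \<in> sets T2.p \<and> measure T2.p (\<Union>v\<in>V. T2.tube (\<phi> k) v) \<le> T1.G z"
    by (intro T2.cofinal_bound[OF mV Vne] T2.tube_sets T2.tube_antimono ltV)
  then have U: "(\<Union>v\<in>V. T2.tube (\<phi> k) v) \<in> sets T2.p" "measure T2.p (\<Union>v\<in>V. T2.tube (\<phi> k) v) \<le> T1.G z"
    by simp_all
  have "T2.F \<eta> \<subseteq> (\<Union>v\<in>V. T2.tube (\<phi> k) v)"
  proof
    fix y assume "y \<in> T2.F \<eta>"
    then have y: "T2.le \<eta> y" "y \<in> T2.P" using T2.F_subset by (auto simp: T2.F_def)
    obtain v where v: "v \<in> V" using Vne by blast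
    then have vP: "v \<in> T2.P" "T2.le \<eta> v" using T2.S_in by (auto simp: V_def T2.F_def)
    consider "T2.le y v" | "T2.le v y" | "T2.meet y v \<in> T2.branch T2.P"
      using T2.meet_cases[OF y(2) vP(1)] by blast
    then show "y \<in> (\<Union>v\<in>V. T2.tube (\<phi> k) v)"
    proof cases
      case 1
      then have "y \<in> T2.tube (\<phi> k) v" using T2.lt_le_trans[OF lt y(1)] by (simp add: T2.tube_def)
      then show ?thesis using v by blast
    next
      case 2
      then have "y \<in> T2.tube (\<phi> k) v" by (simp add: T2.tube_def T2.F_def)
      then show ?thesis using v by blast
    next
      case 3
      then have "T2.meet y v \<in> V"
        using T2.branch_in_S T2.meet_greatest[OF y(1) vP(2)] by (auto simp: V_def T2.F_def)
      moreover have "y \<in> T2.tube (\<phi> k) (T2.meet y v)"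
        using T2.meet_le1[OF y(2) vP(1)] by (simp add: T2.tube_def T2.F_def)
      ultimately show ?thesis by blast
    qed
  qed
  then have "T2.G \<eta> \<le> measure T2.p (\<Union>v\<in>V. T2.tube (\<phi> k) v)"
    unfolding T2.G_def using U(1) by (rule T2.mass.finite_measure_mono)
  then show False using U(2) n by linarith
qed

theorem isomorphic: "\<exists>f. tree_isomorphism T1 T2 f"
proof -
  interpret I: ip_pair T2 T1 "inv_into T1.S \<phi>" by (rule swapped)
  obtain f where f: "\<And>\<xi>. \<xi> \<in> T1.P \<Longrightarrow> matched \<xi> (f \<xi>)" using matched_exists by metis
  have fP: "f \<xi> \<in> T2.P" if "\<xi> \<in> T1.P" for \<xi> using f[OF that] by (simp add: matched_def)
  interpret tree_isometry T1 T2 f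
  proof
    show iso: "T2.d (f x) (f y) = T1.d x y" if "x \<in> T1.P" "y \<in> T1.P" for x y
      using matched_gp[OF f f] matched_h[OF f] that T1.d_eq[of x y] T2.d_eq[of "f x" "f y"] by simp
    have "inj_on f T1.P"
    proof (rule inj_onI)
      fix x y assume xy: "x \<in> T1.P" "y \<in> T1.P" "f x = f y"
      then have "T1.d x y = 0" using iso[of x y] fP[of y] by simp
      then show "x = y" using xy by simp
    qed
    moreover have "f ` T1.P = T2.P"
    proof
      show "f ` T1.P \<subseteq> T2.P" using fP by blast
      show "T2.P \<subseteq> f ` T1.P"
      proof
        fix \<eta> assume "\<eta> \<in> T2.P"
        then obtain \<xi> where "matched \<xi> \<eta>" using I.matched_exists matched_swap by blast
        moreover from this have "\<xi> \<in> T1.P" by (simp add: matched_def)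
        ultimately show "\<eta> \<in> f ` T1.P" using matched_unique f by blast
      qed
    qed
    ultimately show "bij_betw f T1.P T2.P" by (simp add: bij_betw_def)
    show "f T1.r = T2.r" using matched_h[OF f[OF T1.root]] T2.h_zero_iff[OF fP[OF T1.root]] by simp
  qed
  have "T2.G (f x) = T1.G x" if "x \<in> T1.P" for x
  proof (rule order_antisym)
    show "T2.G (f x) \<le> T1.G x" by (rule matched_G_le[OF f[OF that]])
    have "I.matched (f x) x" using matched_swap f[OF that] by blast
    then show "T1.G x \<le> T2.G (f x)" by (rule I.matched_G_le)
  qed
  then have "distr T1.p T2.p f = T2.p" by (rule distr_eqI)
  then have "tree_isomorphism T1 T2 f" unfolding tree_isomorphism_def using bij isometry root_f by simp
  then show ?thesis by blast
qed

end

lemma ip_trees_isomorphic: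
  assumes "ip_tree T1" "ip_tree T2" "mass_structural_isomorphism T1 T2 \<phi>"
  shows "\<exists>f. tree_isomorphism T1 T2 f"
proof -
  interpret ip_pair T1 T2 \<phi>
    by unfold_locales (use assms in \<open>auto simp: ip_tree_def\<close>)
  show ?thesis by (rule isomorphic)
qed

section \<open>Existence\<close>

context wtree
begin

text \<open>\<open>X\<close> contains the span. Unlike the span it is closed, so that the quotient built from it is
  complete.\<close>

definition X :: "'a set" where "X = {y \<in> P. \<forall>z. z \<sqsubset> y \<longrightarrow> 0 < G z}"

definition H :: "'a \<Rightarrow> real" where "H x = 1 - G x"

definition c :: "'a \<Rightarrow> 'a \<Rightarrow> real" where "c x y = 1 - G (meet x y)"

lemma X_P: "x \<in> X \<Longrightarrow> x \<in> P"
  by (simp add: X_def)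

lemma X_G: "\<lbrakk>x \<in> X; z \<sqsubset> x\<rbrakk> \<Longrightarrow> 0 < G z"
  by (simp add: X_def)

lemma X_down: "\<lbrakk>y \<in> X; x \<sqsubseteq> y\<rbrakk> \<Longrightarrow> x \<in> X"
  using lt_le_trans leD(1) by (auto simp: X_def)

lemma root_X [simp]: "r \<in> X"
proof -
  have "\<not> z \<sqsubset> r" for z using ltD(4)[of z r] h_nonneg[of z] by auto
  then show ?thesis by (simp add: X_def)
qed

lemma span_X: "x \<in> span \<Longrightarrow> x \<in> X"
  using lt_le_trans G_pos_supp leD(1) by (fastforce simp: X_def span_def)

lemma supp_X: "x \<in> supp \<Longrightarrow> x \<in> X"
  using supp_span span_X by blast

lemma meet_X [simp]: "\<lbrakk>x \<in> X; y \<in> P\<rbrakk> \<Longrightarrow> meet x y \<in> X"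
  using X_down meet_le1 X_P by blast

lemma closedin_X: "closedin mtopology X"
  unfolding closedin_metric
proof (intro conjI allI impI)
  show "X \<subseteq> P" using X_P by blast
  fix y assume "y \<in> P - X"
  then obtain z where z: "z \<sqsubset> y" "\<not> 0 < G z" by (auto simp: X_def)
  \<comment> \<open>With half of the height difference as radius, \<open>w\<close> stays strictly
    above \<open>z\<close> and not merely above it.\<close>
  have e: "0 < (h y - h z) / 2" using ltD(4)[OF z(1)] by simp
  have "disjnt X (mball y ((h y - h z) / 2))"
    unfolding disjnt_iff
  proof (intro allI notI, elim conjE)
    fix w assume "w \<in> X" "w \<in> mball y ((h y - h z) / 2)"
    then have w: "w \<in> X" "y \<in> P" "w \<in> P" "d y w < (h y - h z) / 2" by simp_all
    have "d y w \<le> h y - h z" using w(4) e by (simp add: field_simps)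
    then have "z \<sqsubseteq> w" by (rule le_ball[OF ltD(1)[OF z(1)] w(3)])
    moreover have "h y - d y w \<le> h w" using gp_ge[OF w(2,3)] gp_le2[OF w(2,3)] by linarith
    ultimately have "z \<sqsubset> w" using w(4) e by (intro ltI) (simp_all add: field_simps)
    then show False using X_G[OF w(1)] z(2) by blast
  qed
  then show "\<exists>e>0. disjnt X (mball y e)" using e by blast
qed

lemma X_sets [simp]: "X \<in> sets p"
  by (rule closed_sets[OF closedin_X])

lemma X_limit:
  assumes "\<And>n::nat. \<sigma> n \<in> X" "a \<in> P" "\<And>e. 0 < e \<Longrightarrow> \<exists>N. \<forall>n\<ge>N. d (\<sigma> n) a < e"
  shows "a \<in> X"
proof (rule ccontr)
  assume "a \<notin> X"
  then obtain e where e: "e > 0" "disjnt X (mball a e)" using closedin_X assms(2) unfolding closedin_metric by blast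
  then obtain N where "d (\<sigma> N) a < e" using assms(3) by blast
  then have "\<sigma> N \<in> mball a e" using assms(1)[of N] assms(2) X_P commute[of a "\<sigma> N"] by simp
  then show False using e(2) assms(1)[of N] by (auto simp: disjnt_iff)
qed

lemma H_nonneg [simp]: "0 \<le> H x" and H_le_1 [simp]: "H x \<le> 1" and H_root [simp]: "H r = 0"
  by (simp_all add: H_def G_le_1)

lemma c_commute: "\<lbrakk>x \<in> P; y \<in> P\<rbrakk> \<Longrightarrow> c x y = c y x"
  by (simp add: c_def meet_commute)

lemma c_below: "x \<sqsubseteq> y \<Longrightarrow> c x y = H x"
  by (simp add: c_def H_def meet_le)

lemma c_self [simp]: "x \<in> P \<Longrightarrow> c x x = H x"
  by (simp add: c_below le_refl)

lemma c_le: "\<lbrakk>x \<in> P; y \<in> P\<rbrakk> \<Longrightarrow> c x y \<le> H x" "\<lbrakk>x \<in> P; y \<in> P\<rbrakk> \<Longrightarrow> c x y \<le> H y"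
  using G_antimono[OF meet_le1[of x y]] G_antimono[OF meet_le2[of x y]] by (simp_all add: c_def H_def)

lemma c_nonneg [simp]: "0 \<le> c x y"
  by (simp add: c_def G_le_1)

lemma c_hyp:
  assumes x: "x \<in> P" and y: "y \<in> P" and z: "z \<in> P"
  shows "min (c x y) (c y z) \<le> c x z"
proof -
  have a: "meet x y \<sqsubseteq> x" "meet x y \<sqsubseteq> y" "meet y z \<sqsubseteq> y" "meet y z \<sqsubseteq> z"
    using x y z by (simp_all add: meet_le1 meet_le2)
  consider "meet x y \<sqsubseteq> meet y z" | "meet y z \<sqsubseteq> meet x y"
    using le_linear'[OF a(2,3)] ltD(1) by blast
  then show ?thesis
  proof cases
    case 1
    then have "meet x y \<sqsubseteq> meet x z" using a(1) le_trans[OF 1 a(4)] by (intro meet_greatest)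
    then have "G (meet x z) \<le> G (meet x y)" by (rule G_antimono)
    then show ?thesis by (simp add: c_def)
  next
    case 2
    then have "meet y z \<sqsubseteq> meet x z" using a(4) le_trans[OF 2 a(1)] by (intro meet_greatest)
    then have "G (meet x z) \<le> G (meet y z)" by (rule G_antimono)
    then show ?thesis by (simp add: c_def)
  qed
qed

text \<open>A decreasing sequence of filters of the tree order has a common point: either the infima of
  the heights increase strictly, and points close to these infima converge, or they stabilise.\<close>

lemma filters_intersect:
  fixes V :: "nat \<Rightarrow> 'a set"
  assumes ne: "\<And>k. V k \<noteq> {}" and sub: "\<And>k. V k \<subseteq> X" and dec: "\<And>m n. m \<le> n \<Longrightarrow> V n \<subseteq> V m"
    and up: "\<And>k x y. \<lbrakk>x \<in> V k; x \<sqsubseteq> y; y \<in> X\<rbrakk> \<Longrightarrow> y \<in> V k"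
    and meet: "\<And>k x y. \<lbrakk>x \<in> V k; y \<in> V k\<rbrakk> \<Longrightarrow> meet x y \<in> V k"
  shows "\<exists>y\<in>X. \<forall>k. y \<in> V k"
proof -
  have VP: "v \<in> P" if "v \<in> V k" for v k using that sub X_P by blast
  define \<alpha> where "\<alpha> k = Inf (h ` V k)" for k
  have bdd: "bdd_below (h ` A)" for A by (intro bdd_belowI[of _ 0]) auto
  have \<alpha>: "\<alpha> k \<le> h v" if "v \<in> V k" for v k unfolding \<alpha>_def by (rule cINF_lower[OF bdd that])
  have near: "\<exists>v\<in>V k. h v < \<alpha> k + e" if "0 < e" for k e
  proof -
    have "Inf (h ` V k) < \<alpha> k + e" using that by (simp add: \<alpha>_def)
    then show ?thesis using cINF_less_iff[OF ne bdd] by blast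
  qed
  have mono: "\<alpha> m \<le> \<alpha> n" if "m \<le> n" for m n
    unfolding \<alpha>_def[of n] using ne[of n] \<alpha> dec[OF that] by (intro cINF_greatest) blast+
  obtain R where R: "\<And>x. x \<in> P \<Longrightarrow> h x \<le> R" using height_bounded by blast
  have \<alpha>R: "\<alpha> k \<le> R" for k
  proof -
    obtain v where "v \<in> V k" using ne by blast
    then show ?thesis using \<alpha>[of v k] R[OF VP, of v k] by linarith
  qed
  show ?thesis
  proof (cases "\<exists>n. \<forall>m\<ge>n. \<alpha> m = \<alpha> n")
    case True
    then obtain n where n: "\<And>m. n \<le> m \<Longrightarrow> \<alpha> m = \<alpha> n" by blast
    show ?thesis
    proof (cases "\<forall>m\<ge>n. \<exists>u\<in>V m. h u = \<alpha> n")
      case True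
      \<comment> \<open>Every later set has a point at the common minimal height; its meet with
        \<open>u\<close> cannot be lower, so the point is \<open>u\<close> itself.\<close>
      then obtain u where u: "u \<in> V n" "h u = \<alpha> n" by blast
      have "u \<in> V m" if m: "n \<le> m" for m
      proof -
        obtain v where v: "v \<in> V m" "h v = \<alpha> n" using True m by blast
        have vn: "v \<in> V n" using v(1) dec[OF m] by blast
        have P: "u \<in> P" "v \<in> P" using VP u(1) vn by blast+
        have "\<alpha> n \<le> h (meet u v)" using \<alpha>[OF meet[OF u(1) vn]] .
        then have "meet u v = u" "meet u v = v"
          using le_antisym[OF meet_le1[OF P]] le_antisym[OF meet_le2[OF P]] u(2) v(2) by simp_all
        then show ?thesis using v(1) by simp
      qed
      moreover have "u \<in> V k" if "k \<le> n" for k using dec[OF that] u(1) by blast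
      ultimately have "\<forall>k. u \<in> V k" using nat_le_linear by blast
      then show ?thesis using sub u(1) by blast
    next
      case False
      \<comment> \<open>Once the infimum is not attained, each \<open>y\<close> in
        \<open>V m\<close> works. The meet of \<open>y\<close> with a point \<open>e\<close> of a
        later \<open>V k\<close> lies strictly above the infimum, and \<open>V k\<close> has a lower
        point \<open>e'\<close>; the meet of \<open>e'\<close> and \<open>e\<close> is then below
        \<open>y\<close>.\<close>
      then obtain m where m: "n \<le> m" "\<And>u. u \<in> V m \<Longrightarrow> h u \<noteq> \<alpha> n" by blast
      obtain y where y: "y \<in> V m" using ne by blast
      have "y \<in> V k" if k: "m \<le> k" for k
      proof -
        have "\<exists>e. e \<in> V k" using ne[of k] by auto
        then obtain e where e: "e \<in> V k" ..
        then have em: "e \<in> V m" using dec[OF k] by blast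
        have P: "y \<in> P" "e \<in> P" using VP[OF y] VP[OF e] by simp_all
        have ye: "meet y e \<in> V m" using meet[OF y em] .
        have "\<alpha> m = \<alpha> n" "\<alpha> k = \<alpha> n" using n[OF m(1)] n[OF order_trans[OF m(1) k]] by simp_all
        then have "0 < h (meet y e) - \<alpha> k" using \<alpha>[OF ye] m(2)[OF ye] by simp
        then obtain e' where e': "e' \<in> V k" "h e' < h (meet y e)" using near[of "h (meet y e) - \<alpha> k" k] by auto
        have e'P: "e' \<in> P" using VP e'(1) by blast
        have "h (meet e' e) \<le> h (meet y e)" using le_h[OF meet_le1[OF e'P P(2)]] e'(2) by linarith
        then have "meet e' e \<sqsubseteq> meet y e"
          by (rule le_linear[OF meet_le2[OF e'P P(2)] meet_le2[OF P]])
        then have "meet e' e \<sqsubseteq> y" using le_trans meet_le1[OF P] by blast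
        then show ?thesis using up[OF meet[OF e'(1) e]] y sub by blast
      qed
      moreover have "y \<in> V k" if "k \<le> m" for k using dec[OF that] y by blast
      ultimately have "\<forall>k. y \<in> V k" using nat_le_linear by blast
      then show ?thesis using sub y by blast
    qed
  next
    case False
    have grow: "\<exists>m\<ge>n. \<alpha> n < \<alpha> m" for n
    proof -
      obtain m where "m \<ge> n" "\<alpha> m \<noteq> \<alpha> n" using False by blast
      then show ?thesis using mono[of n m] by (intro exI[of _ m]) simp
    qed
    have "\<exists>v\<in>V k. h v < \<alpha> k + 1 / Suc k" for k by (rule near) simp
    then obtain y where y: "\<And>k. y k \<in> V k" "\<And>k. h (y k) < \<alpha> k + 1 / Suc k" by metis
    have yP: "y k \<in> P" for k using VP y(1) by blast
    \<comment> \<open>Both points lie in \<open>V k\<close>, hence so does their meet. They branch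
      no lower than \<open>\<alpha> k\<close>, and their heights approach the limit of
      \<open>\<alpha>\<close>, which makes the sequence Cauchy.\<close>
    have gpy: "\<alpha> k \<le> gp (y k) (y m)" if "k \<le> m" for k m
      using \<alpha>[OF meet[OF y(1)[of k], of "y m"]] dec[OF that] y(1)[of m] h_meet[OF yP yP] by auto
    have conv: "convergent \<alpha>"
    proof -
      have "incseq \<alpha>" using mono by (simp add: incseq_def)
      then obtain L where "\<alpha> \<longlonglongrightarrow> L" using \<alpha>R incseq_convergent[of \<alpha> R] by blast
      then show ?thesis by (rule convergentI)
    qed
    then have Cau: "Cauchy \<alpha>" by (simp add: Cauchy_convergent_iff)
    have "\<exists>a\<in>P. \<forall>e>0. \<exists>N. \<forall>n\<ge>N. d (y n) a < e"
    proof (rule Cauchy_limit[OF yP])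
      fix e :: real assume e: "0 < e"
      obtain N1 where N1: "\<And>m n. \<lbrakk>N1 \<le> m; N1 \<le> n\<rbrakk> \<Longrightarrow> dist (\<alpha> m) (\<alpha> n) < e/3"
        using Cau e unfolding Cauchy_def by (meson divide_pos_pos zero_less_numeral)
      obtain N2 where N2: "1 / Suc N2 < e/3" using nat_approx_posE[of "e/3"] e by auto
      have *: "d (y m) (y n) < e" if "max N1 N2 \<le> m" "m \<le> n" for m n
      proof -
        have "1 / Suc m \<le> 1 / Suc N2" "1 / Suc n \<le> 1 / Suc N2" using that by (simp_all add: frac_le)
        moreover have "\<bar>\<alpha> m - \<alpha> n\<bar> < e/3" using N1[of m n] that by (simp add: dist_real_def)
        ultimately show ?thesis using d_eq[of "y m" "y n"] gpy[OF that(2)] y(2)[of m] y(2)[of n] N2 by linarith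
      qed
      have "d (y m) (y n) < e" if "max N1 N2 \<le> m" "max N1 N2 \<le> n" for m n
        using *[of m n] *[of n m] that commute[of "y m" "y n"] by (cases "m \<le> n") simp_all
      then show "\<exists>N. \<forall>m\<ge>N. \<forall>n\<ge>N. d (y m) (y n) < e" by blast
    qed
    then obtain a where a: "a \<in> P" "\<And>e. 0 < e \<Longrightarrow> \<exists>N. \<forall>n\<ge>N. d (y n) a < e" by blast
    have yX: "y n \<in> X" for n using y(1) sub by blast
    have aX: "a \<in> X" by (rule X_limit[OF yX a])
    \<comment> \<open>Strict growth of the infima leaves room: \<open>V k\<close> has a point
      \<open>e\<close> lower than \<open>\<alpha> m\<close>. Its meet with a late \<open>y n\<close>
      is in \<open>V k\<close> and so far below \<open>y n\<close> that it is also below the nearby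
      limit \<open>a\<close>.\<close>
    have "a \<in> V k" for k
    proof -
      obtain m where m: "k \<le> m" "\<alpha> k < \<alpha> m" using grow by blast
      obtain e where e: "e \<in> V k" "h e < \<alpha> m" using near[of "\<alpha> m - \<alpha> k" k] m(2) by auto
      obtain N where N: "\<forall>n\<ge>N. d (y n) a < \<alpha> m - h e" using a(2)[of "\<alpha> m - h e"] e(2) by auto
      define n where "n = max N m"
      have dn: "d (y n) a < \<alpha> m - h e" using N by (simp add: n_def)
      have "\<alpha> m \<le> h (y n)" using mono[of m n] \<alpha>[OF y(1), of n] by (simp add: n_def)
      moreover have "k \<le> n" using m(1) by (simp add: n_def)
      then have "y n \<in> V k" using y(1)[of n] dec[of k n] by blast
      then have ev: "meet e (y n) \<in> V k" using meet[OF e(1)] by blast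
      have eP: "e \<in> P" using VP e(1) by blast
      have "h (meet e (y n)) \<le> h e" using le_h[OF meet_le1[OF eP yP]] .
      ultimately have "meet e (y n) \<sqsubseteq> a"
        using dn by (intro le_ball[OF meet_le2[OF eP yP] a(1)]) linarith
      then show ?thesis using up[OF ev] aX by blast
    qed
    then show ?thesis using aX by blast
  qed
qed

text \<open>The set is the union of the fringes of those points below \<open>x\<close> at which
  \<open>G\<close> has dropped to \<open>1 - t\<close>, and these form a chain. It is to be the
  preimage of a fringe at height \<open>t\<close>, and the bound is one half of the spacing identity
  of the new tree.\<close>

lemma level_sets:
  assumes x: "x \<in> P" and t: "t \<le> 1"
  shows "{y \<in> P. t \<le> c x y} \<in> sets p \<and> measure p {y \<in> P. t \<le> c x y} \<le> 1 - t"
proof -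
  define V where "V = {z. z \<sqsubseteq> x \<and> G z \<le> 1 - t}"
  have eq: "{y \<in> P. t \<le> c x y} = (\<Union>v\<in>V. F v)"
  proof
    show "{y \<in> P. t \<le> c x y} \<subseteq> (\<Union>v\<in>V. F v)"
    proof
      fix y assume "y \<in> {y \<in> P. t \<le> c x y}"
      then have "meet x y \<in> V" "y \<in> F (meet x y)"
        using x meet_le1[of x y] meet_le2[of x y] by (simp_all add: V_def c_def F_def)
      then show "y \<in> (\<Union>v\<in>V. F v)" by blast
    qed
    show "(\<Union>v\<in>V. F v) \<subseteq> {y \<in> P. t \<le> c x y}"
    proof clarify
      fix v y assume "v \<in> V" "y \<in> F v"
      then have v: "v \<sqsubseteq> x" "G v \<le> 1 - t" "v \<sqsubseteq> y" by (simp_all add: V_def F_def)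
      then show "y \<in> P \<and> t \<le> c x y"
        using G_antimono[OF meet_greatest[OF v(1,3)]] leD(2)[OF v(3)] by (simp add: c_def)
    qed
  qed
  show ?thesis
  proof (cases "V = {}")
    case True
    then have "{y \<in> P. t \<le> c x y} = {}" using eq by blast
    then show ?thesis using t by (simp only: sets.empty_sets measure_empty) simp
  next
    case False
    have "meet_closed V" by (rule meet_closed_below[of _ x]) (simp add: V_def)
    moreover have "F v \<in> sets p" if "v \<in> V" for v
    proof -
      have "v \<sqsubseteq> x" using that by (simp add: V_def)
      then show ?thesis using leD(1) F_sets by blast
    qed
    moreover have "measure p (F v) \<le> 1 - t" if "v \<in> V" for v using that by (simp add: V_def G_def)
    ultimately show ?thesis unfolding eq using False by (intro cofinal_bound F_antimono)
  qed
qed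

section \<open>Strict decrease of the fringe mass past special points\<close>

lemma disjoint_F: "\<lbrakk>a \<in> P; b \<in> P; \<not> a \<sqsubseteq> b; \<not> b \<sqsubseteq> a\<rbrakk> \<Longrightarrow> F a \<inter> F b = {}"
  using le_linear' ltD(1) by (fastforce simp: F_def)

lemma G_two:
  assumes a: "m \<sqsubseteq> a" and b: "m \<sqsubseteq> b" and ab: "\<not> a \<sqsubseteq> b" "\<not> b \<sqsubseteq> a"
  shows "G a + G b \<le> G m"
proof -
  have P: "a \<in> P" "b \<in> P" "m \<in> P" using leD a b by blast+
  have "measure p (F a) + measure p (F b) = measure p (F a \<union> F b)"
    using P disjoint_F[OF P(1,2) ab] by (intro mass.finite_measure_Union[symmetric]) simp_all
  also have "\<dots> \<le> measure p (F m)"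
    using P F_antimono[OF a] F_antimono[OF b] by (intro mass.finite_measure_mono) auto
  finally show ?thesis by (simp add: G_def)
qed

text \<open>A point of \<open>X\<close> may lie outside the span, but every point strictly below it
  has a fringe of positive mass and is therefore in the span.\<close>

lemma X_below: assumes "x \<in> X" "m \<sqsubset> x"
  obtains x' where "m \<sqsubset> x'" "x' \<sqsubset> x" "0 < G x'" "x' \<in> span"
proof -
  obtain x' where x': "m \<sqsubset> x'" "x' \<sqsubset> x" using h_lt_exists[OF assms(2)] .
  then have "0 < G x'" using X_G[OF assms(1)] by blast
  then show ?thesis using that x' G_pos_span ltD(3)[OF x'(1)] by blast
qed

lemma gp_shrink:
  assumes "m \<sqsubset> a" "a \<sqsubseteq> x" "m \<sqsubset> b" "b \<sqsubseteq> y" "gp x y = h m"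
  shows "gp a b = h m"
proof -
  have P: "a \<in> P" "b \<in> P" "x \<in> P" "y \<in> P" using leD assms(2,4) by blast+
  have "gp b x = min (h b) (h m)" using gp_below[OF assms(4) P(3)] assms(5) gp_commute[of x y] by simp
  then have "gp b x = h m" using ltD(4)[OF assms(3)] by simp
  then have "gp a b = min (h a) (h m)" using gp_below[OF assms(2) P(2)] gp_commute[of x b] by simp
  then show ?thesis using ltD(4)[OF assms(1)] by simp
qed

lemma branch_spanI:
  assumes "x \<in> X" "y \<in> X" "m \<sqsubset> x" "m \<sqsubset> y" "gp x y = h m"
  shows "m \<in> branch span"
proof -
  obtain a where a: "m \<sqsubset> a" "a \<sqsubset> x" "0 < G a" "a \<in> span" using X_below[OF assms(1,3)] .
  obtain b where b: "m \<sqsubset> b" "b \<sqsubset> y" "0 < G b" "b \<in> span" using X_below[OF assms(2,4)] .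
  have "gp a b = h m" by (rule gp_shrink[OF a(1) ltD(1)[OF a(2)] b(1) ltD(1)[OF b(2)] assms(5)])
  then show ?thesis unfolding branch_def using a b by blast
qed

lemma meet_branch:
  assumes "x \<in> X" "y \<in> X" "\<not> x \<sqsubseteq> y" "\<not> y \<sqsubseteq> x"
  shows "meet x y \<in> branch span"
proof -
  have P: "x \<in> P" "y \<in> P" using assms X_P by blast+
  have "meet x y \<sqsubset> x" using meet_lt[OF P assms(3)] .
  moreover have "meet x y \<sqsubset> y" using meet_lt[OF P(2,1) assms(4)] meet_commute[OF P] by simp
  ultimately show ?thesis using branch_spanI[OF assms(1,2)] h_meet[OF P] by simp
qed

lemma branch_spanE:
  assumes "m \<in> branch span"
  obtains a b where "m \<sqsubset> a" "m \<sqsubset> b" "gp a b = h m" "0 < G a" "0 < G b" "a \<in> span" "b \<in> span"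
proof -
  obtain u v where uv: "u \<in> span" "v \<in> span" "m \<sqsubset> u" "m \<sqsubset> v" "gp u v = h m"
    using assms by (auto simp: branch_def)
  obtain a where a: "m \<sqsubset> a" "a \<sqsubset> u" "0 < G a" "a \<in> span" using X_below[OF span_X[OF uv(1)] uv(3)] .
  obtain b where b: "m \<sqsubset> b" "b \<sqsubset> v" "0 < G b" "b \<in> span" using X_below[OF span_X[OF uv(2)] uv(4)] .
  have "gp a b = h m" by (rule gp_shrink[OF a(1) ltD(1)[OF a(2)] b(1) ltD(1)[OF b(2)] uv(5)])
  then show ?thesis using that a b by blast
qed

lemma branch_span_in: "m \<in> branch span \<Longrightarrow> m \<in> span"
  unfolding branch_def using downsetD[OF downset_span] ltD(1) by blast

text \<open>By hyperbolicity at least one of the two arms at \<open>m\<close> does not lead towards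
  \<open>y\<close>; the fringe of that arm has positive mass and is disjoint from
  \<open>F y\<close>.\<close>

lemma branch_G_less:
  assumes m: "m \<in> branch span" and y: "m \<sqsubset> y" shows "G y < G m"
proof -
  obtain a b where ab: "m \<sqsubset> a" "m \<sqsubset> b" "gp a b = h m" "0 < G a" "0 < G b" using branch_spanE[OF m] by metis
  have P: "a \<in> P" "b \<in> P" "y \<in> P" using ab(1,2) y ltD(3) by blast+
  have key: "G y < G m" if a: "m \<sqsubset> a" "0 < G a" "gp a y \<le> h m" for a
  proof -
    have "\<not> a \<sqsubseteq> y" using leD(3)[of a y] a(3) ltD(4)[OF a(1)] by force
    moreover have "\<not> y \<sqsubseteq> a" using leD(4)[of y a] a(3) ltD(4)[OF y] by force
    ultimately have "G a + G y \<le> G m" by (intro G_two ltD(1) a(1) y)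
    then show ?thesis using a(2) by linarith
  qed
  have "min (gp a y) (gp y b) \<le> gp a b" by (rule hyp[OF P(1,3,2)])
  then have "gp a y \<le> h m \<or> gp b y \<le> h m" using ab(3) gp_commute[of b y] by linarith
  then show ?thesis using key[OF ab(1,4)] key[OF ab(2,5)] by blast
qed

lemma branch_G_pos: "m \<in> branch span \<Longrightarrow> 0 < G m"
proof -
  assume m: "m \<in> branch span"
  then obtain a where "m \<sqsubset> a" using branch_spanE by metis
  then have "G a < G m" by (rule branch_G_less[OF m])
  then show ?thesis using G_nonneg[of a] by linarith
qed

text \<open>This keeps special points apart in the quotient: past an atom the mass of the atom is
  lost, past a branch point that of another arm, and past a tip there is nothing.\<close>

lemma special_G_less:
  assumes x: "x \<in> special_points T" and y: "y \<in> span" "x \<sqsubset> y" shows "G y < G x"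
proof -
  have xP: "x \<in> P" using ltD(2)[OF y(2)] .
  consider "0 < measure p {x}" | "x \<in> branch span" | "x \<in> tips span" using x unfolding special_points_eq by blast
  then show ?thesis
  proof cases
    case 1
    have "x \<notin> F y" using ltD(4)[OF y(2)] le_h[of y x] by (auto simp: F_def)
    then have "measure p {x} + measure p (F y) = measure p ({x} \<union> F y)"
      using xP ltD(3)[OF y(2)] by (intro mass.finite_measure_Union[symmetric]) simp_all
    also have "\<dots> \<le> measure p (F x)"
    proof (rule mass.finite_measure_mono)
      have "x \<in> F x" using le_refl[OF xP] by (simp add: F_def)
      then show "{x} \<union> F y \<subseteq> F x" using F_antimono[OF ltD(1)[OF y(2)]] by blast
    qed (use xP in simp)
    finally show ?thesis using 1 by (simp add: G_def)
  next
    case 2 then show ?thesis using branch_G_less y(2) by blast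
  next
    case 3 then show ?thesis using y ltD(1,5)[OF y(2)] by (auto simp: tips_def)
  qed
qed

text \<open>Otherwise the meet is either \<open>y\<close> or a branch point, hence special and
  strictly below \<open>x\<close>, so \<open>G\<close> would decrease between the two. In the
  quotient this means that no new order relation between special points appears.\<close>

lemma special_le:
  assumes x: "x \<in> special_points T" and y: "y \<in> special_points T" and G: "G (meet x y) = G x"
  shows "x \<sqsubseteq> y"
proof (rule ccontr)
  assume n: "\<not> x \<sqsubseteq> y"
  have s: "x \<in> span" "y \<in> span" "x \<in> P" "y \<in> P" using special_in x y by blast+
  have l: "meet x y \<sqsubset> x" using meet_lt[OF s(3,4) n] .
  have "meet x y \<in> special_points T"
  proof (cases "y \<sqsubseteq> x")
    case True
    then have "meet x y = y" using meet_le[OF True] meet_commute[OF s(3,4)] by simp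
    then show ?thesis using y by simp
  next
    case False
    then show ?thesis using meet_branch[OF span_X span_X, OF s(1,2) n] branch_spec by blast
  qed
  then have "G x < G (meet x y)" using special_G_less[OF _ s(1) l] by blast
  then show False using G by simp
qed

text \<open>The same argument with a support point in place of the lower special point; it
  identifies, on the support, the preimages of special points and of the segments to them.\<close>

lemma special_ge:
  assumes x: "x \<in> special_points T" and y: "y \<in> supp" and G: "G (meet y x) = G y"
  shows "y \<sqsubseteq> x"
proof (rule ccontr)
  assume n: "\<not> y \<sqsubseteq> x"
  have s: "x \<in> span" "y \<in> span" "x \<in> P" "y \<in> P" using special_in x supp_span[OF y] supp_in[OF y] by blast+
  have l: "meet y x \<sqsubset> y" using meet_lt[OF s(4,3) n] .
  have "meet y x \<in> special_points T"
  proof (cases "x \<sqsubseteq> y")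
    case True
    then have "meet y x = x" using meet_le[OF True] meet_commute[OF s(3,4)] by simp
    then show ?thesis using x by simp
  next
    case False
    then show ?thesis using meet_branch[OF span_X span_X, OF s(2,1) n] branch_spec by blast
  qed
  then have "G y < G (meet y x)" using special_G_less[OF _ s(2) l] by blast
  then show False using G by simp
qed

lemma G_near:
  assumes x: "x \<in> P" "x \<noteq> r" and e: "G x < e"
  obtains z where "z \<sqsubset> x" "G z < e"
  using G_left_cont[OF x, of e] e by (meson not_le)

lemma measure_X: "A \<in> sets p \<Longrightarrow> measure p (A \<inter> X) = measure p A"
  by (intro order_antisym measure_supp_mono sets.Int X_sets) (auto intro: supp_X)

text \<open>Equal values of \<open>G\<close> make the fringes of points of \<open>E\<close> agree up
  to null sets, and make \<open>E\<close> a chain. All mass of \<open>E\<close> then sits at its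
  top. So collapsing a fibre of the quotient map creates no atom that was not there before.\<close>

lemma collapse_atom:
  assumes E: "E \<in> sets p" "E \<subseteq> X" "0 < measure p E"
    and m: "\<And>x y. \<lbrakk>x \<in> E; y \<in> E\<rbrakk> \<Longrightarrow> meet x y \<in> E" and G: "\<And>x y. \<lbrakk>x \<in> E; y \<in> E\<rbrakk> \<Longrightarrow> G x = G y"
  shows "\<exists>x\<in>E. 0 < measure p {x}"
proof (rule ccontr)
  assume no: "\<not> ?thesis"
  have EP: "x \<in> P" if "x \<in> E" for x using that E(2) X_P by blast
  have z: "measure p {x} = 0" if "x \<in> E" for x
    using no that measure_nonneg[of p "{x}"] by (meson not_le order_antisym)
  have "E \<noteq> {}" using E(3) by auto
  then obtain x0 where x0: "x0 \<in> E" by blast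
  have mc: "meet_closed E" unfolding meet_closed_def using EP m by blast
  have FE: "F x \<in> sets p" if "x \<in> E" for x using that EP by simp
  have Gpos: "0 < G x0"
  proof -
    have "(\<Union>v\<in>E. F v) \<in> sets p \<and> measure p (\<Union>v\<in>E. F v) \<le> G x0"
      using FE G[OF _ x0] by (intro cofinal_bound[OF mc \<open>E \<noteq> {}\<close>] F_antimono) (simp_all add: G_def)
    moreover have "E \<subseteq> (\<Union>v\<in>E. F v)" using le_refl EP by (auto simp: F_def)
    ultimately show ?thesis using E(3) mass.finite_measure_mono[of E "\<Union>v\<in>E. F v"] by linarith
  qed
  \<comment> \<open>Incomparable points would have disjoint fringes, both of the same positive mass
    as the fringe of their meet that contains them.\<close>
  have chain: "x \<sqsubseteq> y \<or> y \<sqsubseteq> x" if xy: "x \<in> E" "y \<in> E" for x y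
  proof (rule ccontr)
    assume "\<not> ?thesis"
    then have "G x + G y \<le> G (meet x y)"
      using EP[OF xy(1)] EP[OF xy(2)] by (intro G_two) (auto simp: meet_le1 meet_le2)
    then show False using G[OF xy(1) x0] G[OF xy(2) x0] G[OF m[OF xy] x0] Gpos by linarith
  qed
  have null: "(\<Union>v\<in>E. F v - F y) \<in> null_sets p" if y: "y \<in> E" for y
  proof -
    have "measure p (F v - F y) \<le> 0" if v: "v \<in> E" for v
    proof (cases "v \<sqsubseteq> y")
      case True
      then have "measure p (F v - F y) = G v - G y"
        unfolding G_def using FE y v F_antimono by (intro mass.finite_measure_Diff) auto
      then show ?thesis using G[OF v y] by simp
    next
      case False
      then have "F v - F y = {}" using chain[OF v y] F_antimono by blast
      then show ?thesis by (simp only: measure_empty)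
    qed
    then have "(\<Union>v\<in>E. F v - F y) \<in> sets p \<and> measure p (\<Union>v\<in>E. F v - F y) \<le> 0"
      using FE y F_antimono by (intro cofinal_bound[OF mc \<open>E \<noteq> {}\<close>] sets.Diff) blast+
    moreover from this have "measure p (\<Union>v\<in>E. F v - F y) = 0"
      using measure_nonneg[of p "\<Union>v\<in>E. F v - F y"] by linarith
    ultimately show ?thesis unfolding null_sets_def mass.emeasure_eq_measure by simp
  qed
  obtain R where R: "\<And>x. x \<in> P \<Longrightarrow> h x \<le> R" using height_bounded by blast
  define s where "s = Sup (h ` E)"
  have bdd: "bdd_above (h ` E)" using R EP by (intro bdd_aboveI[of _ R]) blast
  have s: "h x \<le> s" if "x \<in> E" for x unfolding s_def by (rule cSUP_upper[OF that bdd])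
  have "\<exists>y\<in>E. s - 1 / Suc n < h y" for n :: nat
  proof -
    have "s - 1 / Suc n < Sup (h ` E)" by (simp add: s_def)
    then show ?thesis using less_cSUP_iff[OF \<open>E \<noteq> {}\<close> bdd] by blast
  qed
  then obtain y where y: "\<And>n. y n \<in> E" "\<And>n::nat. s - 1 / Suc n < h (y n)" by metis
  \<comment> \<open>Countably many \<open>y n\<close> with heights tending to the supremum suffice:
    a point of \<open>E\<close> outside \<open>N\<close> lies above all of them, hence at the
    supremal height, and in a chain there is at most one such point.\<close>
  define N where "N = (\<Union>n. \<Union>v\<in>E. F v - F (y n))"
  have N: "N \<in> null_sets p" unfolding N_def by (intro null_sets_UN null y(1))
  have top: "h x = s" if x: "x \<in> E" "x \<notin> N" for x
  proof (rule order_antisym[OF s[OF x(1)]], rule field_le_epsilon)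
    fix e :: real assume "0 < e"
    then obtain n where n: "1 / Suc n < e" using nat_approx_posE by blast
    have "x \<in> F x" using le_refl EP[OF x(1)] by (simp add: F_def)
    then have "x \<in> F (y n)" using x unfolding N_def by blast
    then have "h (y n) \<le> h x" by (simp add: F_def le_h)
    then show "s \<le> h x + e" using y(2)[of n] n by linarith
  qed
  have "measure p E \<le> 0"
  proof (cases "E \<subseteq> N")
    case True
    then have "measure p E \<le> measure p N" using N by (intro mass.finite_measure_mono) auto
    then show ?thesis using N by (simp add: measure_eq_0_null_sets)
  next
    case False
    then obtain x where x: "x \<in> E" "x \<notin> N" by blast
    have "E \<subseteq> N \<union> {x}"
    proof
      fix w assume w: "w \<in> E"
      show "w \<in> N \<union> {x}"
      proof (rule ccontr)
        assume a: "w \<notin> N \<union> {x}"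
        then have "h w = h x" using top[OF w] top[OF x] by simp
        then have "w = x" using chain[OF w x(1)] le_antisym[of w x] le_antisym[of x w] by auto
        then show False using a by simp
      qed
    qed
    then have "measure p E \<le> measure p (N \<union> {x})" 
      using N EP[OF x(1)] singleton_sets by (intro mass.finite_measure_mono) blast+
    also have "\<dots> \<le> measure p N + measure p {x}" using N EP[OF x(1)] by (intro measure_Un_le) auto
    finally show ?thesis using N z[OF x(1)] by (simp add: measure_eq_0_null_sets)
  qed
  then show False using E(3) by simp
qed

text \<open>Points close to \<open>x\<close> branch from it above a point \<open>z\<close> with
  \<open>G z\<close> close to \<open>G x\<close>, which exists by left continuity.\<close>

lemma c_cont:
  assumes x: "x \<in> P" and e: "0 < e"
  obtains \<delta> where "0 < \<delta>" "\<And>y. \<lbrakk>y \<in> P; d x y < \<delta>\<rbrakk> \<Longrightarrow> H x - e \<le> c x y"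
proof (cases "x = r")
  case True
  then have "H x - e \<le> c x y" for y using e c_nonneg[of x y] by (simp only: H_root)
  then show ?thesis using that[of 1] by simp
next
  case False
  obtain z where z: "z \<sqsubset> x" "G z < G x + e" using G_near[OF x False, of "G x + e"] e by auto
  show ?thesis
  proof (rule that[of "h x - h z"])
    show "0 < h x - h z" using ltD(4)[OF z(1)] by simp
    fix y assume y: "y \<in> P" "d x y < h x - h z"
    have "z \<sqsubseteq> y" by (rule le_ball[OF ltD(1)[OF z(1)] y(1)]) (use y(2) in simp)
    then have "G (meet x y) \<le> G z" by (intro G_antimono meet_greatest ltD(1)[OF z(1)])
    then show "H x - e \<le> c x y" using z(2) by (simp add: H_def c_def)
  qed
qed

end

text \<open>The representative of the class of \<open>T\<close> has the points \<open>(x, t)\<close> with \<open>x \<in> X\<close> and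
  \<open>0 \<le> t \<le> H x\<close>, where \<open>(x, t)\<close> and \<open>(y, t)\<close> are identified when \<open>t \<le> c x y\<close>. The map
  \<open>emb\<close> realises this quotient in a type of points.\<close>

locale collapse = wtree T for T :: "'a rw_tree" +
  fixes emb :: "'a \<Rightarrow> real \<Rightarrow> 'b"
  assumes emb_eq: "\<lbrakk>x \<in> X; y \<in> X; 0 \<le> t; t \<le> H x; 0 \<le> u; u \<le> H y\<rbrakk> \<Longrightarrow>
    emb x t = emb y u \<longleftrightarrow> t = u \<and> t \<le> c x y"
begin

section \<open>The quotient as a pointed hyperbolic geodesic space\<close>

definition adm :: "'a \<Rightarrow> real \<Rightarrow> bool" where "adm x t \<longleftrightarrow> x \<in> X \<and> 0 \<le> t \<and> t \<le> H x"

definition M' :: "'b set" where "M' = {emb x t |x t. adm x t}"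

definition rep :: "'b \<Rightarrow> 'a \<times> real" where
  "rep \<xi> = (SOME q. adm (fst q) (snd q) \<and> emb (fst q) (snd q) = \<xi>)"

definition s' :: "'b \<Rightarrow> 'b \<Rightarrow> real" where
  "s' \<xi> \<eta> = min (min (snd (rep \<xi>)) (snd (rep \<eta>))) (c (fst (rep \<xi>)) (fst (rep \<eta>)))"

text \<open>The value outside \<open>M'\<close> is fixed because nonnegativity and symmetry of a
  metric are required for all arguments.\<close>

definition d' :: "'b \<Rightarrow> 'b \<Rightarrow> real" where
  "d' \<xi> \<eta> = (if \<xi> \<in> M' \<and> \<eta> \<in> M' then snd (rep \<xi>) + snd (rep \<eta>) - 2 * s' \<xi> \<eta> else 0)"

definition r' :: 'b where "r' = emb r 0"

lemma admD: "adm x t \<Longrightarrow> x \<in> X" "adm x t \<Longrightarrow> x \<in> P" "adm x t \<Longrightarrow> 0 \<le> t" "adm x t \<Longrightarrow> t \<le> H x"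
  using X_P by (auto simp: adm_def)

lemma adm_root: "adm r 0"
  by (simp add: adm_def)

lemma adm_top: "x \<in> X \<Longrightarrow> adm x (H x)"
  by (simp add: adm_def)

lemma adm_less: "\<lbrakk>adm x t; 0 \<le> u; u \<le> t\<rbrakk> \<Longrightarrow> adm x u"
  by (auto simp: adm_def)

lemma emb_iff: "\<lbrakk>adm x t; adm y u\<rbrakk> \<Longrightarrow> emb x t = emb y u \<longleftrightarrow> t = u \<and> t \<le> c x y"
  using emb_eq by (simp add: adm_def)

lemma emb_in: "adm x t \<Longrightarrow> emb x t \<in> M'"
  by (auto simp: M'_def)

lemma M'E: assumes "\<xi> \<in> M'" obtains x t where "adm x t" "\<xi> = emb x t"
  using assms by (auto simp: M'_def)

lemma rep_M':
  assumes "\<xi> \<in> M'"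
  shows "adm (fst (rep \<xi>)) (snd (rep \<xi>))" "emb (fst (rep \<xi>)) (snd (rep \<xi>)) = \<xi>"
proof -
  obtain x t where "adm x t" "\<xi> = emb x t" using M'E[OF assms] .
  then have "\<exists>q. adm (fst q) (snd q) \<and> emb (fst q) (snd q) = \<xi>" by (intro exI[of _ "(x, t)"]) simp
  then show "adm (fst (rep \<xi>)) (snd (rep \<xi>))" "emb (fst (rep \<xi>)) (snd (rep \<xi>)) = \<xi>"
    unfolding rep_def using someI_ex[of "\<lambda>q. adm (fst q) (snd q) \<and> emb (fst q) (snd q) = \<xi>"] by blast+
qed

lemma rep:
  assumes "adm x t"
  shows "adm (fst (rep (emb x t))) t" "snd (rep (emb x t)) = t" "t \<le> c x (fst (rep (emb x t)))"
proof -
  let ?q = "rep (emb x t)"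
  have q: "adm (fst ?q) (snd ?q)" "emb (fst ?q) (snd ?q) = emb x t" using rep_M'[OF emb_in[OF assms]] .
  then have e: "t = snd ?q" "t \<le> c x (fst ?q)" using emb_iff[OF assms q(1)] by metis+
  show "adm (fst ?q) t" using q(1) unfolding e(1)[symmetric] .
  show "snd ?q = t" "t \<le> c x (fst ?q)" using e by simp_all
qed

text \<open>Independence of the representatives: a representative of \<open>emb x t\<close> branches
  from \<open>x\<close> at new height at least \<open>t\<close>, and \<open>c_hyp\<close> lets it
  replace \<open>x\<close> below that height.\<close>

lemma s'_emb:
  assumes x: "adm x t" and y: "adm y u"
  shows "s' (emb x t) (emb y u) = min (min t u) (c x y)"
proof -
  define x' y' where "x' = fst (rep (emb x t))" "y' = fst (rep (emb y u))"
  have a: "x' \<in> P" "t \<le> c x x'" "y' \<in> P" "u \<le> c y y'" "x \<in> P" "y \<in> P"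
    using rep[OF x] rep[OF y] admD(2) x y by (auto simp: x'_y'_def)
  have "min (c x x') (c x' y') \<le> c x y'" "min (c x y') (c y' y) \<le> c x y"
    "min (c x' x) (c x y) \<le> c x' y" "min (c x' y) (c y y') \<le> c x' y'"
    using a by (intro c_hyp; simp)+
  then have "min (min t u) (c x' y') = min (min t u) (c x y)"
    using a(2,4) c_commute[OF a(5,1)] c_commute[OF a(6,3)] by linarith
  then show ?thesis using rep(2)[OF x] rep(2)[OF y] by (simp add: s'_def x'_y'_def)
qed

lemma d'_emb:
  "\<lbrakk>adm x t; adm y u\<rbrakk> \<Longrightarrow> d' (emb x t) (emb y u) = t + u - 2 * min (min t u) (c x y)"
  by (simp add: d'_def emb_in rep s'_emb)

text \<open>\<open>min (min t u) (c x y)\<close> inherits the ultrametric inequality from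
  \<open>c\<close>. The triangle inequality and hyperbolicity both come down to
  \<open>c_hyp\<close>.\<close>

lemma pointed': "pointed_tree M' d' r'"
proof
  show "r' \<in> M'" using emb_in[OF adm_root] by (simp add: r'_def)
  show "0 \<le> d' \<xi> \<eta>" for \<xi> \<eta>
  proof (cases "\<xi> \<in> M' \<and> \<eta> \<in> M'")
    case True
    then obtain x t y u where "adm x t" "\<xi> = emb x t" "adm y u" "\<eta> = emb y u" using M'E by metis
    then show ?thesis by (simp add: d'_emb)
  qed (auto simp: d'_def)
  show "d' \<xi> \<eta> = d' \<eta> \<xi>" for \<xi> \<eta>
  proof (cases "\<xi> \<in> M' \<and> \<eta> \<in> M'")
    case True
    then obtain x t y u where "adm x t" "\<xi> = emb x t" "adm y u" "\<eta> = emb y u" using M'E by metis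
    then show ?thesis using c_commute[of x y] admD(2) by (simp add: d'_emb min.commute)
  qed (auto simp: d'_def)
  show "d' \<xi> \<eta> = 0 \<longleftrightarrow> \<xi> = \<eta>" if \<xi>: "\<xi> \<in> M'" and \<eta>: "\<eta> \<in> M'" for \<xi> \<eta>
  proof -
    obtain x t where x: "adm x t" "\<xi> = emb x t" using M'E[OF \<xi>] .
    obtain y u where y: "adm y u" "\<eta> = emb y u" using M'E[OF \<eta>] .
    have "t + u - 2 * min (min t u) (c x y) = 0 \<longleftrightarrow> t = u \<and> t \<le> c x y" by linarith
    then show ?thesis using d'_emb[OF x(1) y(1)] emb_iff[OF x(1) y(1)] x(2) y(2) by simp
  qed
  show "d' \<xi> \<zeta> \<le> d' \<xi> \<eta> + d' \<eta> \<zeta>" if \<xi>: "\<xi> \<in> M'" and \<eta>: "\<eta> \<in> M'" and \<zeta>: "\<zeta> \<in> M'" for \<xi> \<eta> \<zeta>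
  proof -
    obtain x t where x: "adm x t" "\<xi> = emb x t" using M'E[OF \<xi>] .
    obtain y u where y: "adm y u" "\<eta> = emb y u" using M'E[OF \<eta>] .
    obtain z v where z: "adm z v" "\<zeta> = emb z v" using M'E[OF \<zeta>] .
    have "min (c x y) (c y z) \<le> c x z" using c_hyp admD(2) x(1) y(1) z(1) by blast
    then show ?thesis
      unfolding x(2) y(2) z(2) d'_emb[OF x(1) y(1)] d'_emb[OF y(1) z(1)] d'_emb[OF x(1) z(1)] by linarith
  qed
  have dr: "d' r' (emb x t) = t" if "adm x t" for x t
    unfolding r'_def d'_emb[OF adm_root that] using admD(3)[OF that] c_nonneg[of r x] by linarith
  show "min (d' r' \<xi> + d' r' \<eta> - d' \<xi> \<eta>) (d' r' \<eta> + d' r' \<zeta> - d' \<eta> \<zeta>) \<le> d' r' \<xi> + d' r' \<zeta> - d' \<xi> \<zeta>"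
    if \<xi>: "\<xi> \<in> M'" and \<eta>: "\<eta> \<in> M'" and \<zeta>: "\<zeta> \<in> M'" for \<xi> \<eta> \<zeta>
  proof -
    obtain x t where x: "adm x t" "\<xi> = emb x t" using M'E[OF \<xi>] .
    obtain y u where y: "adm y u" "\<eta> = emb y u" using M'E[OF \<eta>] .
    obtain z v where z: "adm z v" "\<zeta> = emb z v" using M'E[OF \<zeta>] .
    have "min (c x y) (c y z) \<le> c x z" using c_hyp admD(2) x(1) y(1) z(1) by blast
    then show ?thesis
      unfolding x(2) y(2) z(2) d'_emb[OF x(1) y(1)] d'_emb[OF y(1) z(1)] d'_emb[OF x(1) z(1)]
        dr[OF x(1)] dr[OF y(1)] dr[OF z(1)] by linarith
  qed
  show "\<exists>\<eta>\<in>M'. d' r' \<eta> = u \<and> d' \<eta> \<xi> = d' r' \<xi> - u" if \<xi>: "\<xi> \<in> M'" and u: "0 \<le> u" "u \<le> d' r' \<xi>" for \<xi> u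
  proof -
    obtain x t where x: "adm x t" "\<xi> = emb x t" using M'E[OF \<xi>] .
    have ut: "u \<le> t" using u(2) dr[OF x(1)] x(2) by simp
    have xu: "adm x u" by (rule adm_less[OF x(1) u(1) ut])
    have "d' (emb x u) \<xi> = t - u"
      unfolding x(2) d'_emb[OF xu x(1)] using ut c_self[OF admD(2)[OF xu]] admD(4)[OF x(1)] by linarith
    then show ?thesis using emb_in[OF xu] dr[OF xu] dr[OF x(1)] x(2) by (intro bexI[of _ "emb x u"]) simp_all
  qed
qed

sublocale N: pointed_tree M' d' r' by (rule pointed')

lemma N_h: "adm x t \<Longrightarrow> N.h (emb x t) = t"
proof -
  assume a: "adm x t"
  have "d' r' (emb x t) = t"
    unfolding r'_def d'_emb[OF adm_root a] using admD(3)[OF a] c_nonneg[of r x] by linarith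
  then show ?thesis by (simp add: N.h_def)
qed

lemma N_gp: "\<lbrakk>adm x t; adm y u\<rbrakk> \<Longrightarrow> N.gp (emb x t) (emb y u) = min (min t u) (c x y)"
  using N.d_eq[of "emb x t" "emb y u"] by (simp add: N_h d'_emb)

lemma N_le: "\<lbrakk>adm x t; adm y u\<rbrakk> \<Longrightarrow> N.le (emb x t) (emb y u) \<longleftrightarrow> t \<le> u \<and> t \<le> c x y"
  by (auto simp: N.le_def emb_in N_h N_gp)

section \<open>Separability and completeness of the quotient\<close>

lemma dense':
  obtains D' where "countable D'" "D' \<subseteq> M'" "\<And>\<xi> e. \<lbrakk>\<xi> \<in> M'; 0 < e\<rbrakk> \<Longrightarrow> \<exists>\<eta>\<in>D'. d' \<xi> \<eta> < e"
proof -
  obtain D where D: "countable D" "D \<subseteq> P" "\<And>x e. \<lbrakk>x \<in> P; 0 < e\<rbrakk> \<Longrightarrow> \<exists>y\<in>D. d x y < e"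
    using countable_dense by blast
  \<comment> \<open>The dense set of \<open>T\<close> may miss \<open>X\<close>, so each of its
    points is replaced by points of \<open>X\<close> close to it.\<close>
  define a where "a q n = (SOME x. x \<in> X \<and> d q x < 1 / Suc n)" for q and n :: nat
  define I where "I = {(q, n, s). q \<in> D \<and> s \<in> \<rat> \<and> adm (a q n) s}"
  define D' where "D' = (\<lambda>(q, n, s). emb (a q n) s) ` I"
  have "I \<subseteq> D \<times> UNIV \<times> \<rat>" by (auto simp: I_def)
  then have "countable D'"
    unfolding D'_def using D(1) countable_rat
    by (meson countable_SIGMA countable_image countable_subset countableI_type)
  moreover have "D' \<subseteq> M'" using emb_in by (auto simp: D'_def I_def)
  moreover have "\<exists>\<eta>\<in>D'. d' \<xi> \<eta> < e" if \<xi>: "\<xi> \<in> M'" and e: "0 < e" for \<xi> e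
  proof -
    obtain x t where x: "adm x t" "\<xi> = emb x t" using M'E[OF \<xi>] .
    obtain \<delta> where \<delta>: "0 < \<delta>" "\<And>y. \<lbrakk>y \<in> P; d x y < \<delta>\<rbrakk> \<Longrightarrow> H x - e/4 \<le> c x y"
      using c_cont[OF admD(2)[OF x(1)], of "e/4"] e by auto
    obtain n where n: "1 / Suc n < \<delta> / 2" using nat_approx_posE[of "\<delta>/2"] \<delta>(1) by auto
    obtain q where q: "q \<in> D" "d x q < 1 / Suc n" using D(3)[OF admD(2)[OF x(1)], of "1 / Suc n"] by auto
    have "x \<in> X \<and> d q x < 1 / Suc n" using q(2) admD(1)[OF x(1)] commute[of x q] by simp
    then have a: "a q n \<in> X" "d q (a q n) < 1 / Suc n"
      unfolding a_def using someI[of "\<lambda>x. x \<in> X \<and> d q x < 1 / Suc n" x] by blast+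
    have qP: "q \<in> P" "a q n \<in> P" "x \<in> P" using q(1) D(2) a(1) X_P admD(2)[OF x(1)] by blast+
    have "d x (a q n) < \<delta>" using triangle[OF qP(3,1,2)] q(2) a(2) n by linarith
    then have cx: "H x - e/4 \<le> c x (a q n)" using \<delta>(2) qP by blast
    \<comment> \<open>With \<open>s\<close> at most \<open>t\<close> and at most
      \<open>c x (a q n)\<close>, the new point lies below \<open>\<xi>\<close> and its distance
      from \<open>\<xi>\<close> is just \<open>t - s\<close>.\<close>
    have "\<exists>s\<in>\<rat>. 0 \<le> s \<and> s \<le> t \<and> t - e/2 \<le> s \<and> s \<le> c x (a q n)"
    proof (cases "t \<le> e/4")
      case True
      then show ?thesis using admD(3)[OF x(1)] e by (intro bexI[of _ 0]) simp_all
    next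
      case False
      then have "max 0 (t - e/2) < t - e/4" using e by auto
      then obtain s where "s \<in> \<rat>" "max 0 (t - e/2) < s" "s < t - e/4" using Rats_dense_in_real by blast
      then show ?thesis using cx admD(4)[OF x(1)] e by (intro bexI[of _ s]) auto
    qed
    then obtain s where s: "s \<in> \<rat>" "0 \<le> s" "s \<le> t" "t - e/2 \<le> s" "s \<le> c x (a q n)" by blast
    have adm: "adm (a q n) s" using a(1) s c_le(2)[OF qP(3,2)] by (simp add: adm_def)
    have "d' \<xi> (emb (a q n) s) = t - s"
      unfolding x(2) d'_emb[OF x(1) adm] using s by linarith
    moreover have "emb (a q n) s \<in> D'"
      unfolding D'_def by (rule image_eqI[of _ _ "(q, n, s)"]) (use q(1) s(1) adm in \<open>simp_all add: I_def\<close>)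
    ultimately show ?thesis using s(4) e by (intro bexI[of _ "emb (a q n) s"]) simp_all
  qed
  ultimately show ?thesis using that by blast
qed

text \<open>The first components \<open>x n\<close> need not converge in \<open>T\<close>. Instead,
  \<open>V k\<close> collects the points that eventually branch from \<open>x n\<close> at new
  height at least \<open>\<tau> - 1 / Suc k\<close>, where \<open>\<tau>\<close> is the limit of the
  heights. These are decreasing filters, and a common point \<open>y\<close> gives the limit
  \<open>emb y \<tau>\<close>.\<close>

lemma complete': "N.mcomplete"
  unfolding N.mcomplete_def
proof (intro allI impI)
  fix \<sigma> assume C: "N.MCauchy \<sigma>"
  then have \<sigma>M: "\<sigma> n \<in> M'" for n by (auto simp: N.MCauchy_def)
  define x t where "x n = fst (rep (\<sigma> n))" and "t n = snd (rep (\<sigma> n))" for n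
  have x: "adm (x n) (t n)" "\<sigma> n = emb (x n) (t n)" for n
    using rep_M'[OF \<sigma>M[of n]] by (simp_all add: x_def t_def)
  have xP: "x n \<in> P" "x n \<in> X" for n using admD x(1) by blast+
  have dist: "d' (\<sigma> m) (\<sigma> n) = t m + t n - 2 * min (min (t m) (t n)) (c (x m) (x n))" for m n
    unfolding x(2) by (rule d'_emb[OF x(1) x(1)])
  have Cau: "\<exists>N. \<forall>m\<ge>N. \<forall>n\<ge>N. d' (\<sigma> m) (\<sigma> n) < e" if "0 < e" for e
  proof -
    have "\<forall>e>0. \<exists>N. \<forall>m n. N \<le> m \<longrightarrow> N \<le> n \<longrightarrow> d' (\<sigma> m) (\<sigma> n) < e" using C by (simp add: N.MCauchy_def)
    then show ?thesis using that by meson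
  qed
  have "Cauchy t"
    unfolding Cauchy_def
  proof (intro allI impI)
    fix e :: real assume "0 < e"
    then obtain N where N: "\<forall>m\<ge>N. \<forall>n\<ge>N. d' (\<sigma> m) (\<sigma> n) < e" using Cau by blast
    have "dist (t m) (t n) < e" if "N \<le> m" "N \<le> n" for m n
      using N that dist[of m n] unfolding dist_real_def by (smt (verit))
    then show "\<exists>N. \<forall>m\<ge>N. \<forall>n\<ge>N. dist (t m) (t n) < e" by blast
  qed
  then obtain \<tau> where \<tau>: "t \<longlonglongrightarrow> \<tau>" using Cauchy_convergent_iff convergent_def by blast
  have near: "\<exists>N. \<forall>n\<ge>N. \<bar>t n - \<tau>\<bar> < e" if "0 < e" for e
    using \<tau> that unfolding lim_sequentially dist_real_def by blast
  have cc: "\<exists>N. \<forall>m\<ge>N. \<forall>n\<ge>N. \<tau> - e \<le> c (x m) (x n)" if e: "0 < e" for e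
  proof -
    obtain N1 where N1: "\<forall>m\<ge>N1. \<forall>n\<ge>N1. d' (\<sigma> m) (\<sigma> n) < e/2" using Cau[of "e/2"] e by auto
    obtain N2 where N2: "\<forall>n\<ge>N2. \<bar>t n - \<tau>\<bar> < e/2" using near[of "e/2"] e by auto
    have "\<tau> - e \<le> c (x m) (x n)" if "max N1 N2 \<le> m" "max N1 N2 \<le> n" for m n
    proof -
      have "d' (\<sigma> m) (\<sigma> n) < e/2" "\<bar>t n - \<tau>\<bar> < e/2" "\<bar>t m - \<tau>\<bar> < e/2" using N1 N2 that by simp_all
      then show ?thesis using dist[of m n] by linarith
    qed
    then show ?thesis by blast
  qed
  define V where "V k = {y \<in> X. \<exists>N. \<forall>n\<ge>N. \<tau> - 1 / Suc k \<le> c (x n) y}" for k :: nat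
  have "\<exists>y\<in>X. \<forall>k. y \<in> V k"
  proof (rule filters_intersect)
    show "V k \<noteq> {}" for k
    proof -
      obtain N where N: "\<forall>m\<ge>N. \<forall>n\<ge>N. \<tau> - 1 / Suc k \<le> c (x m) (x n)" using cc[of "1 / Suc k"] by auto
      then have "x N \<in> V k" using xP by (auto simp: V_def)
      then show ?thesis by blast
    qed
    show "V k \<subseteq> X" for k by (auto simp: V_def)
    show "V n \<subseteq> V m" if "m \<le> n" for m n
    proof -
      have "1 / real (Suc n) \<le> 1 / Suc m" using that by (simp add: frac_le)
      then show ?thesis unfolding V_def by (smt (verit) Collect_mono)
    qed
    show "y \<in> V k" if z: "z \<in> V k" "z \<sqsubseteq> y" "y \<in> X" for k z y
    proof -
      obtain N where N: "\<forall>n\<ge>N. \<tau> - 1 / Suc k \<le> c (x n) z" using z(1) by (auto simp: V_def)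
      have P: "z \<in> P" "y \<in> P" using leD z(2) by blast+
      have "c (x n) z \<le> c (x n) y" for n
        using c_hyp[OF xP(1)[of n] P] c_below[OF z(2)] c_le(2)[OF xP(1)[of n] P(1)] by linarith
      then have "\<forall>n\<ge>N. \<tau> - 1 / Suc k \<le> c (x n) y" using N order_trans by blast
      then show ?thesis using z(3) by (auto simp: V_def)
    qed
    show "meet y z \<in> V k" if yz: "y \<in> V k" "z \<in> V k" for k y z
    proof -
      obtain N1 where N1: "\<forall>n\<ge>N1. \<tau> - 1 / Suc k \<le> c (x n) y" using yz(1) by (auto simp: V_def)
      obtain N2 where N2: "\<forall>n\<ge>N2. \<tau> - 1 / Suc k \<le> c (x n) z" using yz(2) by (auto simp: V_def)
      have X: "y \<in> X" "z \<in> X" using yz by (auto simp: V_def)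
      have P: "y \<in> P" "z \<in> P" using X X_P by blast+
      have "\<tau> - 1 / Suc k \<le> c (x n) (meet y z)" if n: "max N1 N2 \<le> n" for n
      proof -
        have "\<tau> - 1 / Suc k \<le> c (x n) y" "\<tau> - 1 / Suc k \<le> c (x n) z" using N1 N2 n by simp_all
        moreover have "min (c y (x n)) (c (x n) z) \<le> c y z" by (rule c_hyp[OF P(1) xP(1) P(2)])
        moreover have "min (c (x n) y) (c y (meet y z)) \<le> c (x n) (meet y z)"
          by (rule c_hyp[OF xP(1) P(1)]) (use P in simp)
        moreover have "c y (meet y z) = c y z"
          using c_below[OF meet_le1[OF P]] c_commute[of y "meet y z"] P by (simp add: H_def c_def)
        ultimately show ?thesis using c_commute[OF P(1) xP(1)[of n]] by linarith
      qed
      then have "\<forall>n\<ge>max N1 N2. \<tau> - 1 / Suc k \<le> c (x n) (meet y z)" by blast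
      then show ?thesis using meet_X[OF X(1) P(2)] unfolding V_def by blast
    qed
  qed
  then obtain y where y: "y \<in> X" "\<And>k. y \<in> V k" by blast
  have yP: "y \<in> P" using y(1) X_P by blast
  have yc: "\<exists>N. \<forall>n\<ge>N. \<tau> - e \<le> c (x n) y" if e: "0 < e" for e
  proof -
    obtain k where k: "1 / Suc k < e" using nat_approx_posE[OF e] .
    obtain N where "\<forall>n\<ge>N. \<tau> - 1 / Suc k \<le> c (x n) y" using y(2)[of k] by (auto simp: V_def)
    then show ?thesis using k by (intro exI[of _ N]) fastforce
  qed
  have "\<tau> \<le> H y"
  proof (rule field_le_epsilon)
    fix e :: real assume "0 < e"
    then obtain N where "\<tau> - e \<le> c (x N) y" using yc by blast
    then show "\<tau> \<le> H y + e" using c_le(2)[OF xP(1)[of N] yP] by linarith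
  qed
  moreover have "0 \<le> \<tau>" using LIMSEQ_le_const[OF \<tau>, of 0] admD(3)[OF x(1)] by blast
  ultimately have adm: "adm y \<tau>" using y(1) by (simp add: adm_def)
  have "limitin N.mtopology \<sigma> (emb y \<tau>) sequentially"
    unfolding N.limit_metric_sequentially
  proof (intro conjI allI impI)
    show "emb y \<tau> \<in> M'" by (rule emb_in[OF adm])
    fix e :: real assume e: "0 < e"
    obtain N1 where N1: "\<forall>n\<ge>N1. \<bar>t n - \<tau>\<bar> < e/4" using near[of "e/4"] e by auto
    obtain N2 where N2: "\<forall>n\<ge>N2. \<tau> - e/4 \<le> c (x n) y" using yc[of "e/4"] e by auto
    have "d' (\<sigma> n) (emb y \<tau>) < e" if n: "max N1 N2 \<le> n" for n
    proof -
      have "\<bar>t n - \<tau>\<bar> < e/4" "\<tau> - e/4 \<le> c (x n) y" using N1 N2 n by simp_all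
      then show ?thesis unfolding x(2) d'_emb[OF x(1) adm] using e by linarith
    qed
    then show "\<exists>N. \<forall>n\<ge>N. \<sigma> n \<in> M' \<and> d' (\<sigma> n) (emb y \<tau>) < e" using \<sigma>M by blast
  qed
  then show "\<exists>\<xi>. limitin N.mtopology \<sigma> \<xi> sequentially" by blast
qed

lemma real_tree': "real_tree (metric (M', d'))"
proof (rule N.real_tree_metric[OF complete'])
  obtain D' where D': "countable D'" "D' \<subseteq> M'" "\<And>\<xi> e. \<lbrakk>\<xi> \<in> M'; 0 < e\<rbrakk> \<Longrightarrow> \<exists>\<eta>\<in>D'. d' \<xi> \<eta> < e"
    using dense' by blast
  have "N.mtopology closure_of D' = M'"
    unfolding N.metric_closure_of using D'(2,3) by fastforce
  then show "separable_space N.mtopology"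
    unfolding separable_space_def using D'(1,2) by (intro exI[of _ D']) simp
  have "M' \<subseteq> N.mcball r' 1"
  proof
    fix \<xi> assume \<xi>: "\<xi> \<in> M'"
    then obtain x t where x: "adm x t" "\<xi> = emb x t" using M'E by blast
    then have "d' r' \<xi> = t" using N_h by (simp add: N.h_def)
    moreover have "t \<le> 1" using admD(4)[OF x(1)] H_le_1[of x] by linarith
    ultimately show "\<xi> \<in> N.mcball r' 1" using \<xi> by simp
  qed
  then show "N.mbounded M'" unfolding N.mbounded_def by blast
qed

section \<open>The image of the mass and the tree it gives\<close>

definition q :: "'a \<Rightarrow> 'b" where "q y = (if y \<in> X then emb y (H y) else r')"

definition B' :: "'b measure" where "B' = sigma M' {U. openin N.mtopology U}"

definition T' :: "'b rw_tree" where
  "T' = \<lparr>tree_metric = metric (M', d'), tree_root = r', tree_mass = distr p B' q\<rparr>"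

lemma open_pow: "{U. openin N.mtopology U} \<subseteq> Pow M'"
  using openin_subset[of N.mtopology] by auto

lemma B'_space: "space B' = M'" and B'_sets: "sets B' = sigma_sets M' {U. openin N.mtopology U}"
  using open_pow by (simp_all add: B'_def)

lemma B'_sets_F: "sets B' = sigma_sets M' (N.F ` M')"
proof
  obtain D' where D': "countable D'" "D' \<subseteq> M'" "\<And>\<xi> e. \<lbrakk>\<xi> \<in> M'; 0 < e\<rbrakk> \<Longrightarrow> \<exists>\<eta>\<in>D'. d' \<xi> \<eta> < e"
    using dense' by blast
  show "sets B' \<subseteq> sigma_sets M' (N.F ` M')" unfolding B'_sets
    by (intro sigma_sets_mono) (use N.open_in_sigma_F[OF D'] in blast)
  have "N.F \<xi> \<in> sets B'" if "\<xi> \<in> M'" for \<xi>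
  proof -
    have "openin N.mtopology (M' - N.F \<xi>)" using N.closedin_F[OF that] by (simp add: closedin_def)
    then have "M' - N.F \<xi> \<in> sets B'" unfolding B'_sets by (intro sigma_sets.Basic) simp
    then have "space B' - (M' - N.F \<xi>) \<in> sets B'" by (rule sets.compl_sets)
    then show ?thesis using N.F_subset[of \<xi>] by (simp add: B'_space double_diff)
  qed
  then have "N.F ` M' \<subseteq> sets B'" by blast
  then show "sigma_sets M' (N.F ` M') \<subseteq> sets B'"
    using sets.sigma_sets_subset[of "N.F ` M'" B'] B'_space by simp
qed

lemma q_X: "y \<in> X \<Longrightarrow> q y = emb y (H y)"
  by (simp add: q_def)

lemma q_in: "q y \<in> M'"
  using emb_in adm_top N.root by (simp add: q_def)

lemma level_X: assumes "adm x t" shows "{y \<in> X. t \<le> c x y} \<in> sets p"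
proof -
  have "t \<le> 1" using admD(4)[OF assms] H_le_1[of x] by linarith
  then have "X \<inter> {y \<in> P. t \<le> c x y} \<in> sets p" using level_sets[OF admD(2)[OF assms]] X_sets by blast
  moreover have "X \<inter> {y \<in> P. t \<le> c x y} = {y \<in> X. t \<le> c x y}" using X_P by blast
  ultimately show ?thesis by simp
qed

lemma q_F_iff: "\<lbrakk>adm x t; y \<in> X\<rbrakk> \<Longrightarrow> q y \<in> N.F (emb x t) \<longleftrightarrow> t \<le> c x y"
  using N_le[of x t y "H y"] adm_top[of y] c_le(2)[of x y] admD(2) X_P by (fastforce simp: q_X N.F_def)

lemma q_measurable: "q \<in> measurable p B'"
proof (rule measurable_sigma_sets[OF B'_sets_F])
  show "N.F ` M' \<subseteq> Pow M'" using N.F_subset by blast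
  show "q \<in> space p \<rightarrow> M'" using q_in by blast
  fix A assume "A \<in> N.F ` M'"
  then obtain x t where x: "adm x t" "A = N.F (emb x t)" using M'E by blast
  show "q -` A \<inter> space p \<in> sets p"
  \<comment> \<open>Off \<open>X\<close>, which is a null set, \<open>q\<close> has the default
    value \<open>r'\<close>. This lies in the fringe exactly if \<open>t = 0\<close>, and then the
    fringe is the whole tree.\<close>
  proof (cases "t = 0")
    case True
    have "q y \<in> A" for y
    proof -
      have "N.gp (emb x t) (q y) = 0" 
        using N.gp_le1[OF emb_in[OF x(1)] q_in] N.gp_nonneg[OF emb_in[OF x(1)] q_in] N_h[OF x(1)] True
        by (metis order_antisym)
      then show ?thesis unfolding x(2) using emb_in[OF x(1)] q_in N_h[OF x(1)] True
        by (simp add: N.F_def N.le_def)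
    qed
    then have "q -` A \<inter> space p = space p" by blast
    then show ?thesis by simp
  next
    case False
    have "r' \<notin> A"
    proof
      assume "r' \<in> A"
      then have "N.le (emb x t) r'" unfolding x(2) by (simp add: N.F_def)
      then have "N.h (emb x t) \<le> N.h r'" by (rule N.le_h)
      then show False using N_h[OF x(1)] False admD(3)[OF x(1)] by simp
    qed
    then have "q -` A \<inter> space p = {y \<in> X. t \<le> c x y}"
      using q_F_iff[OF x(1)] x(2) X_P by (auto simp: space_p q_def split: if_splits)
    then show ?thesis using level_X[OF x(1)] by simp
  qed
qed

lemma rw': "rooted_weighted_tree T'"
proof -
  have "prob_space (distr p B' q)" by (rule mass.prob_space_distr[OF q_measurable])
  then show ?thesis
    using real_tree' N.root by (simp add: rooted_weighted_tree_def T'_def B'_space B'_sets)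
qed

sublocale T': wtree T' by unfold_locales (rule rw')

lemma T'_parts: "tree_points T' = M'" "tree_dist T' = d'" "tree_root T' = r'" "tree_mass T' = distr p B' q"
  by (simp_all add: T'_def)

lemma T'_order: "T'.h = N.h" "T'.gp = N.gp" "T'.le = N.le" "T'.lt = N.lt" "T'.F = N.F"
  unfolding T'_parts(1,2,3) by simp_all

lemma measure': assumes "A \<in> sets T'.p"
  shows "measure T'.p A = measure p {y \<in> X. q y \<in> A}" "{y \<in> X. q y \<in> A} \<in> sets p"
proof -
  have A: "A \<in> sets B'" using assms by (simp add: T'_parts)
  have s: "q -` A \<inter> space p \<in> sets p" by (rule measurable_sets[OF q_measurable A])
  have eq: "(q -` A \<inter> space p) \<inter> X = {y \<in> X. q y \<in> A}" using X_P space_p by blast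
  show "{y \<in> X. q y \<in> A} \<in> sets p" unfolding eq[symmetric] by (rule sets.Int[OF s X_sets])
  show "measure T'.p A = measure p {y \<in> X. q y \<in> A}"
    unfolding T'_parts measure_distr[OF q_measurable A] eq[symmetric] measure_X[OF s] ..
qed

end

section \<open>Spacing and special points of the quotient\<close>

context collapse
begin

lemma h': "adm x t \<Longrightarrow> T'.h (emb x t) = t"
  unfolding T'_order by (rule N_h)

lemma le': "\<lbrakk>adm x t; adm y u\<rbrakk> \<Longrightarrow> T'.le (emb x t) (emb y u) \<longleftrightarrow> t \<le> u \<and> t \<le> c x y"
  unfolding T'_order by (rule N_le)

lemma q_P [simp]: "q y \<in> T'.P"
  unfolding T'_parts by (rule q_in)

lemma P'E: assumes "\<xi> \<in> T'.P" obtains x t where "adm x t" "\<xi> = emb x t"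
  using assms M'E unfolding T'_parts by blast

lemma emb_P: "adm x t \<Longrightarrow> emb x t \<in> T'.P"
  unfolding T'_parts by (rule emb_in)

lemma h_q: "x \<in> X \<Longrightarrow> T'.h (q x) = H x"
  by (simp add: q_X h' adm_top)

lemma gp_q: "\<lbrakk>x \<in> X; y \<in> X\<rbrakk> \<Longrightarrow> T'.gp (q x) (q y) = c x y"
  using c_le[of x y] X_P N_gp[OF adm_top adm_top, of x y] by (simp add: T'_order q_X)

lemma d_q: "\<lbrakk>x \<in> X; y \<in> X\<rbrakk> \<Longrightarrow> T'.d (q x) (q y) = H x + H y - 2 * c x y"
  using T'.d_eq[of "q x" "q y"] by (simp add: h_q gp_q)

lemma le_q: "\<lbrakk>x \<in> X; y \<in> X\<rbrakk> \<Longrightarrow> T'.le (q x) (q y) \<longleftrightarrow> H x \<le> c x y"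
  using c_le(1)[of x y] X_P by (auto simp: T'.le_def h_q gp_q)

lemma le_q_iff: "\<lbrakk>x \<in> X; y \<in> X\<rbrakk> \<Longrightarrow> T'.le (q x) (q y) \<longleftrightarrow> G (meet x y) = G x"
  using c_le(1)[of x y] X_P by (auto simp: le_q H_def c_def)

lemma q_eqD: "\<lbrakk>x \<in> X; y \<in> X; q x = q y\<rbrakk> \<Longrightarrow> G (meet x y) = G x \<and> G y = G x"
  using emb_iff[OF adm_top adm_top, of x y] c_le(1)[of x y] X_P by (auto simp: q_X H_def c_def)

lemma le_top: "adm x t \<Longrightarrow> T'.le (emb x t) (q x)"
  using le'[of x t x "H x"] admD[of x t] adm_top[of x] by (simp add: q_X)

lemma F'_sets: "adm x t \<Longrightarrow> T'.F (emb x t) \<in> sets T'.p"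
  using T'.F_sets emb_P by blast

lemma G'_eq: "adm x t \<Longrightarrow> T'.G (emb x t) = measure p {y \<in> X. t \<le> c x y}"
proof -
  assume a: "adm x t"
  have "{y \<in> X. q y \<in> T'.F (emb x t)} = {y \<in> X. t \<le> c x y}"
    unfolding T'_order using q_F_iff[OF a] by blast
  then show ?thesis unfolding T'.G_def using measure'(1)[OF F'_sets[OF a]] by simp
qed

lemma G'_le: assumes a: "adm x t" shows "T'.G (emb x t) \<le> 1 - t"
proof -
  have t: "t \<le> 1" using admD(4)[OF a] H_le_1[of x] by linarith
  note L = level_sets[OF admD(2)[OF a] t]
  have "measure p {y \<in> X. t \<le> c x y} \<le> measure p {y \<in> P. t \<le> c x y}"
    using X_P L by (intro mass.finite_measure_mono) auto
  then show ?thesis using L G'_eq[OF a] by linarith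
qed

text \<open>The level \<open>H x = 1 - G x\<close> turns the bound on level sets into one
  inequality; for the other, the support points of \<open>F x\<close> lie in the level set.\<close>

lemma G'_q: assumes x: "x \<in> X" shows "T'.G (q x) = G x"
proof (rule order_antisym)
  show "T'.G (q x) \<le> G x" using G'_le[OF adm_top[OF x]] by (simp add: q_X[OF x] H_def)
  have "measure p (F x) \<le> measure p {y \<in> X. H x \<le> c x y}"
  proof (rule measure_supp_mono)
    show "F x \<inter> supp \<subseteq> {y \<in> X. H x \<le> c x y}" using supp_X c_below by (auto simp: F_def)
  qed (use level_X[OF adm_top[OF x]] X_P[OF x] in simp_all)
  then show "G x \<le> T'.G (q x)" using G'_eq[OF adm_top[OF x]] by (simp add: q_X[OF x] G_def)
qed

text \<open>A branching of the new tree at height \<open>t\<close> has \<open>c x y = t\<close>,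
  less than \<open>H x\<close> and \<open>H y\<close>. So \<open>x\<close> and \<open>y\<close> are
  incomparable, and the branch point is the image of their meet. Conversely, \<open>G\<close>
  strictly decreases along both arms of a branch point, so neither arm collapses.\<close>

lemma branch': "T'.branch T'.P = q ` branch span"
proof
  show "T'.branch T'.P \<subseteq> q ` branch span"
  proof
    fix \<xi> assume "\<xi> \<in> T'.branch T'.P"
    then obtain \<xi>1 \<xi>2 where \<xi>: "T'.lt \<xi> \<xi>1" "T'.lt \<xi> \<xi>2" "T'.gp \<xi>1 \<xi>2 = T'.h \<xi>"
      by (auto simp: T'.branch_def)
    obtain z t where z: "adm z t" "\<xi> = emb z t" using P'E[OF T'.ltD(2)[OF \<xi>(1)]] .
    obtain x u where x: "adm x u" "\<xi>1 = emb x u" using P'E[OF T'.ltD(3)[OF \<xi>(1)]] .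
    obtain y v where y: "adm y v" "\<xi>2 = emb y v" using P'E[OF T'.ltD(3)[OF \<xi>(2)]] .
    have P: "x \<in> P" "y \<in> P" "x \<in> X" "y \<in> X" "z \<in> P" using admD x(1) y(1) z(1) by blast+
    have tu: "t < u" "t < v" using T'.ltD(4)[OF \<xi>(1)] T'.ltD(4)[OF \<xi>(2)] h' x y z by simp_all
    have "min (min u v) (c x y) = t"
      using \<xi>(3) N_gp[OF x(1) y(1)] h'[OF z(1)] unfolding x(2) y(2) z(2) T'_order by simp
    then have ct: "c x y = t" using tu by linarith
    let ?m = "meet x y"
    have Hm: "H ?m = t" using ct by (simp add: c_def H_def)
    have "\<not> x \<sqsubseteq> y" using c_below[of x y] ct tu(1) admD(4)[OF x(1)] by force
    moreover have "\<not> y \<sqsubseteq> x" using c_below[of y x] c_commute[OF P(1,2)] ct tu(2) admD(4)[OF y(1)] by force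
    ultimately have m: "?m \<in> branch span" using meet_branch[OF P(3,4)] by blast
    have mX: "?m \<in> X" using P by simp
    have "t \<le> c z x" using T'.ltD(1)[OF \<xi>(1)] le'[OF z(1) x(1)] x(2) z(2) by simp
    moreover have "c x ?m = t" using c_below[OF meet_le1[OF P(1,2)]] c_commute[of x ?m] P Hm by simp
    ultimately have "t \<le> c z ?m" using c_hyp[OF P(5,1) X_P[OF mX]] by linarith
    then have "\<xi> = q ?m" using emb_iff[OF z(1) adm_top[OF mX]] z(2) q_X[OF mX] Hm by simp
    then show "\<xi> \<in> q ` branch span" using m by blast
  qed
  show "q ` branch span \<subseteq> T'.branch T'.P"
  proof clarify
    fix m assume m: "m \<in> branch span"
    obtain a b where ab: "m \<sqsubset> a" "m \<sqsubset> b" "gp a b = h m" "0 < G a" "0 < G b" "a \<in> span" "b \<in> span"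
      using branch_spanE[OF m] .
    have X: "m \<in> X" "a \<in> X" "b \<in> X" using ab branch_span_in[OF m] span_X by blast+
    have lt: "T'.lt (q m) (q w)" if w: "w \<in> X" "m \<sqsubset> w" for w
    proof (rule T'.ltI)
      show "T'.le (q m) (q w)" using le_q[OF X(1) w(1)] c_below[OF ltD(1)[OF w(2)]] by simp
      show "T'.h (q m) < T'.h (q w)" using branch_G_less[OF m w(2)] h_q X(1) w(1) by (simp add: H_def)
    qed
    have "m \<sqsubseteq> meet a b" by (intro meet_greatest ltD(1) ab)
    then have "meet a b = m" using le_antisym[of m "meet a b"] h_meet[of a b] ab(3) X X_P by simp
    then have "T'.gp (q a) (q b) = T'.h (q m)" using gp_q h_q X by (simp add: c_def H_def)
    then show "q m \<in> T'.branch T'.P"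
      unfolding T'.branch_def using lt[OF X(2) ab(1)] lt[OF X(3) ab(2)] q_P by blast
  qed
qed

text \<open>Only \<open>G x = 0\<close> needs care, since \<open>x\<close> may lie outside the
  support of \<open>T\<close>. Then \<open>q x\<close> has height \<open>1\<close>, and a fringe
  \<open>F z\<close> with \<open>z\<close> slightly below \<open>x\<close> is, up to a null set,
  mapped into a small ball around \<open>q x\<close>, which thus has positive mass.\<close>

lemma top_span: assumes x: "x \<in> X" shows "q x \<in> T'.span"
proof (cases "0 < G x")
  case True
  then show ?thesis using T'.G_pos_span[OF q_P] G'_q[OF x] by simp
next
  case False
  then have G0: "G x = 0" using G_nonneg[of x] by linarith
  then have xr: "x \<noteq> r" by auto
  have "q x \<in> T'.supp"
    unfolding T'.supp_def
  proof (intro CollectI conjI allI impI)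
    show "q x \<in> T'.P" by simp
    fix e :: real assume e: "0 < e"
    obtain z where z: "z \<sqsubset> x" "G z < e/2" using G_near[OF X_P[OF x] xr, of "e/2"] G0 e by auto
    let ?B = "T'.mball (q x) e"
    have "measure p (F z) \<le> measure p {y \<in> X. q y \<in> ?B}"
    proof (rule measure_supp_mono)
      show "F z \<in> sets p" using ltD(2)[OF z(1)] by simp
      show "{y \<in> X. q y \<in> ?B} \<in> sets p" using measure'(2)[OF T'.ball_sets] .
      show "F z \<inter> supp \<subseteq> {y \<in> X. q y \<in> ?B}"
      proof
        fix y assume "y \<in> F z \<inter> supp"
        then have y: "z \<sqsubseteq> y" "y \<in> X" using supp_X by (auto simp: F_def)
        have "G (meet x y) \<le> G z" by (intro G_antimono meet_greatest ltD(1)[OF z(1)] y(1))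
        then have "2 * G (meet x y) < e" using z(2) by simp
        then have "T'.d (q x) (q y) < e"
          unfolding d_q[OF x y(2)] c_def using H_le_1[of x] H_le_1[of y] by argo
        then show "y \<in> {y \<in> X. q y \<in> ?B}" using y(2) by simp
      qed
    qed
    moreover have "0 < G z" using X_G[OF x z(1)] .
    ultimately show "0 < measure T'.p ?B" using measure'(1)[OF T'.ball_sets] by (simp add: G_def)
  qed
  then show ?thesis by (rule T'.supp_span)
qed

lemma full': "T'.span = T'.P"
proof
  show "T'.span \<subseteq> T'.P" using T'.downset_span by (simp add: T'.downset_def)
  show "T'.P \<subseteq> T'.span"
  proof
    fix \<xi> assume "\<xi> \<in> T'.P"
    then obtain x t where x: "adm x t" "\<xi> = emb x t" using P'E by blast
    show "\<xi> \<in> T'.span" unfolding x(2)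
      by (rule T'.downsetD[OF T'.downset_span top_span[OF admD(1)[OF x(1)]] le_top[OF x(1)]])
  qed
qed

text \<open>The mass is an image under \<open>q\<close>, so every ball around \<open>\<xi>\<close>
  contains some \<open>q y\<close>, where the identity holds. A point below \<open>\<xi>\<close> is
  below such \<open>q y\<close> and inherits the bound; left continuity passes it on to
  \<open>\<xi>\<close>.\<close>

lemma supp_spacing':
  assumes \<xi>: "\<xi> \<in> T'.supp" shows "1 - T'.h \<xi> \<le> T'.G \<xi>"
proof (cases "\<xi> = T'.r")
  case False
  have \<xi>P: "\<xi> \<in> T'.P" by (rule T'.supp_in[OF \<xi>])
  show ?thesis
  proof (rule T'.G_left_cont[OF \<xi>P False], rule field_le_epsilon)
    fix \<eta> and e :: real assume \<eta>: "T'.lt \<eta> \<xi>" and e: "0 < e"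
    define \<delta> where "\<delta> = min (T'.h \<xi> - T'.h \<eta>) e"
    have \<delta>: "0 < \<delta>" "\<delta> \<le> T'.h \<xi> - T'.h \<eta>" "\<delta> \<le> e" using T'.ltD(4)[OF \<eta>] e by (simp_all add: \<delta>_def)
    have "0 < measure T'.p (T'.mball \<xi> \<delta>)" using \<xi> \<delta>(1) by (simp add: T'.supp_def)
    then have "{y \<in> X. q y \<in> T'.mball \<xi> \<delta>} \<noteq> {}"
      using measure'(1)[OF T'.ball_sets[of \<xi> \<delta>]] by (metis less_irrefl measure_empty)
    then obtain y where y: "y \<in> X" "T'.d \<xi> (q y) < \<delta>" by auto
    have "T'.le \<eta> (q y)" by (rule T'.le_ball[OF T'.ltD(1)[OF \<eta>] q_P]) (use y(2) \<delta>(2) in linarith)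
    then have "T'.G (q y) \<le> T'.G \<eta>" by (rule T'.G_antimono)
    moreover have "T'.h (q y) \<le> T'.h \<xi> + \<delta>"
    proof -
      have "T'.h (q y) - T'.d (q y) \<xi> \<le> T'.h \<xi>"
        using T'.gp_ge[OF q_P \<xi>P] T'.gp_le2[OF q_P \<xi>P] order_trans by blast
      then show ?thesis using y(2) T'.commute[of "q y" \<xi>] by linarith
    qed
    moreover have "T'.G (q y) = 1 - T'.h (q y)" using G'_q[OF y(1)] h_q[OF y(1)] by (simp add: H_def)
    ultimately show "1 - T'.h \<xi> \<le> T'.G \<eta> + e" using \<delta>(3) by linarith
  qed
qed simp

theorem ip': "ip_tree T'"
proof -
  have "T'.d T'.r \<xi> + measure T'.p (fringe_subtree T' \<xi>) = 1"
    if \<xi>: "\<xi> \<in> T'.P" and s: "\<xi> \<in> branch_points T' T'.P \<or> \<xi> \<in> closed_support T'" for \<xi>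
  proof -
    have "T'.h \<xi> + T'.G \<xi> = 1"
    proof (cases "\<xi> \<in> T'.supp")
      case True
      obtain x t where x: "adm x t" "\<xi> = emb x t" using P'E[OF \<xi>] .
      then show ?thesis using supp_spacing'[OF True] G'_le[OF x(1)] h'[OF x(1)] by simp
    next
      case False
      then have "\<xi> \<in> T'.branch T'.P"
        using s T'.closed_support_eq T'.rooted_branch_points_eq[OF T'.downset_P]
        unfolding rooted_branch_points_def by blast
      then obtain m where m: "m \<in> branch span" "\<xi> = q m" unfolding branch' by blast
      then have "m \<in> X" using branch_span_in span_X by blast
      then show ?thesis using m(2) h_q G'_q by (simp add: H_def)
    qed
    then show ?thesis using T'.fringe_eq[OF \<xi>] by (simp add: T'.G_def T'.h_def)
  qed
  then show ?thesis using rw' full' T'.mass_span_eq by (auto simp: ip_tree_def)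
qed

text \<open>The fibre over \<open>q x\<close> may contain further points. Those in the support lie
  below \<open>x\<close> and have the same \<open>G\<close>, hence belong to sets
  \<open>F v - F x\<close> of mass zero, whose union \<open>U\<close> is still null.\<close>

lemma point': assumes x: "x \<in> special_points T" shows "measure T'.p {q x} = measure p {x}"
proof -
  have xs: "x \<in> X" "x \<in> P" "x \<in> span" using special_in[OF x] span_X by blast+
  define E where "E = {y \<in> X. q y \<in> {q x}}"
  have E: "E \<in> sets p" "measure T'.p {q x} = measure p E"
    using measure'[OF T'.singleton_sets[OF q_P]] by (simp_all add: E_def)
  define V where "V = {y. y \<sqsubseteq> x \<and> G y = G x}"
  define U where "U = (\<Union>v\<in>V. F v - F x)"
  have VP: "v \<in> P" if "v \<in> V" for v using that leD(1) unfolding V_def by blast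
  have "x \<in> V" using le_refl[OF xs(2)] by (simp add: V_def)
  have "meet_closed V" by (rule meet_closed_below[of _ x]) (simp add: V_def)
  moreover have "F v - F x \<in> sets p" if "v \<in> V" for v by (intro sets.Diff F_sets VP[OF that] xs(2))
  moreover have "measure p (F v - F x) \<le> 0" if v: "v \<in> V" for v
  proof -
    have "measure p (F v - F x) = measure p (F v) - measure p (F x)"
      using v VP[OF v] xs(2) F_antimono by (intro mass.finite_measure_Diff) (auto simp: V_def)
    then show ?thesis using v by (simp add: V_def G_def)
  qed
  ultimately have U: "U \<in> sets p \<and> measure p U \<le> 0"
    unfolding U_def using \<open>x \<in> V\<close> F_antimono by (intro cofinal_bound) blast+
  have "measure p E \<le> measure p (U \<union> {x})"
  proof (rule measure_supp_mono[OF E(1)])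
    show "U \<union> {x} \<in> sets p" by (rule sets.Un) (use U xs(2) in simp_all)
    show "E \<inter> supp \<subseteq> U \<union> {x}"
    proof
      fix y assume "y \<in> E \<inter> supp"
      then have y: "y \<in> X" "q y = q x" "y \<in> supp" by (simp_all add: E_def)
      have G: "G (meet y x) = G y" "G x = G y" using q_eqD[OF y(1) xs(1) y(2)] by simp_all
      have yx: "y \<sqsubseteq> x" by (rule special_ge[OF x y(3) G(1)])
      show "y \<in> U \<union> {x}"
      proof (cases "x \<sqsubseteq> y")
        case True
        then show ?thesis using le_antisym[OF yx] le_h by simp
      next
        case False
        then have "y \<in> V" "y \<in> F y - F x" using yx G le_refl[OF supp_in[OF y(3)]] by (simp_all add: V_def F_def)
        then show ?thesis unfolding U_def by blast
      qed
    qed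
  qed
  also have "\<dots> \<le> measure p U + measure p {x}" by (rule measure_Un_le) (use U xs(2) in simp_all)
  finally have "measure p E \<le> measure p {x}" using U by linarith
  moreover have "measure p {x} \<le> measure p E"
    using E(1) xs(1) by (intro mass.finite_measure_mono) (auto simp: E_def)
  ultimately show ?thesis using E(2) by simp
qed

text \<open>The preimage of the segment may be larger than the old segment, but on the support the
  two coincide by \<open>special_ge\<close>.\<close>

lemma below': assumes x: "x \<in> special_points T"
  shows "measure T'.p {\<zeta>. T'.le \<zeta> (q x)} = measure p {z. z \<sqsubseteq> x}"
proof -
  have xs: "x \<in> X" "x \<in> P" using special_in[OF x] span_X by blast+
  define E where "E = {y \<in> X. q y \<in> {\<zeta>. T'.le \<zeta> (q x)}}"
  have E: "E \<in> sets p" "measure T'.p {\<zeta>. T'.le \<zeta> (q x)} = measure p E"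
    using measure'[OF T'.below_sets[OF q_P]] by (simp_all add: E_def)
  have iff: "y \<in> E \<longleftrightarrow> y \<sqsubseteq> x" if y: "y \<in> supp" for y
  proof
    have yX: "y \<in> X" by (rule supp_X[OF y])
    show "y \<sqsubseteq> x" if "y \<in> E"
      using that le_q_iff[OF yX xs(1)] special_ge[OF x y] by (simp add: E_def)
    show "y \<in> E" if "y \<sqsubseteq> x"
      using le_q_iff[OF yX xs(1)] meet_le[OF that] yX by (simp add: E_def)
  qed
  have B: "{z. z \<sqsubseteq> x} \<in> sets p" using xs(2) by simp
  have "measure p E = measure p {z. z \<sqsubseteq> x}"
    by (intro order_antisym measure_supp_mono E(1) B) (use iff in auto)
  then show ?thesis using E(2) by simp
qed

text \<open>The fibre over \<open>\<xi>\<close> is closed under meets and \<open>G\<close> is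
  constant on it, so \<open>collapse_atom\<close> finds an old atom in it.\<close>

lemma atom': assumes \<xi>: "\<xi> \<in> T'.P" "0 < measure T'.p {\<xi>}"
  shows "\<xi> \<in> q ` special_points T"
proof -
  define E where "E = {y \<in> X. q y \<in> {\<xi>}}"
  have E: "E \<in> sets p" "0 < measure p E"
    using measure'[OF T'.singleton_sets[OF \<xi>(1)]] \<xi>(2) by (simp_all add: E_def)
  have G: "G x = G y" "meet x y \<in> E" if xy: "x \<in> E" "y \<in> E" for x y
  proof -
    have X: "x \<in> X" "y \<in> X" "q x = q y" "x \<in> P" "y \<in> P" "q x = \<xi>" using xy X_P by (auto simp: E_def)
    have G: "G (meet x y) = G x" "G y = G x" using q_eqD[OF X(1,2,3)] by simp_all
    show "G x = G y" using G by simp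
    have mX: "meet x y \<in> X" using X by simp
    have le: "meet x y \<sqsubseteq> x" by (rule meet_le1[OF X(4,5)])
    have "H (meet x y) = H x" using G(1) by (simp add: H_def)
    moreover have "c (meet x y) x = H (meet x y)" by (rule c_below[OF le])
    ultimately have "q (meet x y) = q x" using emb_iff[OF adm_top[OF mX] adm_top[OF X(1)]] q_X mX X(1) by simp
    then show "meet x y \<in> E" using mX X(6) by (simp add: E_def)
  qed
  have "\<exists>x\<in>E. 0 < measure p {x}"
  proof (rule collapse_atom[OF E(1) _ E(2)])
    show "E \<subseteq> X" by (auto simp: E_def)
    show "meet x y \<in> E" "G x = G y" if "x \<in> E" "y \<in> E" for x y using G[OF that] by blast+
  qed
  then obtain x where "x \<in> E" "0 < measure p {x}" by blast
  then have "x \<in> special_points T" "q x = \<xi>" using X_P by (auto simp: special_points_eq E_def)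
  then show ?thesis by blast
qed

text \<open>A tip without an atom has \<open>G x = 0\<close>, so its image has height
  \<open>1\<close>, the greatest possible, and is maximal. Small new distance to \<open>q x\<close>
  means that the branching with \<open>x\<close> has a fringe of small mass, and so lies high on the
  old segment to \<open>x\<close>.\<close>

lemma tip_to:
  assumes x: "x \<in> tips span" "\<not> limit_of (branch span) x" and p0: "measure p {x} = 0"
  shows "q x \<in> T'.tips T'.P \<and> \<not> T'.limit_of (q ` branch span) (q x)"
proof -
  have t: "x \<in> span" "x \<noteq> r" "\<And>y. \<lbrakk>y \<in> span; x \<sqsubseteq> y\<rbrakk> \<Longrightarrow> y = x" using x(1) by (auto simp: tips_def)
  have xX: "x \<in> X" and xP: "x \<in> P" using span_X[OF t(1)] X_P by blast+
  have "measure p (F x) \<le> measure p {x}"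
    by (rule measure_supp_mono) (use xP t(3) supp_span in \<open>auto simp: F_def[symmetric] intro: F_sets\<close>, auto simp: F_def)
  then have G0: "G x = 0" using p0 measure_nonneg[of p "F x"] unfolding G_def by linarith
  have hx: "T'.h (q x) = 1" using h_q[OF xX] G0 by (simp add: H_def)
  have "q x \<noteq> T'.r" using hx T'.h_root by force
  moreover have "\<xi> = q x" if le: "T'.le (q x) \<xi>" for \<xi>
  proof -
    obtain y u where y: "adm y u" "\<xi> = emb y u" using P'E[OF T'.leD(2)[OF le]] .
    have "u \<le> 1" using admD(4)[OF y(1)] H_le_1[of y] by linarith
    then have "T'.h \<xi> \<le> T'.h (q x)" using h'[OF y(1)] y(2) hx by simp
    then show ?thesis using T'.le_antisym[OF le] by simp
  qed
  ultimately have "q x \<in> T'.tips T'.P" by (auto simp: T'.tips_def)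
  moreover have "\<not> T'.limit_of (q ` branch span) (q x)"
  proof
    assume lim: "T'.limit_of (q ` branch span) (q x)"
    have "limit_of (branch span) x"
      unfolding limit_of_def
    proof (intro allI impI)
      fix e :: real assume e: "0 < e"
      have "0 < h x" using t(2) h_zero_iff[OF xP] h_nonneg[of x] by linarith
      then have s: "0 \<le> max 0 (h x - e/2)" "max 0 (h x - e/2) < h x" using e by simp_all
      define z where "z = pt x (max 0 (h x - e/2))"
      have z: "z \<sqsubseteq> x" "h z = max 0 (h x - e/2)" using pt[OF xP s(1)] s(2) by (simp_all add: z_def)
      then have zx: "z \<sqsubset> x" using s(2) by (intro ltI) simp_all
      have "0 < G z" by (rule X_G[OF xX zx])
      then obtain u where u: "u \<in> branch span" "T'.d (q x) (q u) < G z" using lim unfolding T'.limit_of_def by blast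
      have us: "u \<in> span" "u \<in> X" "u \<in> P" using branch_span_in[OF u(1)] span_X X_P by blast+
      \<comment> \<open>\<open>u\<close> itself may be far from \<open>x\<close> in
        \<open>T\<close>. Its meet with \<open>x\<close> is again a branch point, and it lies on the
        segment to \<open>x\<close> above \<open>z\<close>.\<close>
      let ?m = "meet x u"
      have mP: "?m \<in> P" "?m \<sqsubseteq> x" "?m \<sqsubseteq> u" using xP us meet_le1 meet_le2 by simp_all
      have "G u \<le> G ?m" by (rule G_antimono[OF mP(3)])
      then have Gm: "G ?m < G z" using u(2) d_q[OF xX us(2)] G0 unfolding c_def H_def by argo
      have "\<not> ?m \<sqsubseteq> z" using G_antimono[of ?m z] Gm by force
      then have zm: "z \<sqsubset> ?m" using le_linear'[OF mP(2) z(1)] by blast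
      have nxu: "\<not> x \<sqsubseteq> u"
      proof
        assume "x \<sqsubseteq> u"
        then have "u = x" using t(3) us(1) by blast
        then obtain w where "w \<in> span" "x \<sqsubset> w" using u(1) by (auto simp: branch_def)
        then show False using t(3) ltD(1,5) by blast
      qed
      have mx: "?m \<sqsubset> x" using meet_lt[OF xP us(3) nxu] .
      have "?m \<in> branch span"
      proof (cases "u \<sqsubseteq> x")
        case True
        then show ?thesis using meet_le[OF True] meet_commute[OF xP us(3)] u(1) by simp
      next
        case False then show ?thesis using meet_branch[OF xX us(2) nxu] by blast
      qed
      moreover have "d x ?m < e" using le_d[OF mP(2)] commute[of x ?m] ltD(4)[OF zm] z(2) e by auto
      ultimately show "\<exists>y\<in>branch span. y \<noteq> x \<and> y \<in> P \<and> d x y < e" using ltD(5)[OF mx] mP(1) by blast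
    qed
    then show False using x(2) by blast
  qed
  ultimately show ?thesis by blast
qed

text \<open>A tip of the new tree without an atom is in its support and has fringe mass zero, so
  spacing puts it at height \<open>1\<close>. A representing pair is then \<open>(x, H x)\<close>
  with \<open>G x = 0\<close>, and such an \<open>x\<close> is maximal in \<open>X\<close>.\<close>

lemma tip_from:
  assumes \<xi>: "\<xi> \<in> T'.tips T'.P" "\<not> T'.limit_of (q ` branch span) \<xi>" and p0: "measure T'.p {\<xi>} = 0"
  shows "\<exists>x\<in>tips span. \<not> limit_of (branch span) x \<and> \<xi> = q x"
proof -
  have t: "\<xi> \<in> T'.P" "\<xi> \<noteq> T'.r" "\<And>\<eta>. T'.le \<xi> \<eta> \<Longrightarrow> \<eta> = \<xi>"
    using \<xi>(1) T'.leD(2) by (auto simp: T'.tips_def)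
  have "T'.F \<xi> = {\<xi>}" using t(1,3) T'.le_refl by (auto simp: T'.F_def)
  then have G0: "T'.G \<xi> = 0" using p0 by (simp add: T'.G_def)
  have "\<xi> \<in> T'.supp"
  proof -
    have "\<xi> \<in> T'.span" using t(1) full' by blast
    then obtain \<eta> where "\<eta> \<in> T'.supp" "T'.le \<xi> \<eta>" by (auto simp: T'.span_def)
    then show ?thesis using t(3) by blast
  qed
  then have h1: "1 \<le> T'.h \<xi>" using supp_spacing' G0 by fastforce
  obtain x s where x: "adm x s" "\<xi> = emb x s" using P'E[OF t(1)] .
  have "1 \<le> s" "s \<le> H x" "H x \<le> 1" using h1 h'[OF x(1)] x(2) admD(4)[OF x(1)] H_le_1[of x] by simp_all
  then have sx: "s = H x" "H x = 1" by linarith+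
  have xX: "x \<in> X" and xP: "x \<in> P" using admD x(1) by blast+
  have qx: "\<xi> = q x" using x(2) sx q_X[OF xX] by simp
  have Gx: "G x = 0" using sx by (simp add: H_def)
  have xr: "x \<noteq> r" using Gx by auto
  have nlim: "\<not> limit_of (branch span) x"
  proof
    assume lim: "limit_of (branch span) x"
    have "T'.limit_of (q ` branch span) \<xi>"
      unfolding T'.limit_of_def
    proof (intro allI impI)
      fix e :: real assume e: "0 < e"
      obtain z where z: "z \<sqsubset> x" "G z < e/2" using G_near[OF xP xr, of "e/2"] Gx e by auto
      have "0 < h x - h z" using ltD(4)[OF z(1)] by simp
      then obtain u where u: "u \<in> branch span" "u \<in> P" "d x u < h x - h z" using lim unfolding limit_of_def by blast
      have uX: "u \<in> X" using branch_span_in[OF u(1)] span_X by blast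
      have "z \<sqsubseteq> u" by (rule le_ball[OF ltD(1)[OF z(1)] u(2)]) (use u(3) in simp)
      then have "G (meet x u) \<le> G z" by (intro G_antimono meet_greatest ltD(1)[OF z(1)])
      then have "2 * G (meet x u) < e" using z(2) by simp
      then have "T'.d \<xi> (q u) < e"
        unfolding qx d_q[OF xX uX] c_def using H_le_1[of x] H_le_1[of u] by argo
      moreover have "q u \<noteq> \<xi>"
        using h_q[OF uX] h_q[OF xX] qx branch_G_pos[OF u(1)] Gx by (auto simp: H_def)
      ultimately show "\<exists>\<eta>\<in>q ` branch span. \<eta> \<noteq> \<xi> \<and> \<eta> \<in> T'.P \<and> T'.d \<xi> \<eta> < e" using u(1) q_P by blast
    qed
    then show False using \<xi>(2) by blast
  qed
  have mx: "y = x" if y: "y \<in> X" "x \<sqsubseteq> y" for y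
  proof (rule ccontr)
    assume "y \<noteq> x"
    then have "0 < G x" using X_G[OF y(1)] y(2) by (simp add: lt_def)
    then show False using Gx by simp
  qed
  \<comment> \<open>Membership in \<open>X\<close> does not put \<open>x\<close> into the span. As
    no other branch point is within \<open>e\<close> of \<open>x\<close>, the support points above
    \<open>z\<close> all lie on the segment to \<open>x\<close>, so the positive mass of
    \<open>F z\<close> is close to \<open>x\<close>.\<close>
  have "x \<in> supp"
    unfolding supp_def
  proof (intro CollectI conjI allI impI)
    show "x \<in> P" by fact
    fix \<rho> :: real assume \<rho>: "0 < \<rho>"
    obtain e where e: "0 < e" "\<And>y. \<lbrakk>y \<in> branch span; y \<noteq> x; y \<in> P\<rbrakk> \<Longrightarrow> e \<le> d x y"
      using nlim unfolding limit_of_def by (meson not_le)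
    define \<epsilon> where "\<epsilon> = min e \<rho> / 2"
    have \<epsilon>: "0 < \<epsilon>" "\<epsilon> < e" "\<epsilon> < \<rho>" using e(1) \<rho> by (simp_all add: \<epsilon>_def min_def)
    have "0 < h x" using xr h_zero_iff[OF xP] h_nonneg[of x] by linarith
    then have s: "0 \<le> max 0 (h x - \<epsilon>)" "max 0 (h x - \<epsilon>) < h x" using \<epsilon>(1) by simp_all
    define z where "z = pt x (max 0 (h x - \<epsilon>))"
    have z: "z \<sqsubseteq> x" "h z = max 0 (h x - \<epsilon>)" using pt[OF xP s(1)] s(2) by (simp_all add: z_def)
    then have zx: "z \<sqsubset> x" using s(2) by (intro ltI) simp_all
    have near: "d x m \<le> \<epsilon>" if "z \<sqsubseteq> m" "m \<sqsubseteq> x" for m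
      using le_d[OF that(2)] le_h[OF that(1)] commute[of x m] z(2) by linarith
    have "measure p (F z) \<le> measure p (mball x \<rho>)"
    proof (rule measure_supp_mono)
      show "F z \<in> sets p" using leD(1)[OF z(1)] by simp
      show "F z \<inter> supp \<subseteq> mball x \<rho>"
      proof
        fix y assume "y \<in> F z \<inter> supp"
        then have y: "z \<sqsubseteq> y" "y \<in> X" "y \<in> P" using supp_X supp_in by (auto simp: F_def)
        have m: "meet x y \<sqsubseteq> x" "z \<sqsubseteq> meet x y" "meet x y \<in> P"
          using meet_le1[OF xP y(3)] meet_greatest[OF z(1) y(1)] xP y(3) by simp_all
        have "y \<sqsubseteq> x"
        proof (rule ccontr)
          assume n: "\<not> y \<sqsubseteq> x"
          then have n': "\<not> x \<sqsubseteq> y" using mx[OF y(2)] by auto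
          have "meet x y \<in> branch span" by (rule meet_branch[OF xX y(2) n' n])
          moreover have "meet x y \<noteq> x" using ltD(5)[OF meet_lt[OF xP y(3) n']] .
          ultimately have "e \<le> d x (meet x y)" using e(2) m(3) by blast
          then show False using near[OF m(2,1)] \<epsilon>(2) by linarith
        qed
        then have "d x y \<le> \<epsilon>" using near[OF y(1)] by blast
        then show "y \<in> mball x \<rho>" using \<epsilon>(3) xP y(3) by simp
      qed
    qed simp
    then show "0 < measure p (mball x \<rho>)" using X_G[OF xX zx] by (simp add: G_def)
  qed
  then have "x \<in> tips span" using supp_span xr mx span_X by (auto simp: tips_def)
  then show ?thesis using nlim qx by blast
qed

lemma special_image: "q ` special_points T = special_points T'"
proof
  show "q ` special_points T \<subseteq> special_points T'"
  proof clarify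
    fix x assume x: "x \<in> special_points T"
    then consider "0 < measure p {x}" | "x \<in> branch span"
      | "measure p {x} = 0" "x \<in> tips span" "\<not> limit_of (branch span) x"
      unfolding special_points_eq using zero_less_measure_iff[of p "{x}"] by auto
    then show "q x \<in> special_points T'"
    proof cases
      case 1 then show ?thesis using point'[OF x] unfolding T'.special_points_eq by simp
    next
      case 2 then show ?thesis unfolding T'.special_points_eq full' branch' by blast
    next
      case 3 then show ?thesis using tip_to[OF 3(2,3,1)] unfolding T'.special_points_eq full' branch' by blast
    qed
  qed
  show "special_points T' \<subseteq> q ` special_points T"
  proof
    fix \<xi> assume \<xi>: "\<xi> \<in> special_points T'"
    then have \<xi>P: "\<xi> \<in> T'.P" using T'.special_in by blast
    consider "0 < measure T'.p {\<xi>}" | "\<xi> \<in> q ` branch span"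
      | "measure T'.p {\<xi>} = 0" "\<xi> \<in> T'.tips T'.P" "\<not> T'.limit_of (q ` branch span) \<xi>"
      using \<xi> zero_less_measure_iff[of T'.p "{\<xi>}"] unfolding T'.special_points_eq full' branch' by auto
    then show "\<xi> \<in> q ` special_points T"
    proof cases
      case 1 then show ?thesis using atom'[OF \<xi>P] by blast
    next
      case 2 then show ?thesis using branch_spec by blast
    next
      case 3
      then obtain x where "x \<in> tips span" "\<not> limit_of (branch span) x" "\<xi> = q x" using tip_from by blast
      then show ?thesis unfolding special_points_eq by blast
    qed
  qed
qed

theorem mass_structural': "mass_structural_isomorphism T T' q"
proof -
  have S: "x \<in> X" "x \<in> P" if "x \<in> special_points T" for x using special_in[OF that] span_X by blast+
  have le: "T'.le (q x) (q y) \<longleftrightarrow> x \<sqsubseteq> y" if xy: "x \<in> special_points T" "y \<in> special_points T" for x y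
    using le_q_iff[OF S(1)[OF xy(1)] S(1)[OF xy(2)]] special_le[OF xy] meet_le[of x y] by auto
  have "inj_on q (special_points T)"
  proof (rule inj_onI)
    fix x y assume xy: "x \<in> special_points T" "y \<in> special_points T" "q x = q y"
    then have "x \<sqsubseteq> y" "y \<sqsubseteq> x" using le[OF xy(1,2)] le[OF xy(2,1)] T'.le_refl[OF q_P] by simp_all
    then show "x = y" using le_antisym le_h by blast
  qed
  then have "bij_betw q (special_points T) (special_points T')" using special_image by (simp add: bij_betw_def)
  then show ?thesis
    unfolding mass_structural_isomorphism_def
    using S le by (simp add: seg_root T'.seg_root fringe_eq T'.fringe_eq below' point' G'_q[unfolded G_def T'.G_def])
qed

end

text \<open>A tree with more than one point contains a segment, so there are enough points for the
  pairs in \<open>'a \<times> real\<close>.\<close>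

lemma (in wtree) collapse_exists: "\<exists>emb :: 'a \<Rightarrow> real \<Rightarrow> 'a. collapse T emb"
proof (cases "P = {r}")
  case True
  \<comment> \<open>In the one-point tree \<open>(r, 0)\<close> is the only pair, and there is
    nothing to encode.\<close>
  have "collapse T (\<lambda>x t. x)"
  proof
    fix x y t u assume a: "x \<in> X" "y \<in> X" "0 \<le> t" "t \<le> H x" "0 \<le> u" "u \<le> H y"
    have xy: "x = r" "y = r" using X_P[OF a(1)] X_P[OF a(2)] True by auto
    then have "t = 0" "u = 0" using a(3-6) by simp_all
    then show "x = y \<longleftrightarrow> t = u \<and> t \<le> c x y" using xy by simp
  qed
  then show ?thesis by blast
next
  case False
  then obtain x where x: "x \<in> P" "x \<noteq> r" using root by blast
  have hx: "0 < h x" using x h_zero_iff[of x] h_nonneg[of x] by linarith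
  \<comment> \<open>The rescaled arctangent maps the reals injectively into the unit interval, so a
    single segment contains a copy of the reals.\<close>
  define g where "g s = pt x (h x * (arctan s / pi + 1 / 2))" for s
  have "0 \<le> arctan s / pi + 1 / 2 \<and> arctan s / pi + 1 / 2 \<le> 1" for s
    using arctan_bounded[of s] pi_gt_zero by (simp add: field_simps)
  then have b: "0 \<le> h x * (arctan s / pi + 1 / 2)" "h x * (arctan s / pi + 1 / 2) \<le> h x" for s
    using hx by (simp_all add: mult_left_le)
  have "inj g"
  proof (rule injI)
    fix s t assume "g s = g t"
    then have "h (g s) = h (g t)" by simp
    then have "h x * (arctan s / pi + 1 / 2) = h x * (arctan t / pi + 1 / 2)"
      unfolding g_def h_pt[OF x(1) b] .
    then show "s = t" using hx by (simp add: arctan_eq_iff)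
  qed
  then have le: "(card_of (UNIV :: real set), card_of (UNIV :: 'a set)) \<in> ordLeq" using card_of_ordLeq[of "UNIV :: real set" "UNIV :: 'a set"] by blast
  have "infinite (UNIV :: 'a set)"
    using \<open>inj g\<close> infinite_UNIV_char_0 finite_imageD[of g UNIV] finite_subset[of "range g" UNIV] by blast
  then have "(card_of ((UNIV :: 'a set) \<times> (UNIV :: real set)), card_of (UNIV :: 'a set)) \<in> ordIso"
    using card_of_Times_infinite[OF _ _ le] by blast
  then obtain \<iota> :: "'a \<times> real \<Rightarrow> 'a" where "bij_betw \<iota> (UNIV \<times> UNIV) UNIV"
    using card_of_ordIso by blast
  then have "inj \<iota>" by (simp add: bij_betw_def)
  then have \<iota>: "\<iota> a = \<iota> b \<longleftrightarrow> a = b" for a b by (rule inj_eq)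
  \<comment> \<open>A canonical representative: the choice depends on \<open>x\<close> only through
    the set of points identified with it at level \<open>t\<close>, so equal classes give equal
    choices.\<close>
  define rp where "rp x t = (SOME y. y \<in> {y \<in> X. t \<le> c x y})" for x t
  have rp: "rp x t \<in> X" "t \<le> c x (rp x t)" if "x \<in> X" "t \<le> H x" for x t
  proof -
    have "x \<in> {y \<in> X. t \<le> c x y}" using that X_P by simp
    then have "rp x t \<in> {y \<in> X. t \<le> c x y}" unfolding rp_def by (rule someI)
    then show "rp x t \<in> X" "t \<le> c x (rp x t)" by simp_all
  qed
  have "collapse T (\<lambda>x t. \<iota> (rp x t, t))"
  proof
    fix x y t u assume a: "x \<in> X" "y \<in> X" "0 \<le> t" "t \<le> H x" "0 \<le> u" "u \<le> H y"
    have P: "x \<in> P" "y \<in> P" using a X_P by blast+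
    have "rp x t = rp y t \<longleftrightarrow> t \<le> c x y" if ty: "t \<le> H y"
    proof
      assume "rp x t = rp y t"
      then have "t \<le> c x (rp x t)" "t \<le> c (rp x t) y" "rp x t \<in> P"
        using rp[OF a(1,4)] rp[OF a(2) ty] X_P c_commute P by simp_all
      then show "t \<le> c x y" using c_hyp[OF P(1) _ P(2)] by fastforce
    next
      assume t: "t \<le> c x y"
      have "t \<le> c x w \<longleftrightarrow> t \<le> c y w" if "w \<in> X" for w
        using c_hyp[OF P(1,2) X_P[OF that]] c_hyp[OF P(2,1) X_P[OF that]] t c_commute[OF P] by linarith
      then have "{w \<in> X. t \<le> c x w} = {w \<in> X. t \<le> c y w}" by blast
      then show "rp x t = rp y t" by (simp add: rp_def)
    qed
    then show "\<iota> (rp x t, t) = \<iota> (rp y u, u) \<longleftrightarrow> t = u \<and> t \<le> c x y" using \<iota> a by auto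
  qed
  then show ?thesis by blast
qed

theorem theorem1:
  fixes C :: "'a rw_tree set"
  assumes "C \<in> {T. rooted_weighted_tree T} // mass_structural_rel"
  shows "\<exists>!I. I \<in> {T. ip_tree T} // isomorphism_rel \<and> I \<subseteq> C"
proof -
  obtain T where T: "rooted_weighted_tree T" "C = mass_structural_rel `` {T}"
    using assms by (auto elim: quotientE)
  interpret wtree T by unfold_locales (rule T(1))
  obtain emb :: "'a \<Rightarrow> real \<Rightarrow> 'a" where "collapse T emb" using collapse_exists by blast
  then interpret collapse T emb .
  have rel: "(T, T') \<in> mass_structural_rel"
    using T(1) rw' mass_structural' by (auto simp: mass_structural_rel_def)
  note eq = equiv_isomorphism_rel equiv_mass_structural_rel
  show ?thesis
  proof (intro ex1I[of _ "isomorphism_rel `` {T'}"] conjI)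
    show "isomorphism_rel `` {T'} \<in> {T. ip_tree T} // isomorphism_rel"
      using ip' by (intro quotientI) simp
    show "isomorphism_rel `` {T'} \<subseteq> C"
    proof
      fix T2 assume "T2 \<in> isomorphism_rel `` {T'}"
      then obtain f where f: "rooted_weighted_tree T2" "tree_isomorphism T' T2 f" by (auto simp: isomorphism_rel_def)
      interpret I: tree_iso T' T2 f by (rule tree_isoI[OF rw' f])
      have "(T', T2) \<in> mass_structural_rel"
        using rw' f(1) I.mass_structural by (auto simp: mass_structural_rel_def)
      then show "T2 \<in> C" using rel T(2) eq(2) by (auto simp: equiv_def dest: transD)
    qed
    fix I assume I: "I \<in> {T. ip_tree T} // isomorphism_rel \<and> I \<subseteq> C"
    then obtain T1 where T1: "ip_tree T1" "I = isomorphism_rel `` {T1}" by (auto elim: quotientE)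
    have rw1: "rooted_weighted_tree T1" using T1(1) by (simp add: ip_tree_def)
    have "T1 \<in> I" using equiv_class_self[OF eq(1), of T1] rw1 T1(2) by simp
    then have "(T, T1) \<in> mass_structural_rel" using I T(2) by blast
    then have "(T1, T') \<in> mass_structural_rel"
      using rel eq(2) by (meson equiv_def symD transD)
    then obtain \<phi> where "mass_structural_isomorphism T1 T' \<phi>" by (auto simp: mass_structural_rel_def)
    then obtain f where "tree_isomorphism T1 T' f" using ip_trees_isomorphic[OF T1(1) ip'] by blast
    then have "(T1, T') \<in> isomorphism_rel" using rw1 rw' by (auto simp: isomorphism_rel_def)
    then show "I = isomorphism_rel `` {T'}" using equiv_class_eq[OF eq(1)] T1(2) by simp
  qed
qed

end
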